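(* Let $S_0$ be the Riemann sphere, the complex plane or the open unit disk, and let $f:S_0\to S_0$ be a rational function that is a branched covering of degree $d$ with $1<d<\infty$. Let $\{x_1,\dots,x_n\}\subset S_0$ be a periodic cycle of $f$ of period $n$, indexed so that $f(x_{i+1})=x_i$ for $1\le i<n$ and $f(x_1)=x_n$, and let $x=(x_1,x_2,\dots)\in S_\infty$ be its invariant lift to the plaque inverse limit, i.e. $x_i=x_{i+n}=x_{i+2n}=\dots$ for all $1\le i\le n$. Let $sq(n)$ denote the binary sequence that has $1$ in the places $n,2n,3n,\dots$ and $0$ in all other places. 1. If the cycle is repelling or Siegel, then $x$ is a regular point; so $sign(x,c)=\{[0,0,\dots]\}$ for every critical point $c$ of $f$. 2. If the cycle is attracting, super-attracting, parabolic or Cremer, then $x$ is an irregular point, and thus has a non-trivial signature (different from $\{[0,0,\dots]\}$) with respect to some critical point. Moreover, with respect to every critical point $c$, $sign(x,c)=shift_{\pm n}(sign(x,c))$. (a) In the attracting and super-attracting cases there are critical points $c_1,\dots,c_m$ of $f$ and integers $0\le k_j<n$ such that $sign(x,c_j)=shift_{k_j}(\alpha[sq(n)])$ for each $j$, and with respect to all other critical points the signature of $x$ is $\{[0,0,\dots]\}$. (b) In the parabolic case there are a critical point $c$ of $f$ and an integer $0\le k<n$ such that $sign(x,c)=shift_k(\alpha[sq(n)])$.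
   Context: Put $S_1=S_2=\dots=S_0$ and $f_i=f:S_{i+1}\to S_i$. The plaque inverse limit $S_\infty$ is the set of all sequences $x=(x_1,x_2,\dots)$ with $x_i\in S_i$ and $f(x_{i+1})=x_i$ for all $i$, with the topology generated by the sets given by sequences $U=(U_1,U_2,\dots)$ of open sets $U_i\subset S_i$ with $f(U_{i+1})=U_i$ for all $i$ (such a $U$ being identified with the set of $x\in S_\infty$ with $x_i\in U_i$ for all $i$). A plaque is such an open set $U$ in which each $U_i$ is conformally equivalent to the unit disk and each $f|_{U_{i+1}}:U_{i+1}\to U_i$ is conformally equivalent to a self-map $z\mapsto z^t$ of the unit disk, $1\le t\le d$. Plaques containing $x$ form a local base at $x$, and open neighborhoods of points of $S_\infty$ are always assumed to be plaques. A point $x\in S_\infty$ is regular if there are an open neighborhood $U$ of $x$ and a positive integer $n_0$ such that $f:U_{i+1}\to U_i$ is a bijection for all $i\ge n_0$; otherwise $x$ is irregular. Let $I$ be the Boolean algebra of binary sequences modulo almost equality (differing in only finitely many places), with coordinatewise operations and order; $[a_1,a_2,\dots]$ (or $[a]$) denotes the class of $a=(a_1,a_2,\dots)$. For $[a]\in I$ let $\alpha[a]=\{b\in I: b\le [a]\}$. For an integer $m$, $shift_m:I\to I$ sends the class of a sequence to the class of the sequence obtained by adjoining $m$ initial $0$ entries if $m\ge0$, or deleting $|m|$ initial entries if $m<0$; it acts on subsets of $I$ by taking images. For an open neighborhood $U\subset S_\infty$ and a critical point $c\in S_0$ of $f$, $ind(U,c)\in I$ is the class of the binary sequence with $1$ in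 the $j$-th place if and only if $c\in U_j$. A sequence $(U(1),U(2),\dots)$ of open neighborhoods of $x$ shrinks to $x$ if $U(i+1)\subset U(i)$ for all $i$ and every open neighborhood of $x$ contains some $U(m)$. The signature of $x$ with respect to $c$ is $sign(x,c)=\bigcap_{j=1}^\infty\alpha(ind(U(j),c))$ for any sequence $(U(1),U(2),\dots)$ of open neighborhoods of $x$ shrinking to $x$ (it does not depend on the choice). The points of a periodic cycle of period $n$ are pairwise different. Its multiplier is $\lambda=(f^n)'(x_1)$. The cycle is repelling if $|\lambda|>1$, attracting if $0<|\lambda|<1$, super-attracting if $\lambda=0$, and neutral if $|\lambda|=1$. A neutral cycle with $\lambda=e^{2\pi\theta i}$ is parabolic if $\theta$ is rational; Siegel if $f^n$ is locally (holomorphically) conjugate, near a point of the cycle, to $z\mapsto e^{2\pi\theta i}z$; and Cremer if $\theta$ is irrational and there is no such conjugation.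
   Formalization: In part 2, (a) and (b) the claims about signatures (not irregularity) assume that some sequence of plaques shrinks to x, so that sign(x,c) is defined; this can fail, e.g. for the fixed point 0 of f(z)=z^3+εz, ε≠0 small, where no plaque contains x. *)

theory Defs
  imports "HOL-Analysis.Analysis" "HOL-Complex_Analysis.Complex_Analysis"
    "HOL-Computational_Algebra.Computational_Algebra"
begin

text \<open>
  The Riemann sphere is \<^typ>\<open>complex option\<close>, with \<^term>\<open>None\<close> as the point at infinity.
  All sequences of the mathematics are indexed from 1; a sequence \<open>(s\<^sub>1, s\<^sub>2, \<dots>)\<close> is the
  function \<open>s\<close> on \<^typ>\<open>nat\<close> whose value at \<open>i\<close> is the entry in place \<open>i + 1\<close>.
\<close>

subsection \<open>The Riemann sphere, holomorphic maps and rational functions\<close>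

definition riemann_sphere :: "complex option topology" where
  "riemann_sphere = Alexandroff_compactification euclidean"

fun sphere_inv :: "complex option \<Rightarrow> complex option" where
  "sphere_inv None = Some 0"
| "sphere_inv (Some z) = (if z = 0 then None else Some (1 / z))"

text \<open>
  \<open>chart p\<close> is the standard chart around \<open>p\<close>: the identity for finite \<open>p\<close> and \<open>1/z\<close> for
  infinity. It is an involution of the sphere, hence also its own inverse.
\<close>

definition chart :: "complex option \<Rightarrow> complex option \<Rightarrow> complex option" where
  "chart p = (if p = None then sphere_inv else id)"

text \<open>Holomorphic maps from an open set of complex numbers into the sphere.\<close>

definition sphere_holomorphic_on :: "(complex \<Rightarrow> complex option) \<Rightarrow> complex set \<Rightarrow> bool" where
  "sphere_holomorphic_on \<phi> A \<longleftrightarrow>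
     (\<forall>z\<in>A. \<exists>e>0. (\<forall>w\<in>ball z e. chart (\<phi> z) (\<phi> w) \<noteq> None) \<and>
        (\<lambda>w. the (chart (\<phi> z) (\<phi> w))) holomorphic_on ball z e)"

text \<open>
  The derivative at \<open>p\<close> of a self-map, in the standard charts around \<open>p\<close> and \<open>f p\<close>. Its
  vanishing is independent of the charts, and so is its value if \<open>f p = p\<close>.
\<close>

definition sphere_deriv :: "(complex option \<Rightarrow> complex option) \<Rightarrow> complex option \<Rightarrow> complex" where
  "sphere_deriv f p =
     deriv (\<lambda>z. the (chart (f p) (f (chart p (Some z))))) (the (chart p p))"

definition critical_points ::
    "complex option set \<Rightarrow> (complex option \<Rightarrow> complex option) \<Rightarrow> complex option set" where
  "critical_points S f = {c \<in> S. sphere_deriv f c = 0}"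

text \<open>For coprime \<open>p\<close> and \<open>q\<close>; the value at infinity is the limit of \<open>p z / q z\<close>.\<close>

fun rational_map :: "complex poly \<Rightarrow> complex poly \<Rightarrow> complex option \<Rightarrow> complex option" where
  "rational_map p q None =
     (if degree p > degree q then None else Some (coeff p (degree q) / lead_coeff q))"
| "rational_map p q (Some z) =
     (if poly q z = 0 then None else Some (poly p z / poly q z))"

definition rational_on ::
    "complex option set \<Rightarrow> (complex option \<Rightarrow> complex option) \<Rightarrow> bool" where
  "rational_on S f \<longleftrightarrow>
     (\<exists>p q. q \<noteq> 0 \<and> coprime p q \<and> (\<forall>z\<in>S. f z = rational_map p q z))"

text \<open>
  A conformal isomorphism from the unit disk onto \<open>U\<close>; the inverse of a holomorphic
  bijection is automatically holomorphic.
\<close>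

definition conformal_from_disk :: "(complex \<Rightarrow> complex option) \<Rightarrow> complex option set \<Rightarrow> bool" where
  "conformal_from_disk \<phi> U \<longleftrightarrow>
     sphere_holomorphic_on \<phi> (ball 0 1) \<and> bij_betw \<phi> (ball 0 1) U"

text \<open>
  \<open>power_in_coordinates f t \<phi> W \<psi> V\<close>: in the coordinates \<open>\<phi>\<close> on \<open>W\<close> and \<open>\<psi>\<close> on \<open>V\<close>, the map
  from \<open>W\<close> to \<open>V\<close> induced by \<open>f\<close> is \<open>z \<mapsto> z\<^sup>t\<close> on the unit disk.
\<close>

definition power_in_coordinates :: "(complex option \<Rightarrow> complex option) \<Rightarrow> nat \<Rightarrow>
    (complex \<Rightarrow> complex option) \<Rightarrow> complex option set \<Rightarrow>
    (complex \<Rightarrow> complex option) \<Rightarrow> complex option set \<Rightarrow> bool" where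
  "power_in_coordinates f t \<phi> W \<psi> V \<longleftrightarrow>
     conformal_from_disk \<phi> W \<and> conformal_from_disk \<psi> V \<and>
     (\<forall>z\<in>ball 0 1. f (\<phi> z) = \<psi> (z ^ t))"

text \<open>
  Every point \<open>y\<close> has a neighborhood \<open>V\<close> whose preimage splits into finitely many sheets \<open>W\<close>,
  on each of which \<open>f\<close> is a power map branched at most over \<open>y\<close>; the exponents add up to \<open>d\<close>.
\<close>

definition branched_covering ::
    "complex option set \<Rightarrow> (complex option \<Rightarrow> complex option) \<Rightarrow> nat \<Rightarrow> bool" where
  "branched_covering S f d \<longleftrightarrow>
     f ` S \<subseteq> S \<and>
     (\<forall>y\<in>S. \<exists>V \<W> t.
        openin riemann_sphere V \<and> y \<in> V \<and> V \<subseteq> S \<and>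
        finite \<W> \<and> disjoint \<W> \<and> \<Union>\<W> = {z \<in> S. f z \<in> V} \<and>
        (\<forall>W\<in>\<W>. openin riemann_sphere W \<and> 1 \<le> t W \<and>
           (\<exists>\<phi> \<psi>. power_in_coordinates f (t W) \<phi> W \<psi> V \<and> \<psi> 0 = y)) \<and>
        (\<Sum>W\<in>\<W>. t W) = d)"

subsection \<open>The plaque inverse limit\<close>

definition plaque_limit ::
    "complex option set \<Rightarrow> (complex option \<Rightarrow> complex option) \<Rightarrow> (nat \<Rightarrow> complex option) set" where
  "plaque_limit S f = {x. \<forall>i. x i \<in> S \<and> f (x (Suc i)) = x i}"

definition open_seq :: "complex option set \<Rightarrow> (complex option \<Rightarrow> complex option) \<Rightarrow>
    (nat \<Rightarrow> complex option set) \<Rightarrow> bool" where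
  "open_seq S f U \<longleftrightarrow>
     (\<forall>i. U i \<subseteq> S \<and> openin riemann_sphere (U i) \<and> f ` U (Suc i) = U i)"

text \<open>The set of points of the plaque inverse limit with which such a sequence is identified.\<close>

definition points_of :: "complex option set \<Rightarrow> (complex option \<Rightarrow> complex option) \<Rightarrow>
    (nat \<Rightarrow> complex option set) \<Rightarrow> (nat \<Rightarrow> complex option) set" where
  "points_of S f U = {x \<in> plaque_limit S f. \<forall>i. x i \<in> U i}"

definition plaque :: "complex option set \<Rightarrow> (complex option \<Rightarrow> complex option) \<Rightarrow> nat \<Rightarrow>
    (nat \<Rightarrow> complex option set) \<Rightarrow> bool" where
  "plaque S f d U \<longleftrightarrow>
     open_seq S f U \<and>
     (\<forall>i. \<exists>\<phi>. conformal_from_disk \<phi> (U i)) \<and>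
     (\<forall>i. \<exists>t\<in>{1..d}. \<exists>\<phi> \<psi>. power_in_coordinates f t \<phi> (U (Suc i)) \<psi> (U i))"

text \<open>Open neighborhoods of points of the plaque inverse limit are by convention plaques.\<close>

definition nbhd :: "complex option set \<Rightarrow> (complex option \<Rightarrow> complex option) \<Rightarrow> nat \<Rightarrow>
    (nat \<Rightarrow> complex option) \<Rightarrow> (nat \<Rightarrow> complex option set) \<Rightarrow> bool" where
  "nbhd S f d x U \<longleftrightarrow> plaque S f d U \<and> x \<in> points_of S f U"

definition regular_point :: "complex option set \<Rightarrow> (complex option \<Rightarrow> complex option) \<Rightarrow> nat \<Rightarrow>
    (nat \<Rightarrow> complex option) \<Rightarrow> bool" where
  "regular_point S f d x \<longleftrightarrow>
     x \<in> plaque_limit S f \<and>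
     (\<exists>U n0. nbhd S f d x U \<and> (\<forall>i\<ge>n0. bij_betw f (U (Suc i)) (U i)))"

definition irregular_point :: "complex option set \<Rightarrow> (complex option \<Rightarrow> complex option) \<Rightarrow> nat \<Rightarrow>
    (nat \<Rightarrow> complex option) \<Rightarrow> bool" where
  "irregular_point S f d x \<longleftrightarrow> x \<in> plaque_limit S f \<and> \<not> regular_point S f d x"

subsection \<open>Binary sequences modulo almost equality\<close>

definition almost_eq :: "(nat \<Rightarrow> bool) \<Rightarrow> (nat \<Rightarrow> bool) \<Rightarrow> bool" where
  "almost_eq a b \<longleftrightarrow> finite {j. a j \<noteq> b j}"

lemma almost_eq_iff: "almost_eq a b \<longleftrightarrow> (\<forall>\<^sub>F j in sequentially. a j = b j)"
  unfolding almost_eq_def cofinite_eq_sequentially[symmetric] eventually_cofinite by simp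

lemma finite_Collect_not_iff: "finite {j::nat. \<not> P j} \<longleftrightarrow> (\<forall>\<^sub>F j in sequentially. P j)"
  by (simp add: cofinite_eq_sequentially[symmetric] eventually_cofinite)

quotient_type binseq_class = "nat \<Rightarrow> bool" / almost_eq
proof (intro equivpI reflpI sympI transpI)
  fix a b c :: "nat \<Rightarrow> bool"
  show "almost_eq a a" by (simp add: almost_eq_def)
  show "almost_eq b a" if "almost_eq a b"
    using that by (simp add: almost_eq_def eq_commute)
  show "almost_eq a c" if "almost_eq a b" "almost_eq b c"
    using that unfolding almost_eq_iff by eventually_elim simp
qed

lift_definition class_of :: "(nat \<Rightarrow> bool) \<Rightarrow> binseq_class" is "\<lambda>a. a" .

instantiation binseq_class :: boolean_algebra
begin

lift_definition less_eq_binseq_class :: "binseq_class \<Rightarrow> binseq_class \<Rightarrow> bool"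
  is "\<lambda>a b. finite {j. \<not> (a j \<longrightarrow> b j)}"
proof -
  fix a a' b b' :: "nat \<Rightarrow> bool"
  assume "almost_eq a a'" "almost_eq b b'"
  then have "\<forall>\<^sub>F j in sequentially. (a j \<longrightarrow> b j) = (a' j \<longrightarrow> b' j)"
    unfolding almost_eq_iff by eventually_elim simp
  then show "finite {j. \<not> (a j \<longrightarrow> b j)} = finite {j. \<not> (a' j \<longrightarrow> b' j)}"
    unfolding finite_Collect_not_iff by (rule eventually_subst)
qed

definition less_binseq_class :: "binseq_class \<Rightarrow> binseq_class \<Rightarrow> bool" where
  "less_binseq_class a b \<longleftrightarrow> a \<le> b \<and> \<not> b \<le> a"

lift_definition inf_binseq_class :: "binseq_class \<Rightarrow> binseq_class \<Rightarrow> binseq_class"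
  is "\<lambda>a b j. a j \<and> b j"
  unfolding almost_eq_iff by (erule (1) eventually_elim2) simp

lift_definition sup_binseq_class :: "binseq_class \<Rightarrow> binseq_class \<Rightarrow> binseq_class"
  is "\<lambda>a b j. a j \<or> b j"
  unfolding almost_eq_iff by (erule (1) eventually_elim2) simp

lift_definition uminus_binseq_class :: "binseq_class \<Rightarrow> binseq_class"
  is "\<lambda>a j. \<not> a j"
  unfolding almost_eq_iff by simp

lift_definition minus_binseq_class :: "binseq_class \<Rightarrow> binseq_class \<Rightarrow> binseq_class"
  is "\<lambda>a b j. a j \<and> \<not> b j"
  unfolding almost_eq_iff by (erule (1) eventually_elim2) simp

lift_definition bot_binseq_class :: binseq_class is "\<lambda>_. False" .

lift_definition top_binseq_class :: binseq_class is "\<lambda>_. True" .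

instance
proof
  fix x y z :: binseq_class
  show "x < y \<longleftrightarrow> x \<le> y \<and> \<not> y \<le> x"
    by (rule less_binseq_class_def)
  show "x \<le> x" by transfer simp
  show "x \<le> z" if "x \<le> y" "y \<le> z"
    using that by transfer (unfold finite_Collect_not_iff, erule (1) eventually_elim2, blast)
  show "x = y" if "x \<le> y" "y \<le> x"
    using that
    by transfer (unfold finite_Collect_not_iff almost_eq_iff, erule (1) eventually_elim2, blast)
  show "inf x y \<le> x" "inf x y \<le> y" "x \<le> sup x y" "y \<le> sup x y" "bot \<le> x" "x \<le> top"
    by (transfer; simp)+
  show "x \<le> inf y z" if "x \<le> y" "x \<le> z"
    using that by transfer (unfold finite_Collect_not_iff, erule (1) eventually_elim2, blast)
  show "sup y z \<le> x" if "y \<le> x" "z \<le> x"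
    using that by transfer (unfold finite_Collect_not_iff, erule (1) eventually_elim2, blast)
  show "sup x (inf y z) = inf (sup x y) (sup x z)"
    by transfer (simp add: almost_eq_iff disj_conj_distribL)
  show "inf x (- x) = bot" "sup x (- x) = top" "x - y = inf x (- y)"
    by (transfer; simp add: almost_eq_iff)+
qed

end

definition alpha :: "binseq_class \<Rightarrow> binseq_class set" where
  "alpha a = {b. b \<le> a}"

definition shift_seq :: "int \<Rightarrow> (nat \<Rightarrow> bool) \<Rightarrow> nat \<Rightarrow> bool" where
  "shift_seq m a j =
     (if m \<ge> 0 then nat m \<le> j \<and> a (j - nat m) else a (j + nat (- m)))"

lift_definition shift :: "int \<Rightarrow> binseq_class \<Rightarrow> binseq_class" is shift_seq
proof -
  fix m :: int and a b :: "nat \<Rightarrow> bool"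
  assume "almost_eq a b"
  then obtain N where N: "\<And>j. j \<ge> N \<Longrightarrow> a j = b j"
    unfolding almost_eq_iff eventually_sequentially by blast
  have "shift_seq m a j = shift_seq m b j" if "j \<ge> N + nat m" for j
    using that by (auto simp: shift_seq_def N)
  then show "almost_eq (shift_seq m a) (shift_seq m b)"
    unfolding almost_eq_iff eventually_sequentially by blast
qed

text \<open>Ones exactly in the places \<open>n\<close>, \<open>2n\<close>, \<open>3n\<close>, \dots, i.e. at the indices \<open>j\<close> with \<open>n\<close> dividing \<open>j + 1\<close>.\<close>

definition sq :: "nat \<Rightarrow> nat \<Rightarrow> bool" where
  "sq n j \<longleftrightarrow> n dvd Suc j"

subsection \<open>The signature\<close>

definition ind :: "(nat \<Rightarrow> complex option set) \<Rightarrow> complex option \<Rightarrow> binseq_class" where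
  "ind U c = class_of (\<lambda>j. c \<in> U j)"

definition shrinks_to :: "complex option set \<Rightarrow> (complex option \<Rightarrow> complex option) \<Rightarrow> nat \<Rightarrow>
    (nat \<Rightarrow> nat \<Rightarrow> complex option set) \<Rightarrow> (nat \<Rightarrow> complex option) \<Rightarrow> bool" where
  "shrinks_to S f d U x \<longleftrightarrow>
     (\<forall>j. nbhd S f d x (U j)) \<and>
     (\<forall>j. points_of S f (U (Suc j)) \<subseteq> points_of S f (U j)) \<and>
     (\<forall>V. nbhd S f d x V \<longrightarrow> (\<exists>m. points_of S f (U m) \<subseteq> points_of S f V))"

text \<open>
  By \<open>signature_eq\<close> below this is the intersection for any sequence shrinking to \<open>x\<close>. It is
  meaningful only if the plaques containing \<open>x\<close> form a local base at \<open>x\<close> in the sense that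
  such a sequence exists (\<open>has_plaque_base\<close>). This is not automatic: since \<open>z \<mapsto> z\<^sup>t\<close> is proper,
  each \<open>U (Suc i)\<close> of a plaque is a whole component of the preimage of \<open>U i\<close>, with at most one
  critical point. For \<open>f z = z\<^sup>3 + \<epsilon> z\<close>, \<open>\<epsilon> \<noteq> 0\<close> small, and the invariant lift of the fixed point 0,
  these components finally contain both critical points, so no plaque contains that point.
\<close>

definition signature :: "complex option set \<Rightarrow> (complex option \<Rightarrow> complex option) \<Rightarrow> nat \<Rightarrow>
    (nat \<Rightarrow> complex option) \<Rightarrow> complex option \<Rightarrow> binseq_class set" where
  "signature S f d x c =
     (THE s. \<exists>U. shrinks_to S f d U x \<and> s = (\<Inter>j. alpha (ind (U j) c)))"

definition has_plaque_base :: "complex option set \<Rightarrow> (complex option \<Rightarrow> complex option) \<Rightarrow> nat \<Rightarrow>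
    (nat \<Rightarrow> complex option) \<Rightarrow> bool" where
  "has_plaque_base S f d x \<longleftrightarrow> (\<exists>U. shrinks_to S f d U x)"

lemma points_of_through:
  assumes U: "open_seq S f U" and y: "y \<in> U i"
  obtains z where "z \<in> points_of S f U" "z i = y"
proof -
  have img: "f ` U (Suc j) = U j" and US: "U j \<subseteq> S" for j
    using U by (simp_all add: open_seq_def)
  define g where "g j w = (SOME v. v \<in> U (Suc j) \<and> f v = w)" for j w
  have g: "g j w \<in> U (Suc j)" "f (g j w) = w" if "w \<in> U j" for j w
  proof -
    have "\<exists>v. v \<in> U (Suc j) \<and> f v = w"
      using that unfolding img[of j, symmetric] by (elim imageE) (intro exI conjI, auto)
    from someI_ex[OF this] show "g j w \<in> U (Suc j)" "f (g j w) = w"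
      unfolding g_def by simp_all
  qed
  define up where "up = rec_nat y (\<lambda>k w. g (i + k) w)"
  have up0: "up 0 = y" and upS: "up (Suc k) = g (i + k) (up k)" for k
    by (simp_all add: up_def)
  have upU: "up k \<in> U (i + k)" for k
  proof (induction k)
    case (Suc k)
    then show ?case using g(1)[of "up k" "i + k"] by (simp add: upS)
  qed (simp add: up0 y)
  have dn: "(f ^^ k) y \<in> U (i - k)" if "k \<le> i" for k
    using that
  proof (induction k)
    case (Suc k)
    then have "(f ^^ k) y \<in> U (Suc (i - Suc k))" by (simp add: Suc_diff_Suc)
    then show ?case using imageI[of _ _ f] img[of "i - Suc k"] by fastforce
  qed (simp add: y)
  define z where "z j = (if j \<le> i then (f ^^ (i - j)) y else up (j - i))" for j
  have zU: "z j \<in> U j" for j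
    using dn[of "i - j"] upU[of "j - i"] by (cases "j \<le> i") (simp_all add: z_def)
  have zf: "f (z (Suc j)) = z j" for j
  proof (cases "j < i")
    case True
    then have "i - j = Suc (i - Suc j)" by simp
    with True show ?thesis by (simp add: z_def)
  next
    case False
    then have "Suc j - i = Suc (j - i)" and ij: "i + (j - i) = j" by linarith+
    then have "f (z (Suc j)) = up (j - i)"
      using False g(2)[OF upU[of "j - i"]] by (simp add: z_def upS)
    also have "\<dots> = z j"
      using False by (cases "j = i") (simp_all add: z_def up0)
    finally show ?thesis .
  qed
  have "z \<in> points_of S f U"
    using zU zf subsetD[OF US zU] by (simp add: points_of_def plaque_limit_def)
  moreover have "z i = y" by (simp add: z_def)
  ultimately show ?thesis by (rule that)
qed

lemma ind_mono:
  assumes "open_seq S f U" "points_of S f U \<subseteq> points_of S f V"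
  shows "ind U c \<le> ind V c"
proof -
  have "U i \<subseteq> V i" for i
  proof
    fix y assume "y \<in> U i"
    then obtain z where "z \<in> points_of S f U" "z i = y"
      using points_of_through[OF assms(1)] by blast
    then show "y \<in> V i" using assms(2) by (auto simp: points_of_def)
  qed
  then have "{j. \<not> (c \<in> U j \<longrightarrow> c \<in> V j)} = {}" by auto
  then show ?thesis
    by (simp add: ind_def class_of.abs_eq less_eq_binseq_class.abs_eq del: not_imp)
qed

lemma signature_eq:
  assumes "shrinks_to S f d U x"
  shows "signature S f d x c = (\<Inter>j. alpha (ind (U j) c))"
proof -
  have le: "(\<Inter>j. alpha (ind (A j) c)) \<subseteq> (\<Inter>j. alpha (ind (B j) c))"
    if A: "shrinks_to S f d A x" and B: "shrinks_to S f d B x" for A B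
  proof (intro INT_greatest)
    fix j
    have "nbhd S f d x (B j)"
      using B by (simp add: shrinks_to_def)
    then obtain m where "points_of S f (A m) \<subseteq> points_of S f (B j)"
      using A by (auto simp: shrinks_to_def)
    moreover have "open_seq S f (A m)"
      using A by (simp add: shrinks_to_def nbhd_def plaque_def)
    ultimately have "ind (A m) c \<le> ind (B j) c" by (intro ind_mono)
    then have "alpha (ind (A m) c) \<subseteq> alpha (ind (B j) c)"
      unfolding alpha_def using order_trans by blast
    then show "(\<Inter>j. alpha (ind (A j) c)) \<subseteq> alpha (ind (B j) c)" by blast
  qed
  show ?thesis unfolding signature_def
  proof (rule the_equality)
    show "\<exists>V. shrinks_to S f d V x \<and>
        (\<Inter>j. alpha (ind (U j) c)) = (\<Inter>j. alpha (ind (V j) c))"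
      using assms by (intro exI[of _ U]) simp
    fix s assume "\<exists>V. shrinks_to S f d V x \<and> s = (\<Inter>j. alpha (ind (V j) c))"
    then obtain V where V: "shrinks_to S f d V x" and s: "s = (\<Inter>j. alpha (ind (V j) c))"
      by (elim exE conjE)
    show "s = (\<Inter>j. alpha (ind (U j) c))"
      unfolding s using le[OF V assms] le[OF assms V] by (rule subset_antisym)
  qed
qed

subsection \<open>Periodic cycles\<close>

text \<open>The cycle \<open>x\<^sub>1, \<dots>, x\<^sub>n\<close> consists of \<open>p 0, \<dots>, p (n - 1)\<close>; \<open>f\<close> decreases the index.\<close>

definition periodic_cycle :: "complex option set \<Rightarrow> (complex option \<Rightarrow> complex option) \<Rightarrow> nat \<Rightarrow>
    (nat \<Rightarrow> complex option) \<Rightarrow> bool" where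
  "periodic_cycle S f n p \<longleftrightarrow>
     n \<ge> 1 \<and> inj_on p {..<n} \<and> p ` {..<n} \<subseteq> S \<and>
     (\<forall>i. Suc i < n \<longrightarrow> f (p (Suc i)) = p i) \<and> f (p 0) = p (n - 1)"

definition invariant_lift :: "nat \<Rightarrow> (nat \<Rightarrow> complex option) \<Rightarrow> nat \<Rightarrow> complex option" where
  "invariant_lift n p i = p (i mod n)"

definition multiplier ::
    "(complex option \<Rightarrow> complex option) \<Rightarrow> nat \<Rightarrow> (nat \<Rightarrow> complex option) \<Rightarrow> complex" where
  "multiplier f n p = sphere_deriv (f ^^ n) (p 0)"

text \<open>Near \<open>a\<close>, the map \<open>g\<close> is holomorphically conjugate to \<open>z \<mapsto> \<mu> z\<close> near 0 (with \<open>\<bar>\<mu>\<bar> = 1\<close>).\<close>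

definition conjugate_to_rotation ::
    "(complex option \<Rightarrow> complex option) \<Rightarrow> complex \<Rightarrow> complex option \<Rightarrow> bool" where
  "conjugate_to_rotation g \<mu> a \<longleftrightarrow>
     (\<exists>r>0. \<exists>h. sphere_holomorphic_on h (ball 0 r) \<and> inj_on h (ball 0 r) \<and> h 0 = a \<and>
        (\<forall>z\<in>ball 0 r. g (h z) = h (\<mu> * z)))"

definition repelling ::
    "(complex option \<Rightarrow> complex option) \<Rightarrow> nat \<Rightarrow> (nat \<Rightarrow> complex option) \<Rightarrow> bool" where
  "repelling f n p \<longleftrightarrow> cmod (multiplier f n p) > 1"

definition attracting ::
    "(complex option \<Rightarrow> complex option) \<Rightarrow> nat \<Rightarrow> (nat \<Rightarrow> complex option) \<Rightarrow> bool" where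
  "attracting f n p \<longleftrightarrow> 0 < cmod (multiplier f n p) \<and> cmod (multiplier f n p) < 1"

definition super_attracting ::
    "(complex option \<Rightarrow> complex option) \<Rightarrow> nat \<Rightarrow> (nat \<Rightarrow> complex option) \<Rightarrow> bool" where
  "super_attracting f n p \<longleftrightarrow> multiplier f n p = 0"

definition neutral_with_angle ::
    "(complex option \<Rightarrow> complex option) \<Rightarrow> nat \<Rightarrow> (nat \<Rightarrow> complex option) \<Rightarrow> real \<Rightarrow> bool" where
  "neutral_with_angle f n p \<theta> \<longleftrightarrow>
     cmod (multiplier f n p) = 1 \<and> multiplier f n p = exp (2 * of_real pi * of_real \<theta> * \<i>)"

definition parabolic ::
    "(complex option \<Rightarrow> complex option) \<Rightarrow> nat \<Rightarrow> (nat \<Rightarrow> complex option) \<Rightarrow> bool" where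
  "parabolic f n p \<longleftrightarrow> (\<exists>\<theta>. neutral_with_angle f n p \<theta> \<and> \<theta> \<in> \<rat>)"

definition siegel ::
    "(complex option \<Rightarrow> complex option) \<Rightarrow> nat \<Rightarrow> (nat \<Rightarrow> complex option) \<Rightarrow> bool" where
  "siegel f n p \<longleftrightarrow> (\<exists>\<theta>. neutral_with_angle f n p \<theta> \<and>
     (\<exists>i<n. conjugate_to_rotation (f ^^ n) (exp (2 * of_real pi * of_real \<theta> * \<i>)) (p i)))"

definition cremer ::
    "(complex option \<Rightarrow> complex option) \<Rightarrow> nat \<Rightarrow> (nat \<Rightarrow> complex option) \<Rightarrow> bool" where
  "cremer f n p \<longleftrightarrow> (\<exists>\<theta>. neutral_with_angle f n p \<theta> \<and> \<theta> \<notin> \<rat> \<and>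
     \<not> (\<exists>i<n. conjugate_to_rotation (f ^^ n) (exp (2 * of_real pi * of_real \<theta> * \<i>)) (p i)))"

end

(*
A connected set that f maps into one entry of a plaque, and that meets the next entry, is contained
in that next entry, because z^t is proper on the disk. So a plaque around x is determined by its
first entry, and a conformal disk in the first entry always extends to a plaque. Hence plaques over
small round disks form a base at x, and signatures can be read off from it.

Repelling and Siegel cycles: a local inverse branch of f^n maps a disk into itself, and its iterates
give univalent plaques.

Attracting cycles: the base consists of plaques with U(i) contained in U(i + n), so a critical point
eventually stays in the entries of a single residue class modulo n.

Irregularity: on a univalent plaque the inverse branches of the iterates of f^n omit three points of
a backward orbit, so by Schottky's theorem they are uniformly bounded. This contradicts an
attracting multiplier, and in the neutral case averaging the branches linearizes f^n.

Parabolic cycles: the same bound shows that large disks in a petal cannot all be pulled back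
univalently, which produces a critical point that is joined to the cycle inside the parabolic basin.
*)
theory Submission
  imports Defs
begin

subsection \<open>Charts and the topology of the sphere\<close>

text \<open>The delicate point is the existence of plaques: around a given \<open>x\<close> there
  may be none. Regular points get theirs by explicit construction. The statements about signatures
  in the irregular cases start from one given plaque, and all others come from shrinking its first
  entry, possibly around another backward orbit, or from shifting it by whole periods. Three omitted
  points are obtained for two different reasons. On a univalent plaque \<open>f ^^ (n * k)\<close>
  is injective on the entry at index \<open>n * k\<close>, which contains \<open>x 0\<close>, so
  that no other preimage of \<open>x 0\<close> lies there; such preimages exist because
  \<open>1 < d\<close> and the multiplier is nonzero. In a petal, disks are lifted from a point off
  the cycle, and the omitted points are excluded because they are mapped to \<open>x 0\<close>,
  which is not in the petal. The parabolic contradiction compares two rates of growth in the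
  half-plane coordinate: after \<open>k\<close> steps the disk to be lifted has radius at least
  \<open>1 + k / 2\<close>, while the derivative of the \<open>k\<close>-th iterate is at most
  \<open>sqrt (k + 1)\<close>.\<close>

definition pt :: "complex option \<Rightarrow> complex \<Rightarrow> complex option" where
  "pt p z = chart p (Some z)"

text \<open>\<open>the None\<close> leaves \<open>co p s\<close> arbitrary at the one point that the
  chart at \<open>p\<close> sends to infinity, so statements about coordinates carry the side
  condition \<open>chart p s \<noteq> None\<close>.\<close>

definition co :: "complex option \<Rightarrow> complex option \<Rightarrow> complex" where
  "co p s = the (chart p s)"

lemma chart_chart [simp]: "chart p (chart p s) = s"
  by (cases s) (auto simp: chart_def)

lemma chart_self [simp]: "chart p p \<noteq> None"
  by (cases p) (auto simp: chart_def)

lemma chart_pt [simp]: "chart p (pt p z) = Some z"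
  by (simp add: pt_def)

lemma co_pt [simp]: "co p (pt p z) = z"
  by (simp add: co_def)

lemma pt_co: "chart p s \<noteq> None \<Longrightarrow> pt p (co p s) = s"
  by (simp add: co_def pt_def)

lemma inj_pt: "inj (pt p)"
  by (metis co_pt injI)

lemma co_eq_iff: "chart p s \<noteq> None \<Longrightarrow> chart p t \<noteq> None \<Longrightarrow> co p s = co p t \<longleftrightarrow> s = t"
  by (metis pt_co)

lemma co_change_same: "(p = None) = (q = None) \<Longrightarrow> co q s = co p s"
  by (simp add: co_def chart_def)

text \<open>There are only two charts, so a change of coordinates is the identity or the inversion;
  chart independence below always rests on these two cases.\<close>

lemma co_change_inverse:
  assumes "chart p s \<noteq> None" "chart q s \<noteq> None" "(p = None) \<noteq> (q = None)"
  shows "co q s = inverse (co p s)" "co p s \<noteq> 0"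
  using assms by (cases s; auto simp: co_def chart_def divide_inverse split: if_splits)+

lemma chart_other: "chart p s \<noteq> None \<Longrightarrow> co p s \<noteq> 0 \<Longrightarrow> chart q s \<noteq> None"
  by (cases s) (auto simp: co_def chart_def split: if_splits)

lemma open_inverse_vimage: "open (V::complex set) \<Longrightarrow> open {z. z \<noteq> 0 \<and> inverse z \<in> V}"
proof -
  assume "open V"
  moreover have "continuous_on (- {0}) (inverse :: complex \<Rightarrow> complex)"
    by (intro continuous_intros) auto
  ultimately have "open (- {0} \<inter> inverse -` V)"
    by (intro continuous_open_preimage) auto
  moreover have "- {0} \<inter> inverse -` V = {z. z \<noteq> 0 \<and> inverse z \<in> V}" by auto
  ultimately show ?thesis by simp
qed

text \<open>Neighborhoods of infinity are complements of compact sets; in the coordinate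
  \<open>1 / z\<close>, boundedness of such a complement becomes the presence of a disk around
  0.\<close>

lemma openin_sphere_iff:
  "openin riemann_sphere U \<longleftrightarrow> open {z. Some z \<in> U} \<and> open {z. sphere_inv (Some z) \<in> U}"
proof
  assume "openin riemann_sphere U"
  then consider V where "open V" "U = Some ` V"
    | C where "compact C" "U = insert None (Some ` (UNIV - C))"
    unfolding riemann_sphere_def openin_Alexandroff_compactification by auto
  then show "open {z. Some z \<in> U} \<and> open {z. sphere_inv (Some z) \<in> U}"
  proof cases
    case (1 V)
    have "{z. sphere_inv (Some z) \<in> U} = {z. z \<noteq> 0 \<and> inverse z \<in> V}"
      using 1 by (auto simp: divide_inverse split: if_splits)
    moreover have "{z. Some z \<in> U} = V" using 1 by auto
    ultimately show ?thesis using 1 open_inverse_vimage by simp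
  next
    case (2 C)
    obtain B where B: "B > 0" "\<And>c. c \<in> C \<Longrightarrow> norm c < B"
      using \<open>compact C\<close> compact_imp_bounded bounded_pos_less by metis
    \<comment> \<open>The disk supplies openness at 0, the coordinate of infinity: inverses of its
      nonzero points have norm above \<open>B\<close> and hence lie outside
      \<open>C\<close>.\<close>
    have "{z. sphere_inv (Some z) \<in> U} = {z. z \<noteq> 0 \<and> inverse z \<in> - C} \<union> ball 0 (1 / B)"
    proof -
      have "inverse z \<notin> C" if "norm z < 1 / B" "z \<noteq> 0" for z
      proof -
        have "B * norm z < 1" using that(1) B(1) by (simp add: pos_less_divide_eq mult.commute)
        then have "B < inverse (norm z)" using that(2) by (simp add: inverse_eq_divide pos_less_divide_eq)
        then show ?thesis using B(2)[of "inverse z"] by (auto simp: norm_inverse)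
      qed
      then show ?thesis using 2 B(1) by (auto simp: divide_inverse split: if_splits)
    qed
    moreover have "{z. Some z \<in> U} = - C" using 2 by auto
    moreover have "open (- C)" using \<open>compact C\<close> by (simp add: open_Compl compact_imp_closed)
    ultimately show ?thesis using open_inverse_vimage[of "- C"] by auto
  qed
next
  assume *: "open {z. Some z \<in> U} \<and> open {z. sphere_inv (Some z) \<in> U}"
  show "openin riemann_sphere U"
  proof (cases "None \<in> U")
    case False
    have "s \<in> U \<longleftrightarrow> s \<in> Some ` {z. Some z \<in> U}" for s
      using False by (cases s) auto
    then have "U = Some ` {z. Some z \<in> U}" by blast
    then show ?thesis
      using * openin_Alexandroff_compactification_image_Some open_openin
      unfolding riemann_sphere_def by metis
  next
    case True
    define C where "C = - {z. Some z \<in> U}"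
    have "0 \<in> {z. sphere_inv (Some z) \<in> U}" using True by simp
    then obtain e where e: "e > 0" "ball 0 e \<subseteq> {z. sphere_inv (Some z) \<in> U}"
      using * open_contains_ball by metis
    have "norm c \<le> 1 / e" if "c \<in> C" for c
    proof (rule ccontr)
      assume "\<not> norm c \<le> 1 / e"
      then have "1 < e * norm c" using e(1) by (simp add: not_le pos_divide_less_eq mult.commute)
      then have c: "c \<noteq> 0" "norm c > 0" by auto
      have "inverse (norm c) < e"
        using c(2) \<open>1 < e * norm c\<close> by (simp add: inverse_eq_divide pos_divide_less_eq)
      then have "norm (inverse c) < e" by (simp add: norm_inverse)
      then have "inverse c \<in> ball 0 e" by simp
      with e(2) have "inverse c \<in> {z. sphere_inv (Some z) \<in> U}" by (rule subsetD)
      then show False using that c(1) by (simp add: C_def divide_inverse)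
    qed
    then have "bounded C" unfolding bounded_iff by blast
    moreover have "closed C" unfolding C_def using * by (simp add: closed_Compl)
    ultimately have "compact C" by (simp add: compact_eq_bounded_closed)
    moreover have "U = insert None (Some ` (UNIV - C))"
    proof (rule set_eqI)
      fix s show "s \<in> U \<longleftrightarrow> s \<in> insert None (Some ` (UNIV - C))"
        using True by (cases s) (auto simp: C_def)
    qed
    ultimately show ?thesis
      unfolding riemann_sphere_def openin_Alexandroff_compactification
      by (metis closed_closedin compactin_euclidean_iff compact_imp_closed topspace_euclidean)
  qed
qed

lemma topspace_sphere [simp]: "topspace riemann_sphere = UNIV"
  by (auto simp: riemann_sphere_def intro: UNIV_option_conv[symmetric])
     (metis not_Some_eq rangeI)

lemma Hausdorff_sphere: "Hausdorff_space riemann_sphere"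
  by (simp add: riemann_sphere_def Hausdorff_space_Alexandroff_compactification
      locally_compact_space_euclidean)

lemma open_pt_vimage: "openin riemann_sphere U \<Longrightarrow> open {z. pt p z \<in> U}"
  by (cases "p = None") (auto simp: openin_sphere_iff pt_def chart_def)

lemma openin_sphereI:
  assumes "\<And>p. p \<in> U \<Longrightarrow> \<exists>V. openin riemann_sphere V \<and> p \<in> V \<and> V \<subseteq> U"
  shows "openin riemann_sphere U"
  using assms openin_subopen by metis

text \<open>Openness has to be tested in both charts; seen from the other one, the set is the
  preimage of \<open>A\<close> under inversion with 0 removed.\<close>

lemma openin_pt_image: "open A \<Longrightarrow> openin riemann_sphere (pt p ` A)"
proof -
  assume A: "open A"
  have 1: "open {z. pt q z \<in> pt p ` A}" for q
  proof (cases "(p = None) = (q = None)")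
    case True
    then have "pt q = pt p" by (auto simp: pt_def chart_def fun_eq_iff)
    then show ?thesis using A inj_image_mem_iff[OF inj_pt] by simp
  next
    case False
    have "{z. pt q z \<in> pt p ` A} = {z. z \<noteq> 0 \<and> inverse z \<in> A}"
    proof (rule set_eqI)
      fix z
      have "pt q z \<in> pt p ` A \<longleftrightarrow> z \<noteq> 0 \<and> inverse z \<in> A"
      proof
        assume "pt q z \<in> pt p ` A"
        then obtain a where a: "a \<in> A" "pt q z = pt p a" by auto
        then have "chart p (pt q z) \<noteq> None" by simp
        then have "co p (pt q z) = inverse (co q (pt q z))" "co q (pt q z) \<noteq> 0"
          using co_change_inverse[of q "pt q z" p] False by auto
        moreover have "co q (pt q z) = z" by (rule co_pt)
        moreover have "co p (pt q z) = a" unfolding a(2) by (rule co_pt)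
        ultimately have "a = inverse z" "z \<noteq> 0" by simp_all
        then show "z \<noteq> 0 \<and> inverse z \<in> A" using a(1) by simp
      next
        assume z: "z \<noteq> 0 \<and> inverse z \<in> A"
        then have c: "chart p (pt q z) \<noteq> None" using chart_other[of q "pt q z" p] by simp
        then have "co p (pt q z) = inverse z" using co_change_inverse[of q "pt q z" p] False by auto
        then have "pt q z = pt p (inverse z)" using pt_co[OF c] by simp
        then show "pt q z \<in> pt p ` A" using z by simp
      qed
      then show "z \<in> {z. pt q z \<in> pt p ` A} \<longleftrightarrow> z \<in> {z. z \<noteq> 0 \<and> inverse z \<in> A}" by simp
    qed
    then show ?thesis using open_inverse_vimage[OF A] by simp
  qed
  show ?thesis unfolding openin_sphere_iff
    using 1[of "Some 0"] 1[of None] by (simp add: pt_def chart_def)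
qed

lemma openin_chart_domain: "openin riemann_sphere {s. chart p s \<noteq> None}"
proof -
  have "{s. chart p s \<noteq> None} = pt p ` UNIV"
    by (auto simp: image_iff) (metis chart_chart pt_def)
  then show ?thesis using openin_pt_image[of UNIV p] by simp
qed

subsection \<open>Holomorphic maps into the sphere\<close>

text \<open>The definition uses the chart at the value \<open>\<phi> z\<close>, which may change
  from point to point. As two charts differ at most by an inversion, one fixed chart serves wherever
  it is finite.\<close>

lemma sphere_holomorphic_coord:
  assumes "sphere_holomorphic_on \<phi> A" "open A" "\<And>z. z \<in> A \<Longrightarrow> chart p (\<phi> z) \<noteq> None"
  shows "(\<lambda>z. co p (\<phi> z)) holomorphic_on A"
proof (rule holomorphic_onI)
  fix z assume z: "z \<in> A"
  then obtain e where e: "e > 0" "\<And>w. w \<in> ball z e \<Longrightarrow> chart (\<phi> z) (\<phi> w) \<noteq> None"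
      "(\<lambda>w. co (\<phi> z) (\<phi> w)) holomorphic_on ball z e"
    using assms(1) unfolding sphere_holomorphic_on_def co_def by meson
  obtain e' where e': "e' > 0" "ball z e' \<subseteq> A" using assms(2) z open_contains_ball by metis
  define r where "r = min e e'"
  have r: "r > 0" "ball z r \<subseteq> ball z e" "ball z r \<subseteq> A" using e e' by (auto simp: r_def)
  define k where "k w = co (\<phi> z) (\<phi> w)" for w
  have k: "k holomorphic_on ball z r"
    using e(3) r(2) holomorphic_on_subset unfolding k_def by blast
  have ch: "chart (\<phi> z) (\<phi> w) \<noteq> None" "chart p (\<phi> w) \<noteq> None" if "w \<in> ball z r" for w
    using e(2) assms(3) r that by auto
  have "(\<lambda>w. co p (\<phi> w)) holomorphic_on ball z r"
  proof (cases "(\<phi> z = None) = (p = None)")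
    case True
    then have "co p (\<phi> w) = k w" if "w \<in> ball z r" for w
      using co_change_same[OF True] by (simp add: k_def)
    then show ?thesis using k holomorphic_cong by (metis (no_types, lifting))
  next
    case False
    then have "co p (\<phi> w) = inverse (k w)" "k w \<noteq> 0" if "w \<in> ball z r" for w
      using co_change_inverse[OF ch[OF that] False] by (simp_all add: k_def)
    moreover have "(\<lambda>w. inverse (k w)) holomorphic_on ball z r"
      using k calculation(2) by (intro holomorphic_intros)
    ultimately show ?thesis using holomorphic_cong by (metis (no_types, lifting))
  qed
  then have "(\<lambda>w. co p (\<phi> w)) field_differentiable at z"
    using r(1) holomorphic_on_imp_differentiable_at[of _ "ball z r" z] by simp
  then show "(\<lambda>w. co p (\<phi> w)) field_differentiable at z within A"
    by (rule field_differentiable_at_within)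
qed

lemma sphere_holomorphicI:
  assumes "\<And>z. z \<in> A \<Longrightarrow> \<exists>p e. e > 0 \<and> (\<forall>w\<in>ball z e. chart p (\<phi> w) \<noteq> None) \<and>
      (\<lambda>w. co p (\<phi> w)) holomorphic_on ball z e"
  shows "sphere_holomorphic_on \<phi> A"
  unfolding sphere_holomorphic_on_def
proof
  fix z assume "z \<in> A"
  then obtain p e where e: "e > 0" "\<And>w. w \<in> ball z e \<Longrightarrow> chart p (\<phi> w) \<noteq> None"
      "(\<lambda>w. co p (\<phi> w)) holomorphic_on ball z e"
    using assms by meson
  define k where "k w = co p (\<phi> w)" for w
  have k: "k holomorphic_on ball z e" using e(3) by (simp add: k_def[abs_def])
  have "\<exists>r>0. (\<forall>w\<in>ball z r. chart (\<phi> z) (\<phi> w) \<noteq> None) \<and>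
      (\<lambda>w. co (\<phi> z) (\<phi> w)) holomorphic_on ball z r"
  proof (cases "(\<phi> z = None) = (p = None)")
    case True
    then have "chart p = chart (\<phi> z)" by (simp add: chart_def)
    then show ?thesis using e by (auto simp: co_def)
  next
    case False
    \<comment> \<open>\<open>\<phi> z\<close> is finite in both charts, so its coordinate is
      nonzero; a smaller ball keeps \<open>k\<close> away from 0, where the second chart would be
      left.\<close>
    have "k z \<noteq> 0"
      using co_change_inverse(2)[of p "\<phi> z" "\<phi> z"] e(1) e(2)[of z] False by (auto simp: k_def)
    moreover have "continuous_on (ball z e) k" using k holomorphic_on_imp_continuous_on by blast
    then have "isCont k z" using e(1) by (simp add: continuous_on_eq_continuous_at)
    ultimately have "\<exists>r>0. \<forall>y. dist z y < r \<longrightarrow> k y \<noteq> 0"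
      by (simp add: continuous_at_avoid)
    then obtain r0 where r0: "r0 > 0" "\<And>w. w \<in> ball z r0 \<Longrightarrow> k w \<noteq> 0" by auto
    define r where "r = min e r0"
    have r: "r > 0" "ball z r \<subseteq> ball z e" "\<And>w. w \<in> ball z r \<Longrightarrow> k w \<noteq> 0"
      using e r0 by (auto simp: r_def)
    have ch: "chart p (\<phi> w) \<noteq> None" "chart (\<phi> z) (\<phi> w) \<noteq> None" if "w \<in> ball z r" for w
      using e(2) r that chart_other[of p "\<phi> w" "\<phi> z"] unfolding k_def by auto
    have "(\<lambda>w. inverse (k w)) holomorphic_on ball z r"
      using k r by (intro holomorphic_intros) (auto intro: holomorphic_on_subset)
    moreover have "co (\<phi> z) (\<phi> w) = inverse (k w)" if "w \<in> ball z r" for w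
      using co_change_inverse(1)[OF ch[OF that]] False by (auto simp: k_def)
    ultimately have "(\<lambda>w. co (\<phi> z) (\<phi> w)) holomorphic_on ball z r"
      using holomorphic_cong by (metis (no_types, lifting))
    then show ?thesis using r ch by blast
  qed
  then show "\<exists>e>0. (\<forall>w\<in>ball z e. chart (\<phi> z) (\<phi> w) \<noteq> None) \<and>
      (\<lambda>w. the (chart (\<phi> z) (\<phi> w))) holomorphic_on ball z e"
    by (simp add: co_def)
qed

lemma sphere_holomorphic_subset:
  "sphere_holomorphic_on \<phi> A \<Longrightarrow> B \<subseteq> A \<Longrightarrow> sphere_holomorphic_on \<phi> B"
  by (auto simp: sphere_holomorphic_on_def)

lemma sphere_holomorphic_vimage:
  assumes "sphere_holomorphic_on \<phi> A" "open A" "openin riemann_sphere U"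
  shows "open {z \<in> A. \<phi> z \<in> U}"
proof (rule openI)
  fix z assume z: "z \<in> {z \<in> A. \<phi> z \<in> U}"
  then obtain e where e: "e > 0" "\<And>w. w \<in> ball z e \<Longrightarrow> chart (\<phi> z) (\<phi> w) \<noteq> None"
      "(\<lambda>w. co (\<phi> z) (\<phi> w)) holomorphic_on ball z e"
    using assms(1) unfolding sphere_holomorphic_on_def co_def by blast
  define k where "k w = co (\<phi> z) (\<phi> w)" for w
  have "continuous_on (ball z e) k"
    using e(3) holomorphic_on_imp_continuous_on unfolding k_def by blast
  then have "open (ball z e \<inter> k -` {a. pt (\<phi> z) a \<in> U})"
    by (intro continuous_open_preimage open_pt_vimage assms) auto
  moreover have "pt (\<phi> z) (k w) = \<phi> w" if "w \<in> ball z e" for w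
    using pt_co e(2) that by (simp add: k_def)
  then have "ball z e \<inter> k -` {a. pt (\<phi> z) a \<in> U} = {w \<in> ball z e. \<phi> w \<in> U}" by auto
  ultimately have "open (A \<inter> {w \<in> ball z e. \<phi> w \<in> U})" using assms(2) by auto
  moreover have "z \<in> A \<inter> {w \<in> ball z e. \<phi> w \<in> U}" using z e(1) by auto
  ultimately obtain r where "r > 0" "ball z r \<subseteq> A \<inter> {w \<in> ball z e. \<phi> w \<in> U}"
    using open_contains_ball by metis
  then show "\<exists>r>0. ball z r \<subseteq> {z \<in> A. \<phi> z \<in> U}" by blast
qed

lemma sphere_holomorphic_continuous:
  assumes "sphere_holomorphic_on \<phi> A" "open A"
  shows "continuous_map (top_of_set A) riemann_sphere \<phi>"
  unfolding continuous_map_def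
  using sphere_holomorphic_vimage[OF assms] assms(2)
  by (auto simp: openin_open_eq)

lemma sphere_holomorphic_coord_local:
  assumes "sphere_holomorphic_on \<phi> A" "open A" "z \<in> A" "chart p (\<phi> z) \<noteq> None"
  obtains B where "open B" "z \<in> B" "B \<subseteq> A" "\<And>w. w \<in> B \<Longrightarrow> chart p (\<phi> w) \<noteq> None"
    "(\<lambda>w. co p (\<phi> w)) holomorphic_on B"
proof
  let ?B = "{w \<in> A. \<phi> w \<in> {s. chart p s \<noteq> None}}"
  show o: "open ?B" by (intro sphere_holomorphic_vimage assms openin_chart_domain)
  show "z \<in> ?B" "?B \<subseteq> A" using assms by auto
  show "(\<lambda>w. co p (\<phi> w)) holomorphic_on ?B"
    using o by (intro sphere_holomorphic_coord sphere_holomorphic_subset[OF assms(1)]) auto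
qed auto

lemma sphere_holomorphic_local:
  assumes "\<And>z. z \<in> A \<Longrightarrow> \<exists>B. z \<in> B \<and> sphere_holomorphic_on \<phi> B"
  shows "sphere_holomorphic_on \<phi> A"
  using assms unfolding sphere_holomorphic_on_def by blast

text \<open>The balls of the definition may leave \<open>A\<close>; openness of \<open>A\<close>
  lets them shrink into the set on which the two maps agree.\<close>

lemma sphere_holomorphic_cong:
  assumes "sphere_holomorphic_on \<phi> A" "open A" "\<And>z. z \<in> A \<Longrightarrow> \<psi> z = \<phi> z"
  shows "sphere_holomorphic_on \<psi> A"
proof (rule sphere_holomorphicI)
  fix z assume z: "z \<in> A"
  then obtain B where B: "open B" "z \<in> B" "B \<subseteq> A" "\<And>w. w \<in> B \<Longrightarrow> chart (\<phi> z) (\<phi> w) \<noteq> None"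
    "(\<lambda>w. co (\<phi> z) (\<phi> w)) holomorphic_on B"
    using sphere_holomorphic_coord_local[OF assms(1,2) z chart_self] by blast
  then obtain e where e: "e > 0" "ball z e \<subseteq> B" using open_contains_ball by metis
  have same: "\<psi> w = \<phi> w" if "w \<in> ball z e" for w
    by (rule assms(3)) (use that e(2) B(3) in blast)
  have "(\<lambda>w. co (\<phi> z) (\<psi> w)) holomorphic_on ball z e"
    by (rule holomorphic_transform[OF holomorphic_on_subset[OF B(5) e(2)]]) (simp only: same)
  moreover have "\<forall>w\<in>ball z e. chart (\<phi> z) (\<psi> w) \<noteq> None" using B(4) e(2) same by (metis subsetD)
  ultimately show "\<exists>p e. e > 0 \<and> (\<forall>w\<in>ball z e. chart p (\<psi> w) \<noteq> None) \<and>
      (\<lambda>w. co p (\<psi> w)) holomorphic_on ball z e" using e(1) by blast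
qed

lemma sphere_holomorphic_pt:
  assumes "g holomorphic_on A" "open A"
  shows "sphere_holomorphic_on (\<lambda>z. pt p (g z)) A"
proof (rule sphere_holomorphicI)
  fix z assume "z \<in> A"
  then obtain e where e: "e > 0" "ball z e \<subseteq> A" using assms open_contains_ball by metis
  have "(\<lambda>w. co p (pt p (g w))) holomorphic_on ball z e"
    using assms(1) e holomorphic_on_subset by simp
  then show "\<exists>p' e. e > 0 \<and> (\<forall>w\<in>ball z e. chart p' (pt p (g w)) \<noteq> None) \<and>
      (\<lambda>w. co p' (pt p (g w))) holomorphic_on ball z e" using e(1) by (intro exI[of _ p]) auto
qed

lemma sphere_holomorphic_compose:
  assumes "sphere_holomorphic_on \<phi> A" "open A" "g holomorphic_on B" "open B"
    "\<And>z. z \<in> B \<Longrightarrow> g z \<in> A"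
  shows "sphere_holomorphic_on (\<lambda>z. \<phi> (g z)) B"
proof (rule sphere_holomorphicI)
  fix z assume z: "z \<in> B"
  obtain A' where A': "open A'" "g z \<in> A'" "A' \<subseteq> A" "\<And>w. w \<in> A' \<Longrightarrow> chart (\<phi> (g z)) (\<phi> w) \<noteq> None"
    "(\<lambda>w. co (\<phi> (g z)) (\<phi> w)) holomorphic_on A'"
    using sphere_holomorphic_coord_local[OF assms(1,2) assms(5)[OF z] chart_self] by blast
  have "open (B \<inter> g -` A')"
    using assms(3,4) A'(1) by (intro continuous_open_preimage holomorphic_on_imp_continuous_on)
  then obtain e where e: "e > 0" "ball z e \<subseteq> B \<inter> g -` A'"
    using z A'(2) open_contains_ball[of "B \<inter> g -` A'"] by blast
  have "(\<lambda>w. co (\<phi> (g z)) (\<phi> w)) \<circ> g holomorphic_on ball z e"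
    by (rule holomorphic_on_compose_gen[OF holomorphic_on_subset[OF assms(3)] A'(5)]) (use e in auto)
  moreover have "\<forall>w\<in>ball z e. chart (\<phi> (g z)) (\<phi> (g w)) \<noteq> None" using A'(4) e by blast
  ultimately show "\<exists>p e. e > 0 \<and> (\<forall>w\<in>ball z e. chart p (\<phi> (g w)) \<noteq> None) \<and>
      (\<lambda>w. co p (\<phi> (g w))) holomorphic_on ball z e" using e(1) by (auto simp: o_def)
qed

text \<open>In the chart at a value, the map is an injective holomorphic function on a plane set, to
  which the open mapping theorem applies.\<close>

lemma sphere_holomorphic_inj_open:
  assumes "sphere_holomorphic_on \<phi> A" "open A" "inj_on \<phi> A"
  shows "openin riemann_sphere (\<phi> ` A)"
proof (rule openin_sphereI)
  fix s assume "s \<in> \<phi> ` A"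
  then obtain z where z: "z \<in> A" "s = \<phi> z" by auto
  obtain B where B: "open B" "z \<in> B" "B \<subseteq> A" "\<And>w. w \<in> B \<Longrightarrow> chart s (\<phi> w) \<noteq> None"
    "(\<lambda>w. co s (\<phi> w)) holomorphic_on B"
    using sphere_holomorphic_coord_local[OF assms(1,2) z(1) chart_self] z(2) by blast
  have "inj_on (\<lambda>w. co s (\<phi> w)) B"
    using assms(3) B(3,4) by (auto simp: inj_on_def co_eq_iff)
  then have "open ((\<lambda>w. co s (\<phi> w)) ` B)" using open_mapping_thm3 B by blast
  then have "openin riemann_sphere (pt s ` (\<lambda>w. co s (\<phi> w)) ` B)" by (rule openin_pt_image)
  moreover have "pt s ` (\<lambda>w. co s (\<phi> w)) ` B = \<phi> ` B"
    using B(4) pt_co by (simp add: image_image)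
  ultimately show "\<exists>V. openin riemann_sphere V \<and> s \<in> V \<and> V \<subseteq> \<phi> ` A"
    using B z by (intro exI[of _ "\<phi> ` B"]) auto
qed

text \<open>Inverses of parametrizations occur only after another parametrization. The composite is
  a function between plane sets, so holomorphy on the sphere itself never has to be
  discussed.\<close>

lemma holomorphic_transition:
  assumes "sphere_holomorphic_on \<phi> A" "open A" "inj_on \<phi> A"
    and "sphere_holomorphic_on \<psi> B" "open B" "\<And>z. z \<in> B \<Longrightarrow> \<psi> z \<in> \<phi> ` A"
  shows "(\<lambda>z. inv_into A \<phi> (\<psi> z)) holomorphic_on B"
proof (rule holomorphic_onI)
  fix z assume z: "z \<in> B"
  define a where "a = inv_into A \<phi> (\<psi> z)"
  have a: "a \<in> A" "\<phi> a = \<psi> z"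
    using assms(6)[OF z] by (auto simp: a_def inv_into_into f_inv_into_f)
  obtain A' where A': "open A'" "a \<in> A'" "A' \<subseteq> A" "\<And>w. w \<in> A' \<Longrightarrow> chart (\<psi> z) (\<phi> w) \<noteq> None"
    "(\<lambda>w. co (\<psi> z) (\<phi> w)) holomorphic_on A'"
    using sphere_holomorphic_coord_local[OF assms(1,2) a(1) chart_self] a(2) by metis
  have inj: "inj_on (\<lambda>w. co (\<psi> z) (\<phi> w)) A'"
    using assms(3) A'(3,4) by (auto simp: inj_on_def co_eq_iff)
  obtain g where g: "g holomorphic_on (\<lambda>w. co (\<psi> z) (\<phi> w)) ` A'"
    "\<And>w. w \<in> A' \<Longrightarrow> g (co (\<psi> z) (\<phi> w)) = w"
    using holomorphic_has_inverse[OF A'(5,1) inj] by metis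
  have "openin riemann_sphere (\<phi> ` A')"
    by (rule sphere_holomorphic_inj_open[OF sphere_holomorphic_subset[OF assms(1) A'(3)] A'(1)
          inj_on_subset[OF assms(3) A'(3)]])
  then have o: "open {w \<in> B. \<psi> w \<in> \<phi> ` A'}" by (intro sphere_holomorphic_vimage assms)
  have zB: "z \<in> {w \<in> B. \<psi> w \<in> \<phi> ` A'}" using z a A'(2) by (metis (mono_tags, lifting) image_eqI mem_Collect_eq)
  have "(\<lambda>w. co (\<psi> z) (\<psi> w)) holomorphic_on {w \<in> B. \<psi> w \<in> \<phi> ` A'}"
    using o A'(4) by (intro sphere_holomorphic_coord sphere_holomorphic_subset[OF assms(4)]) auto
  then have h: "g \<circ> (\<lambda>w. co (\<psi> z) (\<psi> w)) holomorphic_on {w \<in> B. \<psi> w \<in> \<phi> ` A'}"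
    using g(1) by (rule holomorphic_on_compose_gen) auto
  have eq: "g (co (\<psi> z) (\<psi> w)) = inv_into A \<phi> (\<psi> w)" if "w \<in> B" "\<psi> w \<in> \<phi> ` A'" for w
    using that g(2) A'(3) assms(3) by (auto simp: inv_into_f_f subset_iff)
  have "(\<lambda>z. inv_into A \<phi> (\<psi> z)) holomorphic_on {w \<in> B. \<psi> w \<in> \<phi> ` A'}"
    by (rule holomorphic_transform[OF h]) (use eq in simp)
  then have "(\<lambda>z. inv_into A \<phi> (\<psi> z)) field_differentiable at z"
    using o zB holomorphic_on_imp_differentiable_at by blast
  then show "(\<lambda>z. inv_into A \<phi> (\<psi> z)) field_differentiable at z within B"
    by (rule field_differentiable_at_within)
qed

subsection \<open>Holomorphic self-maps of open subsets of the sphere\<close>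

text \<open>Testing against all holomorphic \<open>\<phi>\<close> from plane sets avoids charts on
  the domain side and makes closure under composition immediate.\<close>

definition holomorphic_self :: "complex option set \<Rightarrow> (complex option \<Rightarrow> complex option) \<Rightarrow> bool" where
  "holomorphic_self S g \<longleftrightarrow> g ` S \<subseteq> S \<and>
     (\<forall>\<phi> A. open A \<longrightarrow> sphere_holomorphic_on \<phi> A \<longrightarrow> \<phi> ` A \<subseteq> S \<longrightarrow>
        sphere_holomorphic_on (\<lambda>z. g (\<phi> z)) A)"

lemma holomorphic_self_funpow:
  assumes "holomorphic_self S g" shows "holomorphic_self S (g ^^ k)"
proof (induction k)
  case (Suc k)
  have "sphere_holomorphic_on (\<lambda>z. g ((g ^^ k) (\<phi> z))) A"
    if "open A" "sphere_holomorphic_on \<phi> A" "\<phi> ` A \<subseteq> S" for \<phi> A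
  proof -
    have "sphere_holomorphic_on (\<lambda>z. (g ^^ k) (\<phi> z)) A" "(g ^^ k) ` S \<subseteq> S"
      using Suc that by (auto simp: holomorphic_self_def)
    then show ?thesis using assms that by (auto simp: holomorphic_self_def image_subset_iff)
  qed
  then show ?case using Suc assms by (auto simp: holomorphic_self_def image_subset_iff)
qed (auto simp: holomorphic_self_def)

lemma holomorphic_self_coord:
  assumes "holomorphic_self S g" "openin riemann_sphere S" "c \<in> S"
  obtains B where "open B" "co c c \<in> B" "\<And>z. z \<in> B \<Longrightarrow> pt c z \<in> S"
    "\<And>z. z \<in> B \<Longrightarrow> chart (g c) (g (pt c z)) \<noteq> None"
    "(\<lambda>z. co (g c) (g (pt c z))) holomorphic_on B"
proof -
  define A where "A = {z. pt c z \<in> S}"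
  have A: "open A" unfolding A_def by (rule open_pt_vimage[OF assms(2)])
  have "sphere_holomorphic_on (pt c) A" using sphere_holomorphic_pt[OF _ A, of "\<lambda>z. z"] by auto
  then have h: "sphere_holomorphic_on (\<lambda>z. g (pt c z)) A"
    using assms(1) A by (auto simp: holomorphic_self_def A_def)
  have "co c c \<in> A" using assms(3) by (simp add: A_def pt_co)
  moreover have "chart (g c) (g (pt c (co c c))) \<noteq> None" by (simp add: pt_co)
  ultimately obtain B where "open B" "co c c \<in> B" "B \<subseteq> A"
      "\<And>w. w \<in> B \<Longrightarrow> chart (g c) (g (pt c w)) \<noteq> None" "(\<lambda>w. co (g c) (g (pt c w))) holomorphic_on B"
    using sphere_holomorphic_coord_local[OF h A] by metis
  then show ?thesis using that by (auto simp: A_def)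
qed

lemma holomorphic_self_vimage:
  assumes "holomorphic_self S g" "openin riemann_sphere S" "openin riemann_sphere U"
  shows "openin riemann_sphere {s \<in> S. g s \<in> U}"
proof (rule openin_sphereI)
  fix s assume s: "s \<in> {s \<in> S. g s \<in> U}"
  define A where "A = {z. pt s z \<in> S}"
  have A: "open A" unfolding A_def by (rule open_pt_vimage[OF assms(2)])
  have "sphere_holomorphic_on (pt s) A" using sphere_holomorphic_pt[OF _ A, of "\<lambda>z. z"] by auto
  then have "sphere_holomorphic_on (\<lambda>z. g (pt s z)) A"
    using assms(1) A by (auto simp: holomorphic_self_def A_def)
  then have "open {z \<in> A. g (pt s z) \<in> U}" using A assms(3) by (intro sphere_holomorphic_vimage)
  then have "openin riemann_sphere (pt s ` {z \<in> A. g (pt s z) \<in> U})" by (rule openin_pt_image)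
  moreover have "s \<in> pt s ` {z \<in> A. g (pt s z) \<in> U}"
    using s by (intro image_eqI[of _ _ "co s s"]) (auto simp: A_def pt_co)
  ultimately show "\<exists>V. openin riemann_sphere V \<and> s \<in> V \<and> V \<subseteq> {s \<in> S. g s \<in> U}"
    by (intro exI[of _ "pt s ` {z \<in> A. g (pt s z) \<in> U}"]) (auto simp: A_def)
qed

lemma holomorphic_self_connected:
  assumes "holomorphic_self S g" "openin riemann_sphere S"
    and "connectedin riemann_sphere C" "C \<subseteq> S"
  shows "connectedin riemann_sphere (g ` C)"
proof (rule connectedin_continuous_map_image)
  show "continuous_map (subtopology riemann_sphere S) riemann_sphere g"
  proof -
    have "openin (subtopology riemann_sphere S) {x \<in> S. g x \<in> U}" if "openin riemann_sphere U" for U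
      using holomorphic_self_vimage[OF assms(1,2) that] assms(2)
      by (simp add: openin_open_subtopology)
    then show ?thesis by (simp add: continuous_map_def)
  qed
  show "connectedin (subtopology riemann_sphere S) C"
    using assms by (simp add: connectedin_subtopology)
qed

text \<open>Together with its converse below, this trades the derivative in charts for local
  injectivity, the form in which critical points meet plaques.\<close>

lemma sphere_deriv_nonzero_if_inj:
  assumes "holomorphic_self S g" "openin riemann_sphere S" "c \<in> N" "openin riemann_sphere N"
    "N \<subseteq> S" "inj_on g N"
  shows "sphere_deriv g c \<noteq> 0"
proof -
  obtain B where B: "open B" "co c c \<in> B" "\<And>z. z \<in> B \<Longrightarrow> pt c z \<in> S"
    "\<And>z. z \<in> B \<Longrightarrow> chart (g c) (g (pt c z)) \<noteq> None"
    "(\<lambda>z. co (g c) (g (pt c z))) holomorphic_on B"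
    using holomorphic_self_coord[OF assms(1,2)] assms(3,5) by (metis subsetD)
  define B' where "B' = B \<inter> {z. pt c z \<in> N}"
  have B': "open B'" "co c c \<in> B'" "B' \<subseteq> B"
    using B open_pt_vimage[OF assms(4)] assms(3) by (auto simp: B'_def pt_co)
  have "inj_on (\<lambda>z. co (g c) (g (pt c z))) B'"
  proof (rule inj_onI)
    fix z w assume zw: "z \<in> B'" "w \<in> B'" "co (g c) (g (pt c z)) = co (g c) (g (pt c w))"
    then have "g (pt c z) = g (pt c w)" using B(4) B'(3) co_eq_iff by (metis subsetD)
    then have "pt c z = pt c w" using assms(6) zw by (auto simp: B'_def inj_on_def)
    then show "z = w" using inj_pt by (auto simp: inj_on_def)
  qed
  then have "deriv (\<lambda>z. co (g c) (g (pt c z))) (co c c) \<noteq> 0"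
    using holomorphic_injective_imp_regular B' holomorphic_on_subset[OF B(5)] by blast
  then show ?thesis by (simp add: sphere_deriv_def co_def pt_def)
qed

lemma inj_if_sphere_deriv_nonzero:
  assumes "holomorphic_self S g" "openin riemann_sphere S" "c \<in> S" "sphere_deriv g c \<noteq> 0"
  obtains N where "openin riemann_sphere N" "c \<in> N" "N \<subseteq> S" "inj_on g N"
proof -
  obtain B where B: "open B" "co c c \<in> B" "\<And>z. z \<in> B \<Longrightarrow> pt c z \<in> S"
    "\<And>z. z \<in> B \<Longrightarrow> chart (g c) (g (pt c z)) \<noteq> None"
    "(\<lambda>z. co (g c) (g (pt c z))) holomorphic_on B"
    using holomorphic_self_coord[OF assms(1-3)] by metis
  have "deriv (\<lambda>z. co (g c) (g (pt c z))) (co c c) \<noteq> 0"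
    using assms(4) by (simp add: sphere_deriv_def co_def pt_def)
  then obtain r where r: "r > 0" "ball (co c c) r \<subseteq> B"
      "inj_on (\<lambda>z. co (g c) (g (pt c z))) (ball (co c c) r)"
    using has_complex_derivative_locally_injective[OF B(5,2,1)] by blast
  show ?thesis
  proof
    show "openin riemann_sphere (pt c ` ball (co c c) r)" by (simp add: openin_pt_image)
    show "c \<in> pt c ` ball (co c c) r" using r(1) by (intro image_eqI[of _ _ "co c c"]) (auto simp: pt_co)
    show "pt c ` ball (co c c) r \<subseteq> S" using r(2) B(3) by blast
    show "inj_on g (pt c ` ball (co c c) r)"
      using r(3) by (auto simp: inj_on_def)
  qed
qed

subsection \<open>Conformal disks and power maps\<close>

lemma conformal_from_diskD:
  assumes "conformal_from_disk \<phi> U"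
  shows "sphere_holomorphic_on \<phi> (ball 0 1)" "inj_on \<phi> (ball 0 1)" "\<phi> ` ball 0 1 = U"
    "openin riemann_sphere U"
  using assms sphere_holomorphic_inj_open[of \<phi> "ball 0 1"]
  by (auto simp: conformal_from_disk_def bij_betw_def)

lemma conformal_from_diskI:
  assumes "sphere_holomorphic_on \<phi> (ball 0 1)" "inj_on \<phi> (ball 0 1)"
  shows "conformal_from_disk \<phi> (\<phi> ` ball 0 1)"
  using assms by (auto simp: conformal_from_disk_def bij_betw_def)

lemma sphere_holomorphic_connected:
  assumes "sphere_holomorphic_on \<phi> A" "open A" "connected C" "C \<subseteq> A"
  shows "connectedin riemann_sphere (\<phi> ` C)"
  by (rule connectedin_continuous_map_image[OF sphere_holomorphic_continuous[OF assms(1,2)]])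
     (use assms in \<open>auto simp: connectedin_subtopology\<close>)

lemma conformal_connected:
  "conformal_from_disk \<phi> U \<Longrightarrow> connectedin riemann_sphere U"
  using sphere_holomorphic_connected[of \<phi> "ball 0 1" "ball 0 1"] conformal_from_diskD(1,3) by fastforce

lemma power_in_unit_ball_iff: "1 \<le> t \<Longrightarrow> (z::complex) ^ t \<in> ball 0 1 \<longleftrightarrow> z \<in> ball 0 1"
  by (simp add: norm_power power_less_one_iff)

lemma complex_root_exists: "1 \<le> t \<Longrightarrow> \<exists>z::complex. z ^ t = u"
proof (cases "u = 0")
  case False
  assume "1 \<le> t"
  then have "exp (Ln u / of_nat t) ^ t = u"
    using False by (simp add: exp_of_nat_mult[symmetric])
  then show ?thesis by blast
qed (auto intro!: exI[of _ 0])

lemma power_image_unit_ball: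
  assumes "1 \<le> t" shows "(\<lambda>z::complex. z ^ t) ` ball 0 1 = ball 0 1"
proof
  show "ball 0 1 \<subseteq> (\<lambda>z::complex. z ^ t) ` ball 0 1"
  proof
    fix u :: complex assume u: "u \<in> ball 0 1"
    obtain z where "z ^ t = u" using complex_root_exists[OF assms] by blast
    then show "u \<in> (\<lambda>z. z ^ t) ` ball 0 1"
      using u power_in_unit_ball_iff[OF assms] by (metis image_eqI)
  qed
qed (use power_in_unit_ball_iff[OF assms] in blast)

lemma power_in_coordinates_image:
  assumes "power_in_coordinates f t \<phi> W \<psi> V" "1 \<le> t"
  shows "f ` W = V"
proof -
  have "f ` W = (\<lambda>z. f (\<phi> z)) ` ball 0 1"
    using conformal_from_diskD(3)[of \<phi> W] assms(1) by (force simp: power_in_coordinates_def)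
  also have "\<dots> = (\<lambda>z. \<psi> (z ^ t)) ` ball 0 1"
    using assms(1) by (intro image_cong) (auto simp: power_in_coordinates_def)
  also have "\<dots> = \<psi> ` (\<lambda>z. z ^ t) ` ball 0 1" by (simp add: image_image)
  also have "\<dots> = V"
    using assms(1) conformal_from_diskD(3)
    unfolding power_image_unit_ball[OF assms(2)] power_in_coordinates_def by blast
  finally show ?thesis .
qed

lemma power_one_bij:
  assumes "power_in_coordinates f 1 \<phi> W \<psi> V" shows "bij_betw f W V"
proof -
  have "inj_on f W"
    using assms unfolding power_in_coordinates_def conformal_from_disk_def bij_betw_def inj_on_def
    by auto
  then show ?thesis using power_in_coordinates_image[OF assms] by (simp add: bij_betw_def)
qed

text \<open>Near the center, points that differ by a \<open>t\<close>-th root of unity have the same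
  image, so \<open>f\<close> is not locally injective there.\<close>

lemma power_ge_two_critical:
  assumes "holomorphic_self S f" "openin riemann_sphere S"
    and "power_in_coordinates f t \<phi> W \<psi> V" "2 \<le> t" "W \<subseteq> S"
  shows "\<phi> 0 \<in> critical_points S f" "\<phi> 0 \<in> W"
proof -
  have \<phi>: "conformal_from_disk \<phi> W" and eq: "\<And>z. z \<in> ball 0 1 \<Longrightarrow> f (\<phi> z) = \<psi> (z ^ t)"
    using assms(3) by (auto simp: power_in_coordinates_def)
  show 0: "\<phi> 0 \<in> W" using conformal_from_diskD(3)[OF \<phi>] by auto
  have "sphere_deriv f (\<phi> 0) = 0"
  proof (rule ccontr)
    assume "sphere_deriv f (\<phi> 0) \<noteq> 0"
    then obtain N where N: "openin riemann_sphere N" "\<phi> 0 \<in> N" "N \<subseteq> S" "inj_on f N"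
      using inj_if_sphere_deriv_nonzero[OF assms(1,2)] 0 assms(5) by blast
    have "open {z \<in> ball 0 1. \<phi> z \<in> N}"
      by (rule sphere_holomorphic_vimage[OF conformal_from_diskD(1)[OF \<phi>] _ N(1)]) simp
    moreover have "0 \<in> {z \<in> ball 0 1. \<phi> z \<in> N}" using N by simp
    ultimately obtain e where e: "e > 0" "ball 0 e \<subseteq> {z \<in> ball 0 1. \<phi> z \<in> N}"
      using open_contains_ball by metis
    \<comment> \<open>Two points that differ by a rotation through \<open>2 pi / t\<close>: both lie
      where \<open>f\<close> is injective and both have the same \<open>t\<close>-th power.\<close>
    define z :: complex where "z = of_real (e / 2)"
    define w where "w = z * exp (2 * of_real pi * \<i> / of_nat t)"
    have nz: "norm z < e" "norm w < e" using e by (auto simp: z_def w_def norm_mult)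
    have "w ^ t = z ^ t"
      using assms(4) by (simp add: w_def power_mult_distrib exp_of_nat_mult[symmetric] exp_two_pi_i)
    then have "f (\<phi> w) = f (\<phi> z)"
      using eq[of w] eq[of z] nz e by fastforce
    moreover have "\<phi> w \<in> N" "\<phi> z \<in> N" "w \<in> ball 0 1" "z \<in> ball 0 1"
      using nz e(2) by (auto simp: subset_iff)
    ultimately have "w = z"
      using N(4) conformal_from_diskD(2)[OF \<phi>] by (metis inj_onD)
    then have "exp (2 * of_real pi * \<i> / of_nat t) = (1::complex)" using e by (simp add: w_def z_def)
    \<comment> \<open>A trivial rotation would make \<open>1 / t\<close> an integer.\<close>
    then have "(2 * of_real pi * \<i> / of_nat t :: complex) \<in> range (\<lambda>n::int. 2 * of_int n * of_real pi * \<i>)"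
      unfolding exp_eq_1 by (auto simp: complex_eq_iff)
    then obtain n :: int where "2 * of_real pi * \<i> / of_nat t = (2 * of_int n * of_real pi * \<i> :: complex)" by auto
    then have "(1::complex) = of_nat t * of_int n" using assms(4) by (simp add: field_simps)
    then have "int t * n = 1" by (metis of_int_eq_1_iff of_int_mult of_int_of_nat_eq)
    then show False using assms(4) by (metis abs_of_nat numeral_le_one_iff of_nat_1 of_nat_le_iff
      of_nat_numeral order_trans semiring_norm(69) zmult_eq_1_iff abs_1 abs_minus_cancel int_ops(2) le_refl)
  qed
  then show "\<phi> 0 \<in> critical_points S f" using 0 assms(5) by (auto simp: critical_points_def)
qed

text \<open>\<open>W\<close> is open and also relatively closed in the preimage of \<open>V\<close>,
  so a connected subset of that preimage cannot leave it. Closedness is obtained by exhausting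
  \<open>V\<close> by the disks of radius \<open>r < 1\<close>.\<close>

lemma power_in_coordinates_absorb:
  assumes "holomorphic_self S f" "openin riemann_sphere S"
    and pw: "power_in_coordinates f t \<phi> W \<psi> V" and t: "1 \<le> t"
    and C: "connectedin riemann_sphere C" "C \<subseteq> S" "f ` C \<subseteq> V" "C \<inter> W \<noteq> {}"
  shows "C \<subseteq> W"
proof -
  have \<phi>: "conformal_from_disk \<phi> W" and \<psi>: "conformal_from_disk \<psi> V"
    and eq: "\<And>z. z \<in> ball 0 1 \<Longrightarrow> f (\<phi> z) = \<psi> (z ^ t)"
    using pw by (auto simp: power_in_coordinates_def)
  note \<phi>D = conformal_from_diskD[OF \<phi>] and \<psi>D = conformal_from_diskD[OF \<psi>]
  \<comment> \<open>The part of \<open>W\<close> over the closed disk of radius \<open>r\<close>: it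
    is compact, hence closed in the sphere. This is where properness of \<open>z ^ t\<close>
    enters.\<close>
  define K where "K r = \<phi> ` {z. norm z ^ t \<le> r}" for r
  have sub: "{z::complex. norm z ^ t \<le> r} \<subseteq> ball 0 1" if "r < 1" for r
  proof
    fix z :: complex assume "z \<in> {z. norm z ^ t \<le> r}"
    then have "norm (z ^ t) < 1" using that by (simp add: norm_power)
    then show "z \<in> ball 0 1" using power_in_unit_ball_iff[OF t, of z] by simp
  qed
  have K: "closedin riemann_sphere (K r)" "K r \<subseteq> W" if "r < 1" for r
  proof -
    have "closed {z::complex. norm z ^ t \<le> r}" by (intro closed_Collect_le continuous_intros)
    moreover have "bounded {z::complex. norm z ^ t \<le> r}" using sub[OF that] bounded_ball bounded_subset by blast
    ultimately have "compact {z::complex. norm z ^ t \<le> r}" by (simp add: compact_eq_bounded_closed)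
    then have "compactin (top_of_set (ball 0 1)) {z::complex. norm z ^ t \<le> r}"
      using sub[OF that] by (simp add: compactin_subtopology)
    then have "compactin riemann_sphere (K r)"
      unfolding K_def by (rule image_compactin[OF _ sphere_holomorphic_continuous[OF \<phi>D(1)]]) simp
    then show "closedin riemann_sphere (K r)" using compactin_imp_closedin[OF Hausdorff_sphere] by blast
    show "K r \<subseteq> W" using sub[OF that] \<phi>D(3) by (auto simp: K_def)
  qed
  \<comment> \<open>Points of \<open>W\<close> over the open disk of radius \<open>r\<close> lie in
    \<open>K r\<close>; removing \<open>K r\<close> therefore leaves an open set that contains
    exactly the points over this disk outside \<open>W\<close>.\<close>
  define Q where "Q r = {s \<in> S. f s \<in> \<psi> ` ball 0 r} - K r" for r
  have Q: "openin riemann_sphere (Q r)" if "r < 1" for r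
  proof -
    have sb: "ball 0 r \<subseteq> (ball 0 1 :: complex set)" using that by (simp add: subset_ball)
    have "openin riemann_sphere (\<psi> ` ball 0 r)"
      by (rule sphere_holomorphic_inj_open[OF sphere_holomorphic_subset[OF \<psi>D(1) sb] _ inj_on_subset[OF \<psi>D(2) sb]])
         simp
    then show ?thesis unfolding Q_def using K(1)[OF that] holomorphic_self_vimage[OF assms(1,2)]
      by (intro openin_diff) auto
  qed
  show ?thesis
  proof (rule ccontr)
    assume n: "\<not> C \<subseteq> W"
    have cov: "s \<in> \<Union> (Q ` {..<1})" if "s \<in> C" "s \<notin> W" for s
    proof -
      have "f s \<in> \<psi> ` ball 0 1" using C(3) that \<psi>D(3) by auto
      then obtain u where u: "u \<in> ball 0 1" "f s = \<psi> u" by auto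
      then obtain r where r: "norm u < r" "r < 1" using dense[of "norm u" 1] by auto
      then have "s \<in> Q r" using that u C(2) K(2)[OF r(2)] by (auto simp: Q_def)
      then show ?thesis using r by blast
    qed
    have disj: "W \<inter> Q r = {}" if "r < 1" for r
    proof -
      have "\<phi> z \<notin> Q r" if z: "z \<in> ball 0 1" for z
      proof
        assume "\<phi> z \<in> Q r"
        then obtain u where u: "u \<in> ball 0 r" "\<psi> (z ^ t) = \<psi> u" "\<phi> z \<notin> K r"
          using eq[OF z] by (auto simp: Q_def)
        then have "z ^ t = u"
          using \<psi>D(2) z power_in_unit_ball_iff[OF t, of z] \<open>r < 1\<close> by (auto simp: inj_on_def)
        then have "norm z ^ t \<le> r" using u(1) by (auto simp: norm_power)
        then show False using u(3) by (auto simp: K_def)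
      qed
      then show ?thesis using \<phi>D(3) by auto
    qed
    show False
    proof (rule connectedinD[OF C(1) \<phi>D(4)])
      show "openin riemann_sphere (\<Union> (Q ` {..<1}))" using Q by blast
      show "C \<subseteq> W \<union> \<Union> (Q ` {..<1})" using cov by blast
      show "W \<inter> \<Union> (Q ` {..<1}) \<inter> C = {}" using disj by blast
      show "W \<inter> C \<noteq> {}" using C(4) by blast
      show "\<Union> (Q ` {..<1}) \<inter> C \<noteq> {}" using n cov by blast
    qed
  qed
qed

text \<open>
  A conformal disk in the base pulls back under \<open>z\<^sup>t\<close> to a conformal disk: either it avoids the
  critical value and a holomorphic \<open>t\<close>-th root exists, or, after moving the critical value to
  the center, its parametrization is \<open>z H z\<close> and the pullback is \<open>z K (z\<^sup>t)\<close> with \<open>K\<^sup>t = H\<close>.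
\<close>

lemma holomorphic_root_ball:
  assumes "F holomorphic_on ball 0 1" "\<And>z. z \<in> ball 0 1 \<Longrightarrow> F z \<noteq> 0" "1 \<le> t"
  obtains G where "G holomorphic_on ball 0 1" "\<And>z. z \<in> ball 0 1 \<Longrightarrow> G z ^ t = (F z :: complex)"
proof -
  obtain h where h: "h holomorphic_on ball 0 1" "\<And>z. z \<in> ball 0 1 \<Longrightarrow> F z = exp (h z)"
    using contractible_imp_holomorphic_log[OF assms(1) convex_imp_contractible[OF convex_ball] assms(2)]
    by blast
  show ?thesis
  proof
    show "(\<lambda>z. exp (h z / of_nat t)) holomorphic_on ball 0 1"
      using h(1) assms(3) by (intro holomorphic_intros) auto
    show "exp (h z / of_nat t) ^ t = F z" if "z \<in> ball 0 1" for z
      using h(2)[OF that] assms(3) by (simp add: exp_of_nat_mult[symmetric])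
  qed
qed

lemma pullback_disk:
  assumes pw: "power_in_coordinates f t \<phi> W \<psi> V" and t: "1 \<le> t"
    and \<alpha>: "conformal_from_disk \<alpha> A" and A: "A \<subseteq> V" and w: "w \<in> W" "f w \<in> A"
  obtains s \<phi>' \<alpha>' B where "1 \<le> s" "s \<le> t" "B \<subseteq> W" "w \<in> B" "power_in_coordinates f s \<phi>' B \<alpha>' A"
proof -
  have \<phi>: "conformal_from_disk \<phi> W" and \<psi>: "conformal_from_disk \<psi> V"
    and eq: "\<And>z. z \<in> ball 0 1 \<Longrightarrow> f (\<phi> z) = \<psi> (z ^ t)"
    using pw by (auto simp: power_in_coordinates_def)
  note result = that
  note \<phi>D = conformal_from_diskD[OF \<phi>] and \<psi>D = conformal_from_diskD[OF \<psi>]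
    and \<alpha>D = conformal_from_diskD[OF \<alpha>]
  define F where "F z = inv_into (ball 0 1) \<psi> (\<alpha> z)" for z
  have in\<psi>: "\<alpha> z \<in> \<psi> ` ball 0 1" if "z \<in> ball 0 1" for z using that \<alpha>D(3) A \<psi>D(3) by blast
  have Fhol: "F holomorphic_on ball 0 1" unfolding F_def
    by (rule holomorphic_transition[OF \<psi>D(1) _ \<psi>D(2) \<alpha>D(1)]) (use in\<psi> in auto)
  have F\<psi>: "\<psi> (F z) = \<alpha> z" "F z \<in> ball 0 1" if "z \<in> ball 0 1" for z
    using in\<psi>[OF that] unfolding F_def by (rule f_inv_into_f, rule inv_into_into)
  have Finj: "inj_on F (ball 0 1)"
    using F\<psi>(1) \<alpha>D(2) by (metis inj_onD inj_onI)
  obtain \<zeta> where \<zeta>: "\<zeta> \<in> ball 0 1" "w = \<phi> \<zeta>" using w(1) \<phi>D(3) by auto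
  obtain u where u: "u \<in> ball 0 1" "f w = \<alpha> u" using w(2) \<alpha>D(3) by auto
  have Fu: "F u = \<zeta> ^ t"
  proof -
    have "\<psi> (F u) = \<psi> (\<zeta> ^ t)" using F\<psi>(1)[OF u(1)] u(2) eq[OF \<zeta>(1)] \<zeta>(2) by simp
    then show ?thesis
      using \<psi>D(2) F\<psi>(2)[OF u(1)] power_in_unit_ball_iff[OF t, of \<zeta>] \<zeta>(1) by (auto simp: inj_on_def)
  qed
  \<comment> \<open>Both cases end with a map \<open>G\<close> that parametrizes the sought disk in
    the coordinate of \<open>W\<close>; they differ in the exponent \<open>s\<close>, which is 1 or
    \<open>t\<close>.\<close>
  have fin: thesis
    if G: "G holomorphic_on ball 0 1" "inj_on G (ball 0 1)" "\<zeta> \<in> G ` ball 0 1"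
      and \<alpha>': "conformal_from_disk \<alpha>' A" and s: "1 \<le> s" "s \<le> t"
      and GF: "\<And>z. z \<in> ball 0 1 \<Longrightarrow> G z ^ t \<in> ball 0 1"
      and Ga: "\<And>z. z \<in> ball 0 1 \<Longrightarrow> \<psi> (G z ^ t) = \<alpha>' (z ^ s)" for G \<alpha>' s
  proof (rule result)
    have G1: "G z \<in> ball 0 1" if "z \<in> ball 0 1" for z
      using GF[OF that] power_in_unit_ball_iff[OF t] by blast
    let ?\<phi> = "\<lambda>z. \<phi> (G z)"
    have "sphere_holomorphic_on ?\<phi> (ball 0 1)"
      by (rule sphere_holomorphic_compose[OF \<phi>D(1) _ G(1)]) (use G1 in auto)
    moreover have "inj_on ?\<phi> (ball 0 1)"
      using G(2) G1 \<phi>D(2) by (auto simp: inj_on_def)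
    ultimately have "conformal_from_disk ?\<phi> (?\<phi> ` ball 0 1)" by (rule conformal_from_diskI)
    then show "power_in_coordinates f s ?\<phi> (?\<phi> ` ball 0 1) \<alpha>' A"
      using \<alpha>' eq G1 Ga by (auto simp: power_in_coordinates_def)
    show "?\<phi> ` ball 0 1 \<subseteq> W" using G1 \<phi>D(3) by blast
    show "w \<in> ?\<phi> ` ball 0 1" using G(3) \<zeta>(2) by auto
  qed (use s in auto)
  show thesis
  proof (cases "0 \<in> F ` ball 0 1")
    case False
    then obtain G0 where G0: "G0 holomorphic_on ball 0 1" "\<And>z. z \<in> ball 0 1 \<Longrightarrow> G0 z ^ t = F z"
      using holomorphic_root_ball[OF Fhol _ t] by (metis imageI)
    have nz: "G0 u \<noteq> 0" using G0(2)[OF u(1)] False u(1) t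
      by (metis imageI power_0_left not_one_le_zero)
    \<comment> \<open>\<open>G0 u\<close> is only known to have the same \<open>t\<close>-th power
      as \<open>\<zeta>\<close>; a root of unity corrects the branch so that the disk contains
      \<open>w\<close>.\<close>
    define \<omega> where "\<omega> = \<zeta> / G0 u"
    have \<omega>: "\<omega> ^ t = 1"
    proof -
      have "G0 u ^ t = \<zeta> ^ t" using G0(2)[OF u(1)] Fu by simp
      moreover have "G0 u ^ t \<noteq> 0" using nz by simp
      ultimately show ?thesis unfolding \<omega>_def power_divide by (metis divide_self)
    qed
    have pt: "(\<omega> * G0 z) ^ t = F z" if "z \<in> ball 0 1" for z
      using G0(2)[OF that] \<omega> by (simp add: power_mult_distrib)
    show thesis
    proof (rule fin[of "\<lambda>z. \<omega> * G0 z" \<alpha> 1])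
      show "(\<lambda>z. \<omega> * G0 z) holomorphic_on ball 0 1" using G0(1) by (intro holomorphic_intros)
      show "inj_on (\<lambda>z. \<omega> * G0 z) (ball 0 1)"
      proof (rule inj_onI)
        fix z z' assume z: "z \<in> ball 0 1" "z' \<in> ball 0 1" "\<omega> * G0 z = \<omega> * G0 z'"
        have "F z = F z'" unfolding pt[OF z(1), symmetric] pt[OF z(2), symmetric] z(3) ..
        then show "z = z'" using Finj z by (auto simp: inj_on_def)
      qed
      show "\<zeta> \<in> (\<lambda>z. \<omega> * G0 z) ` ball 0 1" using u(1) nz by (intro image_eqI[of _ _ u]) (auto simp: \<omega>_def)
      show "(\<omega> * G0 z) ^ t \<in> ball 0 1" if "z \<in> ball 0 1" for z
        unfolding pt[OF that] by (rule F\<psi>(2)[OF that])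
      show "\<psi> ((\<omega> * G0 z) ^ t) = \<alpha> (z ^ 1)" if "z \<in> ball 0 1" for z
        unfolding pt[OF that] by (simp add: F\<psi>(1)[OF that])
    qed (use t \<alpha> in auto)
  next
    case True
    then obtain a where a: "a \<in> ball 0 1" "F a = 0" by auto
    \<comment> \<open>An automorphism of the disk moves the zero of \<open>F\<close> to the center,
      where the branch point of \<open>z ^ t\<close> is.\<close>
    obtain m' m where m: "m' a = 0" "m' holomorphic_on ball 0 1" "m' ` ball 0 1 \<subseteq> ball 0 1"
      "m holomorphic_on ball 0 1" "m ` ball 0 1 \<subseteq> ball 0 1"
      "\<And>z. z \<in> ball 0 1 \<Longrightarrow> m' (m z) = z" "\<And>z. z \<in> ball 0 1 \<Longrightarrow> m (m' z) = z"
      using ball_biholomorphism_exists[OF a(1)] by blast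
    have m1: "m z \<in> ball 0 1" "m' z \<in> ball 0 1" if "z \<in> ball 0 1" for z using m(3,5) that by blast+
    have m0: "m 0 = a" using m(1,7) a(1) by metis
    have minj: "inj_on m (ball 0 1)" using m(6) by (metis inj_onI)
    have mim: "m ` ball 0 1 = ball 0 1" using m1 m(7) by (metis image_eqI subsetI subset_antisym image_subsetI)
    define \<alpha>' where "\<alpha>' z = \<alpha> (m z)" for z
    have \<alpha>': "conformal_from_disk \<alpha>' A"
    proof -
      have "sphere_holomorphic_on \<alpha>' (ball 0 1)" unfolding \<alpha>'_def
        by (rule sphere_holomorphic_compose[OF \<alpha>D(1) _ m(4)]) (use m1 in auto)
      moreover have "inj_on \<alpha>' (ball 0 1)" unfolding \<alpha>'_def
        using \<alpha>D(2) minj m1 by (auto simp: inj_on_def)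
      moreover have "\<alpha>' ` ball 0 1 = A" unfolding \<alpha>'_def using mim \<alpha>D(3) by (metis image_image)
      ultimately show ?thesis using conformal_from_diskI by metis
    qed
    define F' where "F' z = F (m z)" for z
    have F'hol: "F' holomorphic_on ball 0 1" unfolding F'_def
      using holomorphic_on_compose_gen[OF m(4) Fhol m(5)] by (simp add: o_def)
    have F'inj: "inj_on F' (ball 0 1)" unfolding F'_def using Finj minj m1 by (auto simp: inj_on_def)
    have F'0: "F' 0 = 0" by (simp add: F'_def m0 a)
    have F'1: "F' z \<in> ball 0 1" "\<psi> (F' z) = \<alpha>' z" if "z \<in> ball 0 1" for z
      using F\<psi> m1 that by (auto simp: F'_def \<alpha>'_def simp del: mem_ball)
    \<comment> \<open>The quotient of \<open>F'\<close> by \<open>z\<close> with its singularity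
      removed. Injectivity of \<open>F'\<close> leaves \<open>H\<close> without zeros, so it has a
      holomorphic \<open>t\<close>-th root.\<close>
    define H where "H z = (if z = 0 then deriv F' 0 else (F' z - F' 0) / (z - 0))" for z
    have Hhol: "H holomorphic_on ball 0 1" unfolding H_def
      by (rule pole_lemma[OF F'hol]) simp
    have HF: "F' z = z * H z" for z by (simp add: H_def F'0)
    have Hnz: "H z \<noteq> 0" if "z \<in> ball 0 1" for z
    proof (cases "z = 0")
      case True
      then show ?thesis using holomorphic_injective_imp_regular[OF F'hol _ F'inj, of 0] by (simp add: H_def)
    next
      case False
      then have "F' z \<noteq> 0" using F'inj that F'0 by (auto simp: inj_on_def)
      then show ?thesis using HF by auto
    qed
    obtain K where K: "K holomorphic_on ball 0 1" "\<And>z. z \<in> ball 0 1 \<Longrightarrow> K z ^ t = H z"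
      using holomorphic_root_ball[OF Hhol Hnz t] by blast
    define G where "G z = z * K (z ^ t)" for z
    have zt: "z ^ t \<in> ball 0 1" if "z \<in> ball 0 1" for z :: complex
      using that power_in_unit_ball_iff[OF t] by blast
    have Gt: "G z ^ t = F' (z ^ t)" if "z \<in> ball 0 1" for z
      using K(2)[OF zt[OF that]] HF[of "z ^ t"] by (simp add: G_def power_mult_distrib)
    have Knz: "K z \<noteq> 0" if "z \<in> ball 0 1" for z
      using K(2)[OF that] Hnz[OF that] t by (metis power_0_left not_one_le_zero)
    obtain u' where u': "u' \<in> ball 0 1" "u = m u'" using u(1) mim by (metis imageE)
    have Fu': "F' u' = \<zeta> ^ t" using Fu u' by (simp add: F'_def)
    obtain z0 where z0: "z0 ^ t = u'" using complex_root_exists[OF t] by blast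
    have z01: "z0 \<in> ball 0 1" using z0 u'(1) power_in_unit_ball_iff[OF t, of z0] by metis
    have "\<exists>z1\<in>ball 0 1. G z1 = \<zeta>"
    proof (cases "z0 = 0")
      case True
      then have "\<zeta> ^ t = 0" using Fu' z0 t F'0 by (metis power_0_left not_one_le_zero)
      then have "G z0 = \<zeta>" using True t by (simp add: G_def)
      then show ?thesis using z01 by blast
    next
      case False
      then have Gnz: "G z0 \<noteq> 0" using Knz[OF zt[OF z01]] by (simp add: G_def)
      \<comment> \<open>\<open>K\<close> sees only \<open>z ^ t\<close>, so \<open>G\<close>
        commutes with rotations by \<open>t\<close>-th roots of unity, and rotating
        \<open>z0\<close> reaches \<open>\<zeta>\<close>.\<close>
      define \<omega> where "\<omega> = \<zeta> / G z0"
      have "G z0 ^ t = \<zeta> ^ t" using Gt[OF z01] z0 Fu' by simp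
      moreover have "G z0 ^ t \<noteq> 0" using Gnz by simp
      ultimately have \<omega>: "\<omega> ^ t = 1" unfolding \<omega>_def power_divide by (metis divide_self)
      have "G (\<omega> * z0) = \<omega> * G z0"
        by (simp only: G_def power_mult_distrib \<omega> mult_1_left mult.assoc)
      also have "\<dots> = \<zeta>" using Gnz by (simp add: \<omega>_def)
      finally have "G (\<omega> * z0) = \<zeta>" .
      moreover have "(\<omega> * z0) ^ t \<in> ball 0 1" using \<omega> z0 u'(1) by (simp add: power_mult_distrib)
      then have "\<omega> * z0 \<in> ball 0 1" using power_in_unit_ball_iff[OF t] by blast
      ultimately show ?thesis by blast
    qed
    show thesis
    proof (rule fin[of G \<alpha>' t])
      show "G holomorphic_on ball 0 1" unfolding G_def
        using holomorphic_on_compose_gen[of "\<lambda>z. z ^ t" "ball 0 1" K "ball 0 1"] K(1) zt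
        by (intro holomorphic_intros) (auto simp: o_def holomorphic_intros image_subset_iff simp del: mem_ball)
      show "inj_on G (ball 0 1)"
      proof (rule inj_onI)
        fix z z' assume z: "z \<in> ball 0 1" "z' \<in> ball 0 1" "G z = G z'"
        have "F' (z ^ t) = F' (z' ^ t)" unfolding Gt[OF z(1), symmetric] Gt[OF z(2), symmetric] z(3) ..
        then have "z ^ t = z' ^ t" by (rule inj_onD[OF F'inj _ zt[OF z(1)] zt[OF z(2)]])
        then show "z = z'" using z Knz[OF zt[OF z(1)]] by (simp add: G_def)
      qed
      show "\<zeta> \<in> G ` ball 0 1" using \<open>\<exists>z1\<in>ball 0 1. G z1 = \<zeta>\<close> by blast
      show "G z ^ t \<in> ball 0 1" if "z \<in> ball 0 1" for z
        unfolding Gt[OF that] by (rule F'1(1)[OF zt[OF that]])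
      show "\<psi> (G z ^ t) = \<alpha>' (z ^ t)" if "z \<in> ball 0 1" for z
        unfolding Gt[OF that] by (rule F'1(2)[OF zt[OF that]])
    qed (use t \<alpha>' in auto)
  qed
qed

subsection \<open>Branched coverings\<close>

locale sphere_covering =
  fixes S :: "complex option set" and f :: "complex option \<Rightarrow> complex option" and d :: nat
  assumes S_cases: "S = UNIV \<or> S = range Some \<or> S = Some ` ball 0 1"
    and degree: "1 < d"
    and covering: "branched_covering S f d"
begin

lemma S_open: "openin riemann_sphere S"
proof -
  have "range Some = pt (Some 0) ` UNIV" "Some ` ball 0 1 = pt (Some 0) ` ball 0 1"
    by (auto simp: pt_def chart_def)
  then show ?thesis
    using S_cases openin_pt_image[of UNIV] openin_pt_image[of "ball 0 1"] openin_topspace[of riemann_sphere]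
    by (metis open_UNIV open_ball topspace_sphere)
qed

lemma Some_in_S: "Some ` ball 0 1 \<subseteq> S"
  using S_cases by auto

lemma infinite_S: "infinite S"
proof -
  have "infinite (Some ` ball 0 1 :: complex option set)"
    using uncountable_ball[of 1 "0::complex"] uncountable_infinite finite_imageD[of Some "ball (0::complex) 1"]
    by (metis inj_Some inj_on_subset subset_UNIV zero_less_one)
  then show ?thesis using Some_in_S finite_subset by blast
qed

lemma f_into: "f ` S \<subseteq> S"
  using covering by (simp add: branched_covering_def)

definition sheets_over where
  "sheets_over y V \<W> t \<longleftrightarrow>
        openin riemann_sphere V \<and> y \<in> V \<and> V \<subseteq> S \<and>
        finite \<W> \<and> disjoint \<W> \<and> \<Union>\<W> = {z \<in> S. f z \<in> V} \<and>
        (\<forall>W\<in>\<W>. openin riemann_sphere W \<and> 1 \<le> t W \<and>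
           (\<exists>\<phi> \<psi>. power_in_coordinates f (t W) \<phi> W \<psi> V \<and> \<psi> 0 = y)) \<and>
        (\<Sum>W\<in>\<W>. t W) = d"

lemma sheets_exist: "y \<in> S \<Longrightarrow> \<exists>V \<W> t. sheets_over y V \<W> t"
  using covering unfolding branched_covering_def sheets_over_def by blast

lemma sheets_overD:
  assumes "sheets_over y V \<W> t"
  shows "openin riemann_sphere V" "y \<in> V" "V \<subseteq> S" "finite \<W>" "disjoint \<W>"
    "\<Union>\<W> = {z \<in> S. f z \<in> V}" "\<And>W. W \<in> \<W> \<Longrightarrow> openin riemann_sphere W" "\<And>W. W \<in> \<W> \<Longrightarrow> 1 \<le> t W"
    "\<And>W. W \<in> \<W> \<Longrightarrow> \<exists>\<phi> \<psi>. power_in_coordinates f (t W) \<phi> W \<psi> V \<and> \<psi> 0 = y"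
    "(\<Sum>W\<in>\<W>. t W) = d"
  using assms unfolding sheets_over_def by blast+

text \<open>Over a small disk, \<open>f\<close> is a coordinate followed by \<open>z ^ t\<close> and
  a parametrization; the transition lemma makes the coordinate holomorphic along any
  \<open>\<phi>\<close>.\<close>

lemma self: "holomorphic_self S f"
  unfolding holomorphic_self_def
proof (intro conjI f_into allI impI)
  fix \<phi> A assume A: "open A" "sphere_holomorphic_on \<phi> A" "\<phi> ` A \<subseteq> S"
  show "sphere_holomorphic_on (\<lambda>z. f (\<phi> z)) A"
  proof (rule sphere_holomorphic_local)
    fix z assume z: "z \<in> A"
    then have "f (\<phi> z) \<in> S" using A(3) f_into by blast
    then obtain V \<W> t where "sheets_over (f (\<phi> z)) V \<W> t" using sheets_exist by blast
    note V = sheets_overD[OF this]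
    have "\<phi> z \<in> S" using z A(3) by blast
    then have "\<phi> z \<in> \<Union>\<W>" unfolding V(6) using V(2) by simp
    then obtain W where W: "W \<in> \<W>" "\<phi> z \<in> W" by blast
    obtain \<phi>' \<psi> where pw: "power_in_coordinates f (t W) \<phi>' W \<psi> V" using V(9)[OF W(1)] by blast
    then have \<phi>': "conformal_from_disk \<phi>' W" and \<psi>: "conformal_from_disk \<psi> V"
      and eq: "\<And>z. z \<in> ball 0 1 \<Longrightarrow> f (\<phi>' z) = \<psi> (z ^ t W)"
      by (auto simp: power_in_coordinates_def)
    define B where "B = {w \<in> A. \<phi> w \<in> W}"
    have B: "open B" unfolding B_def by (intro sphere_holomorphic_vimage A V(7) W)
    define g where "g w = inv_into (ball 0 1) \<phi>' (\<phi> w)" for w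
    have im: "\<phi> w \<in> \<phi>' ` ball 0 1" if "w \<in> B" for w
      using that conformal_from_diskD(3)[OF \<phi>'] by (simp add: B_def)
    have g: "g holomorphic_on B" unfolding g_def
      by (rule holomorphic_transition[OF conformal_from_diskD(1)[OF \<phi>'] _ conformal_from_diskD(2)[OF \<phi>']
          sphere_holomorphic_subset[OF A(2)] B]) (use im in \<open>auto simp: B_def\<close>)
    have g1: "g w \<in> ball 0 1" "\<phi>' (g w) = \<phi> w" if "w \<in> B" for w
      using im[OF that] unfolding g_def by (rule inv_into_into, rule f_inv_into_f)
    have "sphere_holomorphic_on (\<lambda>w. \<psi> (g w ^ t W)) B"
    proof (rule sphere_holomorphic_compose[OF conformal_from_diskD(1)[OF \<psi>]])
      show "(\<lambda>w. g w ^ t W) holomorphic_on B" using g by (intro holomorphic_intros)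
      show "g w ^ t W \<in> ball 0 1" if "w \<in> B" for w
        using g1(1)[OF that] power_in_unit_ball_iff[OF V(8)[OF W(1)]] by blast
    qed (use B in auto)
    then have "sphere_holomorphic_on (\<lambda>w. f (\<phi> w)) B"
      by (rule sphere_holomorphic_cong[OF _ B]) (metis g1 eq)
    moreover have "z \<in> B" using z W(2) by (simp add: B_def)
    ultimately show "\<exists>B. z \<in> B \<and> sphere_holomorphic_on (\<lambda>z. f (\<phi> z)) B" by blast
  qed
qed

lemma self_iter: "holomorphic_self S (f ^^ k)"
  by (rule holomorphic_self_funpow[OF self])

lemma iter_in_S: "z \<in> S \<Longrightarrow> (f ^^ k) z \<in> S"
  using self_iter[of k] by (auto simp: holomorphic_self_def)

lemma preimage_exists:
  assumes "y \<in> S" shows "\<exists>z\<in>S. f z = y"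
proof -
  obtain V \<W> t where "sheets_over y V \<W> t" using sheets_exist assms by blast
  note V = sheets_overD[OF this]
  have "\<W> \<noteq> {}" using V(10) degree by auto
  then obtain W where W: "W \<in> \<W>" by blast
  then obtain \<phi> \<psi> where pw: "power_in_coordinates f (t W) \<phi> W \<psi> V" "\<psi> 0 = y" using V(9) by blast
  then have "f (\<phi> 0) = y" "\<phi> 0 \<in> W"
    using V(8)[OF W] conformal_from_diskD(3)[of \<phi> W] by (auto simp: power_in_coordinates_def power_0_left)
  then show ?thesis using V(6) W by blast
qed

lemma iter_preimage_exists: "y \<in> S \<Longrightarrow> \<exists>z\<in>S. (f ^^ k) z = y"
proof (induction k arbitrary: y)
  case (Suc k)
  then obtain z where "z \<in> S" "f z = y" using preimage_exists by blast
  then show ?case using Suc.IH[of z] by auto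
qed auto

text \<open>The sheets are centered over \<open>f c\<close>, so \<open>c\<close> is the center of
  its own sheet, and injectivity near \<open>c\<close> gives that sheet exponent 1. As the exponents
  add up to \<open>d > 1\<close>, there is a second sheet with its own center.\<close>

lemma other_preimage:
  assumes "c \<in> N" "openin riemann_sphere N" "N \<subseteq> S" "inj_on f N"
  obtains q where "q \<in> S" "q \<noteq> c" "f q = f c"
proof -
  have cS: "c \<in> S" using assms by blast
  then have "f c \<in> S" using f_into by blast
  then obtain V \<W> t where "sheets_over (f c) V \<W> t" using sheets_exist by blast
  note V = sheets_overD[OF this]
  have "c \<in> \<Union>\<W>" unfolding V(6) using V(2) cS by simp
  then obtain W where W: "W \<in> \<W>" "c \<in> W" by blast
  have W0: "W \<subseteq> S" using W(1) V(6) by blast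
  have center: "f (\<phi> 0) = f c" "\<phi> 0 \<in> W'"
    if "W' \<in> \<W>" "power_in_coordinates f (t W') \<phi> W' \<psi> V" "\<psi> 0 = f c" for W' \<phi> \<psi>
    using that V(8)[OF that(1)] conformal_from_diskD(3)[of \<phi> W']
    by (auto simp: power_in_coordinates_def power_0_left)
  obtain \<phi> \<psi> where pw: "power_in_coordinates f (t W) \<phi> W \<psi> V" "\<psi> 0 = f c" using V(9) W(1) by blast
  then have \<phi>: "conformal_from_disk \<phi> W" and \<psi>: "conformal_from_disk \<psi> V"
    and eq: "\<And>z. z \<in> ball 0 1 \<Longrightarrow> f (\<phi> z) = \<psi> (z ^ t W)"
    by (auto simp: power_in_coordinates_def)
  obtain \<zeta> where \<zeta>: "\<zeta> \<in> ball 0 1" "c = \<phi> \<zeta>" using W(2) conformal_from_diskD(3)[OF \<phi>] by auto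
  have "\<psi> (\<zeta> ^ t W) = \<psi> 0" using eq[OF \<zeta>(1)] \<zeta>(2) pw(2) by simp
  then have "\<zeta> ^ t W = 0"
    using inj_onD[OF conformal_from_diskD(2)[OF \<psi>], of "\<zeta> ^ t W" 0] \<zeta>(1)
      power_in_unit_ball_iff[OF V(8)[OF W(1)], of \<zeta>]
    by simp
  then have c0: "c = \<phi> 0" using \<zeta>(2) by simp
  have "t W = 1"
  proof (rule ccontr)
    assume "t W \<noteq> 1"
    then have "2 \<le> t W" using V(8)[OF W(1)] by linarith
    then have "sphere_deriv f c = 0"
      using power_ge_two_critical(1)[OF self S_open pw(1) _ W0] c0 by (simp add: critical_points_def)
    then show False using sphere_deriv_nonzero_if_inj[OF self S_open assms] by simp
  qed
  then have "\<W> \<noteq> {W}" using V(10) degree by auto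
  then obtain W' where W': "W' \<in> \<W>" "W' \<noteq> W" using W(1) by blast
  then obtain \<phi>' \<psi>' where pw': "power_in_coordinates f (t W') \<phi>' W' \<psi>' V" "\<psi>' 0 = f c" using V(9) by blast
  have "W' \<inter> W = {}" using V(5) W' W(1) by (auto simp: disjoint_def)
  then have "\<phi>' 0 \<noteq> c" using center(2)[OF W'(1) pw'] W(2) by blast
  moreover have "\<phi>' 0 \<in> S" using center(2)[OF W'(1) pw'] W'(1) V(6) by blast
  ultimately show ?thesis using center(1)[OF W'(1) pw'] that by blast
qed

text \<open>At a finite point that is not a pole, the derivative vanishes only with the numerator
  \<open>r\<close> of the quotient rule. Poles and infinity are just added to the finite
  bound.\<close>

lemma finite_critical_points:
  assumes "rational_on S f" shows "finite (critical_points S f)"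
proof -
  obtain p q where pq: "q \<noteq> 0" "coprime p q" "\<And>z. z \<in> S \<Longrightarrow> f z = rational_map p q z"
    using assms by (auto simp: rational_on_def)
  define r where "r = pderiv p * q - p * pderiv q"
  have "r \<noteq> 0"
  proof
    assume "r = 0"
    then have eq: "pderiv p * q = p * pderiv q" by (simp add: r_def)
    have "degree q = 0"
    proof (rule ccontr)
      assume dq: "degree q \<noteq> 0"
      then obtain a where a: "poly q a = 0"
        using fundamental_theorem_of_algebra[of q] by (auto simp: constant_degree)
      have "poly p a \<noteq> 0"
      proof
        assume "poly p a = 0"
        then have "is_unit [:- a, 1:]" using a pq(2) by (auto simp: coprime_def poly_eq_0_iff_dvd)
        then show False by (simp add: is_unit_pCons_iff)
      qed
      then have p: "p \<noteq> 0" "order a p = 0" by (auto simp: order_root)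
      have q': "pderiv q \<noteq> 0" using dq by (simp add: pderiv_eq_0_iff)
      \<comment> \<open>At a root \<open>a\<close> of \<open>q\<close>, the left side of
        \<open>eq\<close> vanishes at least to the order of \<open>q\<close>, but the right side
        only to one order less, since \<open>p\<close> does not vanish there.\<close>
      have "order a q = Suc (order a (pderiv q))" by (rule order_pderiv[OF pq(1) a])
      moreover have "order a (p * pderiv q) = order a (pderiv q)" using p q' by (simp add: order_mult)
      moreover have "p * pderiv q \<noteq> 0" using p(1) q' by simp
      then have "order a (pderiv p * q) = order a (pderiv p) + order a q"
        using eq by (intro order_mult) simp
      ultimately show False using eq by simp
    qed
    moreover from this have "pderiv q = 0" by (simp add: pderiv_eq_0_iff)
    then have "pderiv p = 0" using eq pq(1) by simp
    then have "degree p = 0" by (simp add: pderiv_eq_0_iff)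
    ultimately have "degree q = 0" "degree p = 0" by simp_all
    then obtain a b where ab: "q = [:a:]" "p = [:b:]" by (metis degree_eq_zeroE)
    \<comment> \<open>A map with at most two values cannot be onto the infinite set
      \<open>S\<close>.\<close>
    have "f z \<in> {Some (b / a), f None}" if "z \<in> S" for z
      using pq(1) pq(3)[OF that] ab by (cases z) auto
    then have "S \<subseteq> {Some (b / a), f None}" using preimage_exists by blast
    then show False using infinite_S finite_subset by blast
  qed
  have "z = None \<or> z \<in> Some ` {a. poly q a = 0} \<or> z \<in> Some ` {a. poly r a = 0}"
    if z: "z \<in> critical_points S f" for z
  proof (cases z)
    case (Some a)
    show ?thesis
    proof (cases "poly q a = 0")
      case False
      define A where "A = {b. Some b \<in> S \<and> poly q b \<noteq> 0}"
      have "open {b. Some b \<in> S}" using S_open openin_sphere_iff by blast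
      moreover have "open {b. poly q b \<noteq> 0}" by (intro open_Collect_neq continuous_intros)
      ultimately have "open ({b. Some b \<in> S} \<inter> {b. poly q b \<noteq> 0})" by (rule open_Int)
      moreover have "A = {b. Some b \<in> S} \<inter> {b. poly q b \<noteq> 0}" by (auto simp: A_def)
      ultimately have A: "open A" "a \<in> A" using z Some False by (auto simp: A_def critical_points_def)
      have val: "f (Some b) = Some (poly p b / poly q b)" if "b \<in> A" for b
        using that pq(3) by (simp add: A_def)
      have "((\<lambda>b. poly p b / poly q b) has_field_derivative
          (poly (pderiv p) a * poly q a - poly p a * poly (pderiv q) a) / (poly q a * poly q a)) (at a)"
        using False by (intro DERIV_divide poly_DERIV)
      then have "((\<lambda>b. the (chart (f z) (f (chart z (Some b))))) has_field_derivative
          (poly (pderiv p) a * poly q a - poly p a * poly (pderiv q) a) / (poly q a * poly q a)) (at a)"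
        by (rule has_field_derivative_transform_within_open[OF _ A])
           (use val A Some in \<open>simp add: chart_def\<close>)
      then have "sphere_deriv f z = poly r a / (poly q a * poly q a)"
        using DERIV_imp_deriv Some by (fastforce simp: sphere_deriv_def r_def chart_def)
      then have "poly r a = 0" using z False by (simp add: critical_points_def)
      then show ?thesis using Some by blast
    qed (use Some in blast)
  qed simp
  then have "critical_points S f \<subseteq> insert None (Some ` {a. poly q a = 0} \<union> Some ` {a. poly r a = 0})"
    by blast
  moreover have "finite (insert None (Some ` {a. poly q a = 0} \<union> Some ` {a. poly r a = 0}))"
    by (intro finite.insertI finite_UnI finite_imageI poly_roots_finite pq(1) \<open>r \<noteq> 0\<close>)
  ultimately show ?thesis by (rule finite_subset)
qed

subsection \<open>Plaques\<close>

lemma plaqueD: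
  assumes "plaque S f d U"
  shows "U i \<subseteq> S" "openin riemann_sphere (U i)" "f ` U (Suc i) = U i"
    "connectedin riemann_sphere (U i)" "\<exists>\<phi>. conformal_from_disk \<phi> (U i)"
    "\<exists>t\<in>{1..d}. \<exists>\<phi> \<psi>. power_in_coordinates f t \<phi> (U (Suc i)) \<psi> (U i)"
proof -
  show "U i \<subseteq> S" "openin riemann_sphere (U i)" "f ` U (Suc i) = U i" "\<exists>\<phi>. conformal_from_disk \<phi> (U i)"
    "\<exists>t\<in>{1..d}. \<exists>\<phi> \<psi>. power_in_coordinates f t \<phi> (U (Suc i)) \<psi> (U i)"
    using assms by (simp_all add: plaque_def open_seq_def)
  then show "connectedin riemann_sphere (U i)" using conformal_connected by blast
qed

lemma plaqueI:
  assumes "\<And>i. U i \<subseteq> S"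
    and pw: "\<And>i. \<exists>t\<in>{1..d}. \<exists>\<phi> \<psi>. power_in_coordinates f t \<phi> (U (Suc i)) \<psi> (U i)"
  shows "plaque S f d U"
proof -
  have c: "\<exists>\<phi>. conformal_from_disk \<phi> (U i)" for i
    using pw[of i] by (auto simp: power_in_coordinates_def)
  moreover have "f ` U (Suc i) = U i" for i
    using pw[of i] power_in_coordinates_image by fastforce
  moreover have "openin riemann_sphere (U i)" for i using c conformal_from_diskD(4) by blast
  ultimately show ?thesis using assms by (simp add: plaque_def open_seq_def)
qed

lemma plaque_shift: "plaque S f d U \<Longrightarrow> plaque S f d (\<lambda>i. U (i + k))"
  by (simp add: plaque_def open_seq_def)

lemma points_ofD:
  assumes "y \<in> points_of S f U"
  shows "y i \<in> U i" "y i \<in> S" "f (y (Suc i)) = y i"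
  using assms by (auto simp: points_of_def plaque_limit_def)

lemma backward_orbit_iter:
  assumes "\<And>i. f (y (Suc i)) = y i" shows "(f ^^ k) (y (i + k)) = y i"
proof (induction k arbitrary: i)
  case (Suc k)
  then show ?case using assms[of "i + k"] by (metis add_Suc_right funpow_Suc_right comp_apply)
qed simp

text \<open>Stated for any finite chain of connected sets that \<open>f\<close> maps downwards, so
  as to cover both the entries of another plaque and the forward images of a single set.\<close>

lemma plaque_absorb_seq:
  assumes V: "plaque S f d V"
    and C: "\<And>i. i \<le> N \<Longrightarrow> connectedin riemann_sphere (C i) \<and> C i \<subseteq> S \<and> C i \<inter> V i \<noteq> {}"
    and im: "\<And>i. i < N \<Longrightarrow> f ` C (Suc i) \<subseteq> C i" and 0: "C 0 \<subseteq> V 0" and i: "i \<le> N"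
  shows "C i \<subseteq> V i"
  using i
proof (induction i)
  case (Suc i)
  obtain t \<phi> \<psi> where "t \<in> {1..d}" "power_in_coordinates f t \<phi> (V (Suc i)) \<psi> (V i)"
    using plaqueD(6)[OF V] by blast
  moreover have "f ` C (Suc i) \<subseteq> V i" using Suc im[of i] by auto
  ultimately show ?case
    using power_in_coordinates_absorb[OF self S_open, of t \<phi> "V (Suc i)" \<psi> "V i" "C (Suc i)"] C[OF Suc.prems]
    by simp
qed (use 0 in simp)

lemma plaque_mono:
  assumes "plaque S f d U" "plaque S f d V" "y \<in> points_of S f U" "y \<in> points_of S f V" "U 0 \<subseteq> V 0"
  shows "U i \<subseteq> V i"
proof (rule plaque_absorb_seq[OF assms(2), of i])
  fix j show "connectedin riemann_sphere (U j) \<and> U j \<subseteq> S \<and> U j \<inter> V j \<noteq> {}"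
    using plaqueD(1,4)[OF assms(1)] points_ofD(1)[OF assms(3)] points_ofD(1)[OF assms(4)] by blast
  show "f ` U (Suc j) \<subseteq> U j" using plaqueD(3)[OF assms(1)] by blast
qed (use assms in auto)

text \<open>The chain consists of the images of \<open>C\<close> under \<open>f ^^ (i - j)\<close>;
  each contains \<open>y j\<close>, so containment in \<open>V 0\<close> propagates back up to level
  \<open>i\<close>.\<close>

lemma plaque_absorb_iter:
  assumes V: "plaque S f d V" and C: "connectedin riemann_sphere C" "C \<subseteq> S"
    and y: "y \<in> points_of S f V" "y i \<in> C" and im: "(f ^^ i) ` C \<subseteq> V 0"
  shows "C \<subseteq> V i"
proof -
  define D where "D j = (f ^^ (i - j)) ` C" for j
  have "D i \<subseteq> V i"
  proof (rule plaque_absorb_seq[OF V, of i])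
    fix j assume j: "j \<le> i"
    have "y j = (f ^^ (i - j)) (y i)"
      using backward_orbit_iter[of y "i - j" j] points_ofD(3)[OF y(1)] j by simp
    then have "y j \<in> D j" using y(2) by (auto simp: D_def)
    moreover have "connectedin riemann_sphere (D j)"
      unfolding D_def by (rule holomorphic_self_connected[OF self_iter S_open C])
    moreover have "D j \<subseteq> S" using C(2) iter_in_S by (auto simp: D_def)
    ultimately show "connectedin riemann_sphere (D j) \<and> D j \<subseteq> S \<and> D j \<inter> V j \<noteq> {}"
      using points_ofD(1)[OF y(1)] by blast
  next
    fix j assume "j < i"
    then have "i - j = Suc (i - Suc j)" by simp
    then show "f ` D (Suc j) \<subseteq> D j" by (simp add: D_def image_image)
  qed (use im in \<open>auto simp: D_def\<close>)
  then show ?thesis by (simp add: D_def)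
qed

text \<open>Dependent choice: each entry is the pullback of the previous one inside the entry of
  \<open>U\<close>. The new exponents never exceed those of \<open>U\<close>, which keeps them
  within \<open>d\<close>.\<close>

lemma plaque_shrink:
  assumes U: "plaque S f d U" and y: "y \<in> points_of S f U" and A: "A \<subseteq> U 0" "y 0 \<in> A"
    and \<alpha>: "conformal_from_disk \<alpha> A"
  obtains V where "plaque S f d V" "V 0 = A" "y \<in> points_of S f V" "\<And>i. V i \<subseteq> U i"
proof -
  \<comment> \<open>The last conjunct forces the chosen sequence to start with
    \<open>A\<close>.\<close>
  define P where "P i B \<longleftrightarrow> B \<subseteq> U i \<and> y i \<in> B \<and> (\<exists>\<beta>. conformal_from_disk \<beta> B) \<and> (i = 0 \<longrightarrow> B = A)" for i B
  define Q where "Q i B B' \<longleftrightarrow> (\<exists>s\<in>{1..d}. \<exists>\<phi> \<psi>. power_in_coordinates f s \<phi> B' \<psi> B)" for i :: nat and B B'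
  have "\<exists>V. \<forall>i. P i (V i) \<and> Q i (V i) (V (Suc i))"
  proof (rule dependent_nat_choice)
    show "\<exists>B. P 0 B" using A \<alpha> by (auto simp: P_def)
  next
    fix B i assume B: "P i B"
    then obtain \<beta> where \<beta>: "conformal_from_disk \<beta> B" by (auto simp: P_def)
    obtain t \<phi> \<psi> where t: "t \<in> {1..d}" "power_in_coordinates f t \<phi> (U (Suc i)) \<psi> (U i)"
      using plaqueD(6)[OF U] by blast
    have "f (y (Suc i)) \<in> B" "y (Suc i) \<in> U (Suc i)" "B \<subseteq> U i" "1 \<le> t"
      using B points_ofD[OF y] t(1) by (auto simp: P_def)
    then obtain s \<phi>' \<alpha>' B' where "1 \<le> s" "s \<le> t" "B' \<subseteq> U (Suc i)" "y (Suc i) \<in> B'"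
        "power_in_coordinates f s \<phi>' B' \<alpha>' B"
      using pullback_disk[OF t(2) _ \<beta>] by metis
    moreover have "s \<in> {1..d}" using \<open>1 \<le> s\<close> \<open>s \<le> t\<close> t(1) by simp
    moreover have "conformal_from_disk \<phi>' B'"
      using calculation(5) by (simp add: power_in_coordinates_def)
    ultimately have "P (Suc i) B'" "Q i B B'" unfolding P_def Q_def by blast+
    then show "\<exists>B'. P (Suc i) B' \<and> Q i B B'" by blast
  qed
  then obtain V where V: "\<And>i. P i (V i)" "\<And>i. Q i (V i) (V (Suc i))" by blast
  show ?thesis
  proof
    show "plaque S f d V"
    proof (rule plaqueI)
      show "V i \<subseteq> S" for i using V(1)[of i] plaqueD(1)[OF U, of i] by (auto simp: P_def)
      show "\<exists>t\<in>{1..d}. \<exists>\<phi> \<psi>. power_in_coordinates f t \<phi> (V (Suc i)) \<psi> (V i)" for i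
        using V(2)[of i] unfolding Q_def .
    qed
    show "V 0 = A" using V(1)[of 0] by (simp add: P_def)
    show "y \<in> points_of S f V" using y V(1) by (auto simp: points_of_def P_def)
    show "V i \<subseteq> U i" for i using V(1)[of i] by (simp add: P_def)
  qed
qed

lemma plaque_bij_or_critical:
  assumes "plaque S f d V"
  shows "bij_betw f (V (Suc i)) (V i) \<or> (\<exists>c\<in>critical_points S f. c \<in> V (Suc i))"
proof -
  obtain t \<phi> \<psi> where t: "t \<in> {1..d}" "power_in_coordinates f t \<phi> (V (Suc i)) \<psi> (V i)"
    using plaqueD(6)[OF assms] by blast
  consider "t = 1" | "2 \<le> t" using t(1) by force
  then show ?thesis
  proof cases
    case 1
    then show ?thesis using power_one_bij t(2) by blast
  next
    case 2
    then show ?thesis using power_ge_two_critical[OF self S_open t(2) _ plaqueD(1)[OF assms]] by blast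
  qed
qed

lemma critical_not_inj:
  assumes "c \<in> critical_points S f" "c \<in> N" "openin riemann_sphere N" "N \<subseteq> S"
  shows "\<not> inj_on f N"
  using sphere_deriv_nonzero_if_inj[OF self S_open assms(2-4)] assms(1)
  by (auto simp: critical_points_def)

text \<open>The parametrizations in a plaque are unrelated from step to step. On univalent steps
  they can be replaced by the inverse branch of \<open>f ^^ m\<close> along one fixed coordinate of
  the first entry.\<close>

lemma plaque_chain:
  assumes V: "plaque S f d V" and bij: "\<And>i. i < m \<Longrightarrow> bij_betw f (V (Suc i)) (V i)"
    and \<alpha>: "conformal_from_disk \<alpha> (V 0)"
  obtains \<beta> where "conformal_from_disk \<beta> (V m)" "\<And>z. z \<in> ball 0 1 \<Longrightarrow> (f ^^ m) (\<beta> z) = \<alpha> z"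
proof -
  have "\<exists>\<beta>. conformal_from_disk \<beta> (V m) \<and> (\<forall>z\<in>ball 0 1. (f ^^ m) (\<beta> z) = \<alpha> z)"
    using bij
  proof (induction m)
    case 0
    then show ?case using \<alpha> by (intro exI[of _ \<alpha>]) auto
  next
    case (Suc m)
    then obtain \<beta> where \<beta>: "conformal_from_disk \<beta> (V m)" "\<And>z. z \<in> ball 0 1 \<Longrightarrow> (f ^^ m) (\<beta> z) = \<alpha> z"
      by (metis less_SucI)
    obtain \<phi> where \<phi>: "conformal_from_disk \<phi> (V (Suc m))" using plaqueD(5)[OF V] by blast
    note \<phi>D = conformal_from_diskD[OF \<phi>] and \<beta>D = conformal_from_diskD[OF \<beta>(1)]
    have b: "bij_betw f (V (Suc m)) (V m)" using Suc.prems by blast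
    \<comment> \<open>\<open>h\<close> parametrizes \<open>V m\<close> as \<open>\<beta>\<close>
      does; the change of parameter from \<open>\<beta>\<close> to \<open>h\<close>, followed by
      \<open>\<phi>\<close>, is the lift of \<open>\<beta>\<close>.\<close>
    define h where "h z = f (\<phi> z)" for z
    have hhol: "sphere_holomorphic_on h (ball 0 1)"
      using self \<phi>D(1,3) plaqueD(1)[OF V] by (auto simp: holomorphic_self_def h_def[abs_def])
    have hinj: "inj_on h (ball 0 1)"
    proof (rule inj_onI)
      fix z w assume zw: "z \<in> ball 0 1" "w \<in> ball 0 1" "h z = h w"
      then have "\<phi> z \<in> V (Suc m)" "\<phi> w \<in> V (Suc m)" using \<phi>D(3) by blast+
      then have "\<phi> z = \<phi> w" using zw(3) b by (auto simp: h_def bij_betw_def inj_on_def)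
      then show "z = w" using \<phi>D(2) zw by (auto simp: inj_on_def)
    qed
    have him: "h ` ball 0 1 = V m"
      using b \<phi>D(3) by (metis bij_betw_imp_surj_on h_def image_cong image_image)
    define g where "g z = inv_into (ball 0 1) h (\<beta> z)" for z
    have im: "\<beta> z \<in> h ` ball 0 1" if "z \<in> ball 0 1" for z using that him \<beta>D(3) by blast
    have ghol: "g holomorphic_on ball 0 1"
      unfolding g_def by (rule holomorphic_transition[OF hhol _ hinj \<beta>D(1)]) (use im in auto)
    have g: "g z \<in> ball 0 1" "h (g z) = \<beta> z" if "z \<in> ball 0 1" for z
      using im[OF that] unfolding g_def by (rule inv_into_into, rule f_inv_into_f)
    define \<beta>' where "\<beta>' z = \<phi> (g z)" for z
    have "sphere_holomorphic_on \<beta>' (ball 0 1)"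
      unfolding \<beta>'_def by (rule sphere_holomorphic_compose[OF \<phi>D(1) _ ghol]) (use g in auto)
    moreover have "inj_on \<beta>' (ball 0 1)"
    proof (rule inj_onI)
      fix z w assume zw: "z \<in> ball 0 1" "w \<in> ball 0 1" "\<beta>' z = \<beta>' w"
      then have "h (g z) = h (g w)" by (simp add: \<beta>'_def h_def)
      then have "\<beta> z = \<beta> w" using g(2) zw by simp
      then show "z = w" using \<beta>D(2) zw by (auto simp: inj_on_def)
    qed
    moreover have "\<beta>' ` ball 0 1 = V (Suc m)"
    proof
      show "\<beta>' ` ball 0 1 \<subseteq> V (Suc m)" using g(1) \<phi>D(3) by (auto simp: \<beta>'_def simp del: mem_ball)
      show "V (Suc m) \<subseteq> \<beta>' ` ball 0 1"
      proof
        fix s assume "s \<in> V (Suc m)"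
        then obtain a where a: "a \<in> ball 0 1" "s = \<phi> a" using \<phi>D(3) by blast
        then obtain z where z: "z \<in> ball 0 1" "h a = \<beta> z" using him \<beta>D(3) by (metis imageE imageI)
        then have "g z = a" using hinj a(1) g by (metis inj_onD)
        then show "s \<in> \<beta>' ` ball 0 1" using a z by (auto simp: \<beta>'_def)
      qed
    qed
    ultimately have "conformal_from_disk \<beta>' (V (Suc m))" using conformal_from_diskI by metis
    moreover have "(f ^^ Suc m) (\<beta>' z) = \<alpha> z" if "z \<in> ball 0 1" for z
      using \<beta>(2)[OF that] g(2)[OF that] by (simp add: \<beta>'_def h_def funpow_swap1)
    ultimately show ?case by blast
  qed
  then show ?thesis using that by blast
qed

end

section \<open>Classes of binary sequences, and germs with a fixed point\<close>

lemma class_of_le_iff: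
  "class_of a \<le> class_of b \<longleftrightarrow> (\<forall>\<^sub>F j in sequentially. a j \<longrightarrow> b j)"
  unfolding class_of.abs_eq less_eq_binseq_class.abs_eq finite_Collect_not_iff ..

lemma class_of_eq_iff:
  "class_of a = class_of b \<longleftrightarrow> (\<forall>\<^sub>F j in sequentially. a j = b j)"
  unfolding class_of.abs_eq binseq_class.abs_eq_iff almost_eq_iff ..

lemma class_of_cases: obtains \<beta> where "b = class_of \<beta>"
  by (metis Quotient3_abs_rep Quotient3_binseq_class class_of.abs_eq)

text \<open>Used with \<open>\<kappa> = 1\<close> for the inverse branch at a repelling cycle and
  with \<open>\<kappa> < 1\<close> for the return map at an attracting one.\<close>

lemma holomorphic_linear_bound:
  assumes g: "g holomorphic_on A" "open A" "0 \<in> A" "g 0 = (0::complex)" and \<kappa>: "norm (deriv g 0) < \<kappa>"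
  obtains r where "0 < r" "ball 0 r \<subseteq> A" "\<And>z. z \<in> ball 0 r \<Longrightarrow> norm (g z) \<le> \<kappa> * norm z"
proof -
  have "(g has_field_derivative deriv g 0) (at 0)"
    using g holomorphic_derivI by blast
  then have "((\<lambda>h. g h / h) \<longlongrightarrow> deriv g 0) (at 0)"
    using g(4) by (simp add: DERIV_def)
  then have "((\<lambda>h. norm (g h / h)) \<longlongrightarrow> norm (deriv g 0)) (at 0)" by (rule tendsto_norm)
  then have "\<forall>\<^sub>F h in at 0. norm (g h / h) < \<kappa>" using \<kappa> by (rule order_tendstoD(2))
  then obtain r1 where r1: "r1 > 0" "\<And>h. h \<noteq> 0 \<Longrightarrow> norm h < r1 \<Longrightarrow> norm (g h / h) < \<kappa>"
    unfolding eventually_at by (auto simp: dist_norm)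
  obtain r2 where r2: "r2 > 0" "ball 0 r2 \<subseteq> A" using g(2,3) open_contains_ball by metis
  show ?thesis
  proof
    show "0 < min r1 r2" "ball 0 (min r1 r2) \<subseteq> A" using r1 r2 by auto
    show "norm (g z) \<le> \<kappa> * norm z" if "z \<in> ball 0 (min r1 r2)" for z
    proof (cases "z = 0")
      case False
      then have "norm (g z / z) < \<kappa>" using r1(2) that by simp
      then show ?thesis using False by (simp add: norm_divide pos_divide_less_eq)
    qed (use g in simp)
  qed
qed

subsection \<open>Periodic cycles\<close>

locale covering_cycle = sphere_covering +
  fixes n :: nat and p :: "nat \<Rightarrow> complex option"
  assumes cycle: "periodic_cycle S f n p"
begin

abbreviation "x \<equiv> invariant_lift n p"

lemma n_pos: "1 \<le> n"
  using cycle by (simp add: periodic_cycle_def)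

lemma x_in_S: "x i \<in> S"
  using cycle by (auto simp: periodic_cycle_def invariant_lift_def image_subset_iff)

lemma f_x: "f (x (Suc i)) = x i"
proof (cases "Suc (i mod n) = n")
  case True
  then have "Suc i mod n = 0" "i mod n = n - 1" by (simp_all add: mod_Suc)
  then show ?thesis using cycle by (simp add: periodic_cycle_def invariant_lift_def)
next
  case False
  then have "Suc i mod n = Suc (i mod n)" by (simp add: mod_Suc)
  moreover have "Suc (i mod n) < n" using False n_pos by (metis Suc_lessI mod_less_divisor not_one_le_zero gr0I)
  ultimately show ?thesis using cycle by (simp add: periodic_cycle_def invariant_lift_def)
qed

lemma x_eq_iff: "x i = x j \<longleftrightarrow> i mod n = j mod n"
  using cycle n_pos unfolding periodic_cycle_def invariant_lift_def
  by (metis inj_on_eq_iff lessThan_iff mod_less_divisor not_one_le_zero gr0I)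

lemma x_limit: "x \<in> plaque_limit S f"
  using x_in_S f_x by (simp add: plaque_limit_def)

lemma p_eq_x: "i < n \<Longrightarrow> p i = x i"
  by (simp add: invariant_lift_def)

lemma iter_x: "(f ^^ k) (x (i + k)) = x i"
  by (rule backward_orbit_iter) (rule f_x)

lemma iter_x_periodic: "(f ^^ (n * k)) (x i) = x i"
proof -
  have "x (i + n * k) = x i" by (simp add: x_eq_iff)
  then show ?thesis using iter_x[of "n * k" i] by simp
qed

lemma nbhd_iff: "nbhd S f d x U \<longleftrightarrow> plaque S f d U \<and> (\<forall>i. x i \<in> U i)"
  using x_limit by (auto simp: nbhd_def points_of_def)

lemma nbhdD:
  assumes "nbhd S f d x U"
  shows "plaque S f d U" "x i \<in> U i" "x \<in> points_of S f U" "open_seq S f U"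
  using assms x_limit by (auto simp: nbhd_def points_of_def plaque_def)

lemma nbhd_shift: "nbhd S f d x U \<Longrightarrow> nbhd S f d x (\<lambda>i. U (i + n * k))"
proof -
  assume U: "nbhd S f d x U"
  have "x i \<in> U (i + n * k)" for i
    using nbhdD(2)[OF U, of "i + n * k"] by (simp add: x_eq_iff[of "i + n * k" i, THEN iffD2])
  then show ?thesis using plaque_shift[OF nbhdD(1)[OF U]] by (simp add: nbhd_iff)
qed

lemma nbhd_mono: "nbhd S f d x U \<Longrightarrow> nbhd S f d x V \<Longrightarrow> U 0 \<subseteq> V 0 \<Longrightarrow> U i \<subseteq> V i"
  using plaque_mono nbhdD(1,3) by blast

definition loc :: "complex \<Rightarrow> complex option" where
  "loc z = pt (x 0) (co (x 0) (x 0) + z)"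

lemma loc_0 [simp]: "loc 0 = x 0"
  by (simp add: loc_def pt_co)

lemma loc_eq_iff [simp]: "loc z = loc w \<longleftrightarrow> z = w"
proof
  assume "loc z = loc w"
  then have "co (x 0) (loc z) = co (x 0) (loc w)" by simp
  then show "z = w" by (simp add: loc_def)
qed simp

lemma open_loc_vimage: "openin riemann_sphere U \<Longrightarrow> open {z. loc z \<in> U}"
proof -
  assume "openin riemann_sphere U"
  then have "open ((+) (co (x 0) (x 0)) -` {z. pt (x 0) z \<in> U})"
    by (intro open_vimage open_pt_vimage continuous_intros)
  then show ?thesis by (simp add: loc_def vimage_def)
qed

lemma sphere_holomorphic_loc:
  "g holomorphic_on A \<Longrightarrow> open A \<Longrightarrow> sphere_holomorphic_on (\<lambda>z. loc (g z)) A"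
  unfolding loc_def by (intro sphere_holomorphic_pt holomorphic_intros)

lemma conformal_loc:
  assumes "g holomorphic_on ball 0 1" "inj_on g (ball 0 1)"
  shows "conformal_from_disk (\<lambda>z. loc (g z)) (loc ` g ` ball 0 1)"
  using conformal_from_diskI[of "\<lambda>z. loc (g z)"] sphere_holomorphic_loc[OF assms(1)] assms(2)
  by (simp add: image_image inj_on_def)

lemma affine_image_ball:
  assumes "0 < r" shows "(\<lambda>z. c + of_real r * z) ` ball 0 1 = ball (c::complex) r"
proof
  show "(\<lambda>z. c + of_real r * z) ` ball 0 1 \<subseteq> ball c r"
    using assms by (auto simp: dist_norm norm_mult)
  show "ball c r \<subseteq> (\<lambda>z. c + of_real r * z) ` ball 0 1"
  proof
    fix w assume "w \<in> ball c r"
    then have "(w - c) / of_real r \<in> ball 0 1"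
      using assms by (simp add: dist_norm norm_divide norm_minus_commute)
    then show "w \<in> (\<lambda>z. c + of_real r * z) ` ball 0 1"
      using assms by (intro image_eqI[of _ _ "(w - c) / of_real r"]) auto
  qed
qed

lemma conformal_loc_ball:
  assumes "0 < r" "ball c r \<subseteq> A" "g holomorphic_on A" "inj_on g A"
  shows "conformal_from_disk (\<lambda>z. loc (g (c + of_real r * z))) (loc ` g ` ball c r)"
proof -
  have im: "(\<lambda>z. c + of_real r * z) ` ball 0 1 = ball c r" by (rule affine_image_ball[OF assms(1)])
  have "g \<circ> (\<lambda>z. c + of_real r * z) holomorphic_on ball 0 1"
    by (rule holomorphic_on_compose_gen[OF _ assms(3)]) (use im assms(2) in \<open>auto intro!: holomorphic_intros\<close>)
  moreover have "inj_on (g \<circ> (\<lambda>z. c + of_real r * z)) (ball 0 1)"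
  proof (rule comp_inj_on)
    show "inj_on (\<lambda>z. c + of_real r * z) (ball 0 1)" using assms(1) by (simp add: inj_on_def)
    show "inj_on g ((\<lambda>z. c + of_real r * z) ` ball 0 1)"
      unfolding im by (rule inj_on_subset[OF assms(4,2)])
  qed
  ultimately have "conformal_from_disk (\<lambda>z. loc ((g \<circ> (\<lambda>z. c + of_real r * z)) z))
      (loc ` (g \<circ> (\<lambda>z. c + of_real r * z)) ` ball 0 1)"
    by (rule conformal_loc)
  then show ?thesis unfolding im[symmetric] by (simp add: image_image)
qed

definition "disk r = loc ` ball 0 r"

lemma conformal_disk: "0 < r \<Longrightarrow> conformal_from_disk (\<lambda>z. loc (of_real r * z)) (disk r)"
  using conformal_loc_ball[of r 0 UNIV "\<lambda>z. z"] by (simp add: disk_def)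

lemma disk_mono: "r \<le> s \<Longrightarrow> disk r \<subseteq> disk s"
  unfolding disk_def by (intro image_mono subset_ball)

lemma x0_in_disk: "0 < r \<Longrightarrow> x 0 \<in> disk r"
  unfolding disk_def by (metis centre_in_ball imageI loc_0)

lemma disk_small:
  assumes "openin riemann_sphere U" "x 0 \<in> U"
  obtains r where "0 < r" "disk r \<subseteq> U"
proof -
  have "open {z. loc z \<in> U}" "0 \<in> {z. loc z \<in> U}" using open_loc_vimage assms by auto
  then obtain r where "r > 0" "ball 0 r \<subseteq> {z. loc z \<in> U}" using open_contains_ball by metis
  then show ?thesis using that by (auto simp: disk_def)
qed

lemma return_map_coord:
  obtains e \<Phi> where "0 < e" "\<Phi> holomorphic_on ball 0 e" "\<Phi> 0 = 0" "deriv \<Phi> 0 = multiplier f n p"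
    "\<And>z. z \<in> ball 0 e \<Longrightarrow> loc z \<in> S" "\<And>z. z \<in> ball 0 e \<Longrightarrow> (f ^^ n) (loc z) = loc (\<Phi> z)"
proof -
  define a b where "a = x 0" and "b = co a a"
  have Fa: "(f ^^ n) a = a" using iter_x_periodic[of 1 0] by (simp add: a_def)
  obtain B where B: "open B" "b \<in> B" "\<And>z. z \<in> B \<Longrightarrow> pt a z \<in> S"
    "\<And>z. z \<in> B \<Longrightarrow> chart a ((f ^^ n) (pt a z)) \<noteq> None"
    "(\<lambda>z. co a ((f ^^ n) (pt a z))) holomorphic_on B"
    using holomorphic_self_coord[OF self_iter[of n] S_open, of a] x_in_S unfolding b_def Fa
    by (metis a_def)
  define g where "g z = co a ((f ^^ n) (pt a z))" for z
  define \<Phi> where "\<Phi> z = g (b + z) - b" for z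
  obtain e where e: "e > 0" "ball b e \<subseteq> B" using B(1,2) open_contains_ball by metis
  have bz: "b + z \<in> ball b e" if "z \<in> ball 0 e" for z :: complex using that by (simp add: dist_norm)
  have gB: "g holomorphic_on ball b e" using B(5) e(2) holomorphic_on_subset unfolding g_def by blast
  have locab: "loc z = pt a (b + z)" for z by (simp add: loc_def a_def b_def)
  show ?thesis
  proof
    show "0 < e" by (rule e)
    have "g \<circ> (\<lambda>z. b + z) holomorphic_on ball 0 e"
      by (rule holomorphic_on_compose_gen[OF _ gB]) (use bz in \<open>auto intro!: holomorphic_intros\<close>)
    then show "\<Phi> holomorphic_on ball 0 e" unfolding \<Phi>_def by (intro holomorphic_intros) (simp add: o_def)
    have "g b = b" using Fa by (simp add: g_def b_def pt_co)
    then show "\<Phi> 0 = 0" by (simp add: \<Phi>_def)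
    have "(g has_field_derivative deriv g b) (at b)"
      using gB e(1) by (intro holomorphic_derivI[of g "ball b e"]) auto
    then have "((\<lambda>z. g (b + z)) has_field_derivative deriv g b) (at 0)"
      using DERIV_shift[of g "deriv g b" 0 b] by (simp add: add.commute)
    then have "(\<Phi> has_field_derivative deriv g b - 0) (at 0)"
      unfolding \<Phi>_def by (intro DERIV_diff DERIV_const)
    then have "deriv \<Phi> 0 = deriv g b" by (simp add: DERIV_imp_deriv)
    also have "\<dots> = multiplier f n p"
      using Fa p_eq_x[of 0] n_pos
      by (simp add: multiplier_def sphere_deriv_def g_def[abs_def] a_def b_def co_def pt_def)
    finally show "deriv \<Phi> 0 = multiplier f n p" .
    fix z :: complex assume "z \<in> ball 0 e"
    then have z: "b + z \<in> B" using bz e(2) by blast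
    show "loc z \<in> S" unfolding locab by (rule B(3)[OF z])
    have "pt a (g (b + z)) = (f ^^ n) (pt a (b + z))" unfolding g_def by (rule pt_co[OF B(4)[OF z]])
    then show "(f ^^ n) (loc z) = loc (\<Phi> z)" unfolding locab \<Phi>_def by simp
  qed
qed

subsection \<open>Disk bases and the signature\<close>

text \<open>A plaque around \<open>x\<close> is determined by its first entry, so a base can be
  indexed by the radii of round coordinate disks. \<open>B\<close> is arbitrary at radii outside the
  stated range.\<close>

definition "disk_base r0 B \<longleftrightarrow> 0 < r0 \<and> (\<forall>r. 0 < r \<longrightarrow> r \<le> r0 \<longrightarrow> nbhd S f d x (B r) \<and> B r 0 = disk r)"

lemma disk_base_exists:
  assumes "nbhd S f d x U" obtains r0 B where "disk_base r0 B"
proof -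
  obtain r0 where r0: "0 < r0" "disk r0 \<subseteq> U 0"
    using disk_small plaqueD(2)[OF nbhdD(1)[OF assms]] nbhdD(2)[OF assms] by metis
  have "\<exists>V. nbhd S f d x V \<and> V 0 = disk r" if r: "0 < r" "r \<le> r0" for r
  proof -
    have "disk r \<subseteq> U 0" using disk_mono[OF r(2)] r0(2) by blast
    then obtain V where "plaque S f d V" "V 0 = disk r" "x \<in> points_of S f V"
      using plaque_shrink[OF nbhdD(1,3)[OF assms] _ x0_in_disk[OF r(1)] conformal_disk[OF r(1)]] by metis
    then show ?thesis by (auto simp: nbhd_def)
  qed
  then obtain B where "\<And>r. 0 < r \<Longrightarrow> r \<le> r0 \<Longrightarrow> nbhd S f d x (B r) \<and> B r 0 = disk r" by metis
  then show ?thesis using r0(1) that[of r0 B] by (simp add: disk_base_def)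
qed

lemma disk_baseD:
  assumes "disk_base r0 B" "0 < r" "r \<le> r0"
  shows "nbhd S f d x (B r)" "B r 0 = disk r"
  using assms by (auto simp: disk_base_def)

lemma disk_base_mono:
  assumes "disk_base r0 B" "0 < r" "r \<le> s" "s \<le> r0" shows "B r i \<subseteq> B s i"
proof (rule nbhd_mono)
  have "r \<le> r0" "0 < s" using assms(2-) by auto
  then show "nbhd S f d x (B r)" "nbhd S f d x (B s)" "B r 0 \<subseteq> B s 0"
    using disk_baseD[OF assms(1)] assms(2-) disk_mono[of r s] by simp_all
qed

lemma disk_base_absorbs:
  assumes "disk_base r0 B" "nbhd S f d x V"
  obtains r where "0 < r" "r \<le> r0" "\<And>i. B r i \<subseteq> V i"
proof -
  obtain r where r: "0 < r" "disk r \<subseteq> V 0"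
    using disk_small plaqueD(2)[OF nbhdD(1)[OF assms(2)]] nbhdD(2)[OF assms(2)] by metis
  have r0: "0 < r0" using assms(1) by (simp add: disk_base_def)
  show ?thesis
  proof
    show "0 < min r r0" "min r r0 \<le> r0" using r r0 by auto
    have "disk (min r r0) \<subseteq> V 0" using r(2) disk_mono[of "min r r0" r] by auto
    then show "B (min r r0) i \<subseteq> V i" for i
      using nbhd_mono[OF _ assms(2)] disk_baseD[OF assms(1), of "min r r0"] r(1) r0 by simp
  qed
qed

lemma points_of_mono: "(\<And>i. U i \<subseteq> V i) \<Longrightarrow> points_of S f U \<subseteq> points_of S f V"
  by (auto simp: points_of_def)

lemma disk_base_shrinks:
  assumes "disk_base r0 B"
  shows "shrinks_to S f d (\<lambda>j. B (r0 / of_nat (Suc j))) x"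
  unfolding shrinks_to_def
proof (intro conjI allI impI)
  have r0: "0 < r0" using assms by (simp add: disk_base_def)
  have ok: "0 < r0 / of_nat (Suc j)" "r0 / of_nat (Suc j) \<le> r0" for j
    using r0 by (auto simp: divide_le_eq mult_le_cancel_left1)
  show "nbhd S f d x (B (r0 / of_nat (Suc j)))" for j by (rule disk_baseD(1)[OF assms ok])
  have mono: "r0 / of_nat (Suc (Suc j)) \<le> r0 / of_nat (Suc j)" for j
    using r0 by (intro divide_left_mono) auto
  show "points_of S f (B (r0 / of_nat (Suc (Suc j)))) \<subseteq> points_of S f (B (r0 / of_nat (Suc j)))" for j
    by (intro points_of_mono disk_base_mono[OF assms] ok mono)
  fix V assume "nbhd S f d x V"
  then obtain r where r: "0 < r" "r \<le> r0" "\<And>i. B r i \<subseteq> V i"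
    using disk_base_absorbs[OF assms] by blast
  obtain m where m: "r0 / r < of_nat m" using reals_Archimedean2 by blast
  then have "r0 < of_nat m * r" using r(1) by (simp add: pos_divide_less_eq)
  also have "\<dots> \<le> of_nat (Suc m) * r" using r(1) by (intro mult_right_mono) auto
  finally have "r0 / of_nat (Suc m) \<le> r" by (simp add: pos_divide_le_eq mult.commute)
  then have "B (r0 / of_nat (Suc m)) i \<subseteq> V i" for i
    using disk_base_mono[OF assms ok(1) _ r(2)] r(3) by blast
  then show "\<exists>m. points_of S f (B (r0 / of_nat (Suc m))) \<subseteq> points_of S f V"
    using points_of_mono by blast
qed

text \<open>One plaque is enough: shrinking its first entry to smaller and smaller disks yields a
  base.\<close>

lemma has_plaque_base_iff: "has_plaque_base S f d x \<longleftrightarrow> (\<exists>U. nbhd S f d x U)"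
proof
  assume "has_plaque_base S f d x"
  then obtain U where "shrinks_to S f d U x" by (auto simp: has_plaque_base_def)
  then have "nbhd S f d x (U 0)" by (simp add: shrinks_to_def)
  then show "\<exists>U. nbhd S f d x U" by blast
next
  assume "\<exists>U. nbhd S f d x U"
  then obtain r0 B where "disk_base r0 B" using disk_base_exists by blast
  then show "has_plaque_base S f d x"
    using disk_base_shrinks unfolding has_plaque_base_def by blast
qed

text \<open>Replaces inequalities of classes by an eventual implication at each fixed radius, the
  form in which signatures are computed below.\<close>

lemma signature_iff:
  assumes "disk_base r0 B"
  shows "class_of \<beta> \<in> signature S f d x c \<longleftrightarrow>
    (\<forall>r. 0 < r \<longrightarrow> r \<le> r0 \<longrightarrow> (\<forall>\<^sub>F i in sequentially. \<beta> i \<longrightarrow> c \<in> B r i))"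
proof -
  have "class_of \<beta> \<in> signature S f d x c \<longleftrightarrow>
      (\<forall>j. \<forall>\<^sub>F i in sequentially. \<beta> i \<longrightarrow> c \<in> B (r0 / of_nat (Suc j)) i)"
    unfolding signature_eq[OF disk_base_shrinks[OF assms]]
    by (simp add: alpha_def ind_def class_of_le_iff)
  also have "\<dots> \<longleftrightarrow> (\<forall>r. 0 < r \<longrightarrow> r \<le> r0 \<longrightarrow> (\<forall>\<^sub>F i in sequentially. \<beta> i \<longrightarrow> c \<in> B r i))"
  proof (intro iffI allI impI)
    fix r assume *: "\<forall>j. \<forall>\<^sub>F i in sequentially. \<beta> i \<longrightarrow> c \<in> B (r0 / of_nat (Suc j)) i"
      and r: "0 < r" "r \<le> r0"
    have "nbhd S f d x (B r)" using disk_baseD(1)[OF assms r] .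
    then obtain m where m: "points_of S f (B (r0 / of_nat (Suc m))) \<subseteq> points_of S f (B r)"
      using disk_base_shrinks[OF assms] unfolding shrinks_to_def by blast
    have r0: "0 < r0" using assms by (simp add: disk_base_def)
    have "0 < r0 / of_nat (Suc m)" "r0 / of_nat (Suc m) \<le> r0"
      using r0 by (auto simp: divide_le_eq mult_le_cancel_left1)
    then have os: "open_seq S f (B (r0 / of_nat (Suc m)))" using disk_baseD(1)[OF assms] nbhdD(4) by blast
    \<comment> \<open>Inclusion of the point sets passes to the entries because every point of an
      entry extends to a full orbit inside the plaque.\<close>
    have "B (r0 / of_nat (Suc m)) i \<subseteq> B r i" for i
    proof
      fix s assume "s \<in> B (r0 / of_nat (Suc m)) i"
      then obtain z where "z \<in> points_of S f (B (r0 / of_nat (Suc m)))" "z i = s"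
        using points_of_through[OF os] by blast
      then show "s \<in> B r i" using m points_ofD(1) by blast
    qed
    moreover have "\<forall>\<^sub>F i in sequentially. \<beta> i \<longrightarrow> c \<in> B (r0 / of_nat (Suc m)) i" using * by blast
    ultimately show "\<forall>\<^sub>F i in sequentially. \<beta> i \<longrightarrow> c \<in> B r i"
      by (auto elim!: eventually_mono)
  next
    fix j assume *: "\<forall>r. 0 < r \<longrightarrow> r \<le> r0 \<longrightarrow> (\<forall>\<^sub>F i in sequentially. \<beta> i \<longrightarrow> c \<in> B r i)"
    have "0 < r0" using assms by (simp add: disk_base_def)
    then have "0 < r0 / of_nat (Suc j)" "r0 / of_nat (Suc j) \<le> r0"
      by (auto simp: divide_le_eq mult_le_cancel_left1)
    then show "\<forall>\<^sub>F i in sequentially. \<beta> i \<longrightarrow> c \<in> B (r0 / of_nat (Suc j)) i" using * by blast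
  qed
  finally show ?thesis .
qed

lemma signature_trivial_iff:
  "A = {class_of (\<lambda>_. False)} \<longleftrightarrow>
    class_of (\<lambda>_. False) \<in> A \<and> (\<forall>\<beta>. class_of \<beta> \<in> A \<longrightarrow> (\<forall>\<^sub>F i in sequentially. \<not> \<beta> i))"
proof
  assume "class_of (\<lambda>_. False) \<in> A \<and> (\<forall>\<beta>. class_of \<beta> \<in> A \<longrightarrow> (\<forall>\<^sub>F i in sequentially. \<not> \<beta> i))"
  moreover from this have "b = class_of (\<lambda>_. False)" if "b \<in> A" for b
    using that by (cases b rule: class_of_cases) (auto simp: class_of_eq_iff)
  ultimately show "A = {class_of (\<lambda>_. False)}" by blast
qed (auto simp: class_of_eq_iff)

end

section \<open>Shifts of classes of binary sequences\<close>

lemma shift_class_of: "shift m (class_of a) = class_of (shift_seq m a)"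
  unfolding class_of.abs_eq shift.abs_eq ..

text \<open>Deleting initial entries loses information, but only finitely many places of it, so
  modulo almost equality opposite shifts are inverse to each other.\<close>

lemma shift_shift: "shift m (shift (- m) b) = b"
proof -
  obtain a where b: "b = class_of a" by (rule class_of_cases)
  have "shift_seq m (shift_seq (- m) a) j = a j" if "nat m \<le> j" for j
    using that by (auto simp: shift_seq_def)
  then have "\<forall>\<^sub>F j in sequentially. shift_seq m (shift_seq (- m) a) j = a j"
    unfolding eventually_sequentially by blast
  then show ?thesis by (simp add: b shift_class_of class_of_eq_iff)
qed

lemma shift_mono: "a \<le> b \<Longrightarrow> shift m a \<le> shift m b"
proof -
  assume ab: "a \<le> b"
  obtain a' b' where a: "a = class_of a'" and b: "b = class_of b'" using class_of_cases by metis
  obtain N where N: "\<And>j. N \<le> j \<Longrightarrow> a' j \<Longrightarrow> b' j"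
    using ab unfolding a b class_of_le_iff eventually_sequentially by blast
  have "shift_seq m a' j \<longrightarrow> shift_seq m b' j" if "N + nat m \<le> j" for j
    using that N by (auto simp: shift_seq_def)
  then show ?thesis
    unfolding a b shift_class_of class_of_le_iff eventually_sequentially by blast
qed

lemma shift_image_alpha: "shift m ` alpha a = alpha (shift m a)"
proof
  show "shift m ` alpha a \<subseteq> alpha (shift m a)" using shift_mono by (auto simp: alpha_def)
  show "alpha (shift m a) \<subseteq> shift m ` alpha a"
  proof
    fix b assume "b \<in> alpha (shift m a)"
    then have "shift (- m) b \<le> shift (- m) (shift m a)" by (simp add: alpha_def shift_mono)
    then have "shift (- m) b \<in> alpha a" using shift_shift[of "- m" a] by (simp add: alpha_def)
    then show "b \<in> shift m ` alpha a" using shift_shift[of m b] by (metis imageI)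
  qed
qed

text \<open>Since the two shifts are inverse to each other, stability under both turns inclusions
  into equalities.\<close>

lemma shift_invariantI:
  assumes "\<And>\<beta>. class_of \<beta> \<in> A \<Longrightarrow> class_of (\<lambda>j. n \<le> j \<and> \<beta> (j - n)) \<in> A"
    and "\<And>\<beta>. class_of \<beta> \<in> A \<Longrightarrow> class_of (\<lambda>j. \<beta> (j + n)) \<in> A"
  shows "A = shift (int n) ` A \<and> A = shift (- int n) ` A"
proof -
  have s: "shift (int n) (class_of \<beta>) = class_of (\<lambda>j. n \<le> j \<and> \<beta> (j - n))"
    "shift (- int n) (class_of \<beta>) = class_of (\<lambda>j. \<beta> (j + n))" for \<beta>
    unfolding shift_class_of by (auto simp: shift_seq_def class_of_eq_iff)
  have in_A: "shift (int n) b \<in> A" "shift (- int n) b \<in> A" if "b \<in> A" for b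
    using that s assms by (cases b rule: class_of_cases; simp)+
  have "shift m ` A = A" if "\<And>b. b \<in> A \<Longrightarrow> shift m b \<in> A" "\<And>b. b \<in> A \<Longrightarrow> shift (- m) b \<in> A" for m
  proof
    show "A \<subseteq> shift m ` A"
    proof
      fix b assume "b \<in> A"
      then show "b \<in> shift m ` A" using that(2) shift_shift[of m b] by (metis imageI)
    qed
  qed (use that in blast)
  from this[of "int n"] this[of "- int n"] show ?thesis using in_A by simp
qed

text \<open>Index \<open>j\<close> stands for place \<open>j + 1\<close>, so the ones of
  \<open>sq n\<close> have index congruent to \<open>n - 1\<close>; the residue \<open>i\<close> is
  reached by a shift by \<open>i + 1\<close> modulo \<open>n\<close>.\<close>

lemma residue_eq_shift_sq:
  assumes "1 \<le> n"
  shows "alpha (class_of (\<lambda>j. j mod n = i mod n)) = shift (int (Suc i mod n)) ` alpha (class_of (sq n))"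
proof -
  define k where "k = Suc i mod n"
  have "(k \<le> j \<and> sq n (j - k)) = (j mod n = i mod n)" if "k \<le> j" for j
  proof -
    have "sq n (j - k) \<longleftrightarrow> int n dvd int (Suc (j - k))" unfolding sq_def int_dvd_int_iff ..
    also have "int (Suc (j - k)) = (1 + int j) - int k" using that by simp
    also have "int n dvd (1 + int j) - int k \<longleftrightarrow> (1 + int j) mod int n = int k mod int n"
      by (rule mod_eq_dvd_iff[symmetric])
    also have "int k mod int n = (1 + int i) mod int n"
      by (simp add: k_def zmod_int)
    also have "(1 + int j) mod int n = (1 + int i) mod int n \<longleftrightarrow> int n dvd (1 + int j) - (1 + int i)"
      by (rule mod_eq_dvd_iff)
    also have "\<dots> \<longleftrightarrow> int j mod int n = int i mod int n"
      by (simp add: mod_eq_dvd_iff)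
    also have "\<dots> \<longleftrightarrow> j mod n = i mod n" by (metis of_nat_eq_iff zmod_int)
    finally show ?thesis using that by simp
  qed
  then have "\<forall>\<^sub>F j in sequentially. (j mod n = i mod n) = shift_seq (int k) (sq n) j"
    unfolding eventually_sequentially shift_seq_def by auto
  then have "class_of (\<lambda>j. j mod n = i mod n) = shift (int k) (class_of (sq n))"
    by (simp add: shift_class_of class_of_eq_iff)
  then show ?thesis by (simp add: shift_image_alpha k_def)
qed

context covering_cycle
begin

subsection \<open>Linearizable cycles\<close>

text \<open>
  The disk \<open>\<alpha> ` ball 0 1\<close> sits at a point of the cycle and \<open>\<gamma>\<close> is a branch of the inverse of
  \<open>f ^^ n\<close> on it. Entering it one period early (hence \<open>Suc m\<close>) makes every \<open>\<beta> m\<close> injective.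
\<close>

lemma regular_if_backward_branch:
  assumes \<alpha>: "sphere_holomorphic_on \<alpha> (ball 0 1)" "inj_on \<alpha> (ball 0 1)" "\<alpha> ` ball 0 1 \<subseteq> S"
      "\<alpha> 0 = x i" "i \<le> n"
    and \<gamma>: "\<gamma> holomorphic_on ball 0 1" "\<And>z. z \<in> ball 0 1 \<Longrightarrow> \<gamma> z \<in> ball 0 1" "\<gamma> 0 = 0"
    and eq: "\<And>z. z \<in> ball 0 1 \<Longrightarrow> (f ^^ n) (\<alpha> (\<gamma> z)) = \<alpha> z"
  shows "regular_point S f d x"
    and "\<And>c. c \<in> critical_points S f \<Longrightarrow> signature S f d x c = {class_of (\<lambda>_. False)}"
proof -
  \<comment> \<open>\<open>Suc m\<close> periods back and \<open>e m\<close> steps forward are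
    \<open>n - i + m\<close> steps back from level \<open>i\<close>. This leads to level
    \<open>n + m\<close>, where the cycle point is \<open>x m\<close>.\<close>
  define e where "e m = m * (n - 1) + i" for m
  define \<beta> where "\<beta> m z = (f ^^ e m) (\<alpha> ((\<gamma> ^^ Suc m) z))" for m z
  have \<gamma>k: "(\<gamma> ^^ k) z \<in> ball 0 1" if "z \<in> ball 0 1" for k z
    using that \<gamma>(2) by (induction k) (auto simp del: mem_ball)
  have \<gamma>hol: "(\<gamma> ^^ k) holomorphic_on ball 0 1" for k
  proof (induction k)
    case (Suc k)
    have "\<gamma> \<circ> (\<gamma> ^^ k) holomorphic_on ball 0 1"
      by (rule holomorphic_on_compose_gen[OF Suc \<gamma>(1)]) (use \<gamma>k in blast)
    then show ?case by (simp add: o_def)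
  qed (simp add: id_def)
  have \<gamma>0: "(\<gamma> ^^ k) 0 = 0" for k using \<gamma>(3) by (induction k) auto
  have undo: "(f ^^ (n * k)) (\<alpha> ((\<gamma> ^^ k) z)) = \<alpha> z" if z: "z \<in> ball 0 1" for k z
  proof (induction k)
    case (Suc k)
    have "(f ^^ (n * Suc k)) (\<alpha> ((\<gamma> ^^ Suc k) z)) = (f ^^ (n * k)) ((f ^^ n) (\<alpha> (\<gamma> ((\<gamma> ^^ k) z))))"
      by (metis add.commute comp_apply funpow.simps(2) funpow_add mult_Suc_right)
    then show ?case using eq[OF \<gamma>k[OF z]] Suc by simp
  qed simp
  have step: "f (\<beta> (Suc m) z) = \<beta> m z" if z: "z \<in> ball 0 1" for m z
  proof -
    have "Suc (e (Suc m)) = e m + n" using n_pos by (simp add: e_def)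
    then have "f (\<beta> (Suc m) z) = (f ^^ (e m + n)) (\<alpha> (\<gamma> ((\<gamma> ^^ Suc m) z)))"
      unfolding \<beta>_def by (metis comp_apply funpow.simps(2))
    also have "\<dots> = (f ^^ e m) ((f ^^ n) (\<alpha> (\<gamma> ((\<gamma> ^^ Suc m) z))))" by (simp add: funpow_add)
    finally show ?thesis using eq[OF \<gamma>k[OF z, of "Suc m"]] by (simp add: \<beta>_def)
  qed
  have inj: "inj_on (\<beta> m) (ball 0 1)" for m
  \<comment> \<open>Another \<open>m + (n - i)\<close> steps forward complete \<open>Suc m\<close>
    periods; they undo all inverse branches and return \<open>\<alpha> z\<close>.\<close>
  proof (rule inj_on_inverseI[of _ "\<lambda>s. inv_into (ball 0 1) \<alpha> ((f ^^ (m + (n - i))) s)"])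
    fix z :: complex assume z: "z \<in> ball 0 1"
    have "m + (n - i) + e m = n * Suc m"
    proof -
      have "m + (n - i) + e m = n + (m + m * (n - 1))" using \<alpha>(5) by (simp add: e_def)
      also have "m + m * (n - 1) = m * n" using n_pos by (cases n) auto
      finally show ?thesis by simp
    qed
    then have "(f ^^ (m + (n - i))) (\<beta> m z) = (f ^^ (n * Suc m)) (\<alpha> ((\<gamma> ^^ Suc m) z))"
      unfolding \<beta>_def by (metis comp_apply funpow_add)
    then show "inv_into (ball 0 1) \<alpha> ((f ^^ (m + (n - i))) (\<beta> m z)) = z"
      using undo[OF z] \<alpha>(2) z by (simp only: inv_into_f_f)
  qed
  have \<beta>0: "\<beta> m 0 = x m" for m
  proof -
    have "m + e m = i + n * m" using n_pos by (cases n) (auto simp: e_def)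
    then have "x (m + e m) = x i" by (simp add: x_eq_iff)
    then show ?thesis using iter_x[of "e m" m] \<gamma>0 \<alpha>(4) by (simp add: \<beta>_def del: funpow.simps)
  qed
  have hol: "sphere_holomorphic_on (\<beta> m) (ball 0 1)" and inS: "\<beta> m ` ball 0 1 \<subseteq> S" for m
  proof -
    have "sphere_holomorphic_on (\<lambda>z. \<alpha> ((\<gamma> ^^ Suc m) z)) (ball 0 1)"
      by (rule sphere_holomorphic_compose[OF \<alpha>(1) _ \<gamma>hol]) (use \<gamma>k in blast)+
    moreover have "(\<lambda>z. \<alpha> ((\<gamma> ^^ Suc m) z)) ` ball 0 1 \<subseteq> S" using \<gamma>k \<alpha>(3) by blast
    ultimately show "sphere_holomorphic_on (\<beta> m) (ball 0 1)" "\<beta> m ` ball 0 1 \<subseteq> S"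
      using self_iter[of "e m"] iter_in_S unfolding \<beta>_def holomorphic_self_def by blast+
  qed
  define U where "U s m = \<beta> m ` ball 0 s" for s m
  have sub: "ball 0 s \<subseteq> (ball 0 1 :: complex set)" if "s \<le> 1" for s using that by (rule subset_ball)
  have pw: "power_in_coordinates f 1 (\<lambda>z. \<beta> (Suc m) (of_real s * z)) (U s (Suc m))
      (\<lambda>z. \<beta> m (of_real s * z)) (U s m)" if s: "0 < s" "s \<le> 1" for s m
  proof -
    have im: "(\<lambda>z. of_real s * z) ` ball 0 1 = (ball 0 s :: complex set)"
      using affine_image_ball[OF s(1), of 0] by simp
    have s1: "of_real s * z \<in> ball 0 1" if "z \<in> ball 0 1" for z :: complex
      using im that sub[OF s(2)] by blast
    have "conformal_from_disk (\<lambda>z. \<beta> k (of_real s * z)) (U s k)" for k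
    proof -
      have "sphere_holomorphic_on (\<lambda>z. \<beta> k (of_real s * z)) (ball 0 1)"
        by (rule sphere_holomorphic_compose[OF hol]) (use s1 in \<open>auto intro!: holomorphic_intros simp del: mem_ball\<close>)
      moreover have "inj_on (\<lambda>z. \<beta> k (of_real s * z)) (ball 0 1)"
      proof (rule inj_onI)
        fix z w :: complex assume zw: "z \<in> ball 0 1" "w \<in> ball 0 1" "\<beta> k (of_real s * z) = \<beta> k (of_real s * w)"
        have "of_real s * z = of_real s * w" by (rule inj_onD[OF inj zw(3) s1[OF zw(1)] s1[OF zw(2)]])
        then show "z = w" using s(1) by simp
      qed
      moreover have "(\<lambda>z. \<beta> k (of_real s * z)) ` ball 0 1 = U s k"
        unfolding U_def im[symmetric] by (simp add: image_image)
      ultimately show ?thesis using conformal_from_diskI by metis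
    qed
    then show ?thesis using step s1 by (simp add: power_in_coordinates_def)
  qed
  have nb: "nbhd S f d x (U s)" if s: "0 < s" "s \<le> 1" for s
    unfolding nbhd_iff
  proof (intro conjI allI plaqueI)
    show "U s m \<subseteq> S" for m using inS sub[OF s(2)] by (auto simp: U_def)
    show "\<exists>t\<in>{1..d}. \<exists>\<phi> \<psi>. power_in_coordinates f t \<phi> (U s (Suc m)) \<psi> (U s m)" for m
      using pw[OF s] degree by (intro bexI[of _ 1]) auto
    show "x m \<in> U s m" for m using \<beta>0[of m] s(1) by (metis U_def centre_in_ball imageI)
  qed
  have bij: "bij_betw f (U s (Suc m)) (U s m)" if "0 < s" "s \<le> 1" for s m
    by (rule power_one_bij[OF pw[OF that]])
  show "regular_point S f d x"
    using nb[of 1] bij[of 1] x_limit unfolding regular_point_def by (metis order_refl zero_less_one)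
  define s where "s j = inverse (real (Suc j))" for j
  have s: "0 < s j" "s j \<le> 1" for j by (auto simp: s_def field_simps)
  have shr: "shrinks_to S f d (\<lambda>j. U (s j)) x"
    unfolding shrinks_to_def
  proof (intro conjI allI impI)
    show "nbhd S f d x (U (s j))" for j by (rule nb[OF s])
    have "s (Suc j) \<le> s j" for j by (auto simp: s_def field_simps)
    then show "points_of S f (U (s (Suc j))) \<subseteq> points_of S f (U (s j))" for j
      unfolding U_def by (intro points_of_mono image_mono subset_ball)
    fix V assume V: "nbhd S f d x V"
    have "open {z \<in> ball 0 1. \<beta> 0 z \<in> V 0}"
      by (rule sphere_holomorphic_vimage[OF hol _ plaqueD(2)[OF nbhdD(1)[OF V]]]) simp
    moreover have "0 \<in> {z \<in> ball 0 1. \<beta> 0 z \<in> V 0}" using nbhdD(2)[OF V] \<beta>0[of 0] by simp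
    ultimately obtain r where r: "r > 0" "ball 0 r \<subseteq> {z \<in> ball 0 1. \<beta> 0 z \<in> V 0}"
      using open_contains_ball by metis
    obtain m where "s m < r" using reals_Archimedean[OF r(1)] by (auto simp: s_def)
    then have "ball 0 (s m) \<subseteq> ball (0::complex) r" by (intro subset_ball) simp
    then have "U (s m) 0 \<subseteq> V 0" using r(2) by (auto simp: U_def)
    then show "\<exists>m. points_of S f (U (s m)) \<subseteq> points_of S f V"
      using nbhd_mono[OF nb[OF s] V] points_of_mono by blast
  qed
  fix c assume c: "c \<in> critical_points S f"
  have "c \<notin> U (s j) (Suc m)" for j m
  proof
    assume "c \<in> U (s j) (Suc m)"
    note critical_not_inj[OF c this plaqueD(2,1)[OF nbhdD(1)[OF nb[OF s]]]]
    then show False using bij_betw_imp_inj_on[OF bij[OF s]] by (rule notE)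
  qed
  \<comment> \<open>Bijectivity excludes critical points only from entries that are the source of a
    step, that is from index 1 on; modulo almost equality this is enough.\<close>
  then have "(c \<in> U (s j) m) = False" if "1 \<le> m" for j m
    using that by (cases m) auto
  then have "ind (U (s j)) c = class_of (\<lambda>_. False)" for j
    unfolding ind_def class_of_eq_iff eventually_sequentially by blast
  then show "signature S f d x c = {class_of (\<lambda>_. False)}"
    unfolding signature_eq[OF shr] signature_trivial_iff by (auto simp: alpha_def class_of_le_iff)
qed

text \<open>In a linearizing coordinate the inverse branch is the rotation by
  \<open>inverse \<mu>\<close>. The coordinate may be centered at any point of the cycle, which is
  why the general criterion allows an arbitrary index \<open>i\<close>.\<close>

lemma regular_if_siegel:
  assumes "siegel f n p"
  shows "regular_point S f d x"
    and "\<And>c. c \<in> critical_points S f \<Longrightarrow> signature S f d x c = {class_of (\<lambda>_. False)}"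
proof -
  obtain \<mu> i r h where i: "i < n" and \<mu>: "norm \<mu> = 1" and r: "r > 0"
    and h: "sphere_holomorphic_on h (ball 0 r)" "inj_on h (ball 0 r)" "h 0 = p i"
      "\<And>z. z \<in> ball 0 r \<Longrightarrow> (f ^^ n) (h z) = h (\<mu> * z)"
    using assms unfolding siegel_def neutral_with_angle_def conjugate_to_rotation_def by metis
  have "open {z \<in> ball 0 r. h z \<in> S}" by (rule sphere_holomorphic_vimage[OF h(1) _ S_open]) simp
  moreover have "0 \<in> {z \<in> ball 0 r. h z \<in> S}" using h(3) p_eq_x[OF i] x_in_S r by simp
  ultimately obtain s where s: "s > 0" "ball 0 s \<subseteq> {z \<in> ball 0 r. h z \<in> S}"
    using open_contains_ball by metis
  have s1: "of_real s * z \<in> ball 0 s" if "z \<in> ball 0 1" for z :: complex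
    using that s(1) by (simp add: norm_mult)
  then have sr: "of_real s * z \<in> ball 0 r" "h (of_real s * z) \<in> S" if "z \<in> ball 0 1" for z
    using that s(2) by blast+
  define \<alpha> where "\<alpha> z = h (of_real s * z)" for z
  define \<gamma> where "\<gamma> z = inverse \<mu> * z" for z
  have 1: "sphere_holomorphic_on \<alpha> (ball 0 1)" unfolding \<alpha>_def
    by (rule sphere_holomorphic_compose[OF h(1)]) (use sr in \<open>auto intro!: holomorphic_intros simp del: mem_ball\<close>)
  have 2: "inj_on \<alpha> (ball 0 1)" unfolding \<alpha>_def
  proof (rule inj_onI)
    fix z w :: complex assume zw: "z \<in> ball 0 1" "w \<in> ball 0 1" "h (of_real s * z) = h (of_real s * w)"
    have "of_real s * z = of_real s * w" by (rule inj_onD[OF h(2) zw(3) sr(1)[OF zw(1)] sr(1)[OF zw(2)]])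
    then show "z = w" using s(1) by simp
  qed
  have 3: "\<alpha> ` ball 0 1 \<subseteq> S" unfolding \<alpha>_def using sr(2) by blast
  have 4: "\<alpha> 0 = x i" "i \<le> n" using h(3) p_eq_x[OF i] i by (auto simp: \<alpha>_def)
  have 5: "\<gamma> holomorphic_on ball 0 1" unfolding \<gamma>_def by (intro holomorphic_intros)
  have 6: "\<gamma> z \<in> ball 0 1" if "z \<in> ball 0 1" for z
    using that \<mu> by (simp add: \<gamma>_def norm_mult norm_inverse)
  have 7: "\<gamma> 0 = 0" by (simp add: \<gamma>_def)
  have 8: "(f ^^ n) (\<alpha> (\<gamma> z)) = \<alpha> z" if "z \<in> ball 0 1" for z
  proof -
    have "\<mu> \<noteq> 0" using \<mu> by auto
    then show ?thesis using h(4)[OF sr(1)[OF 6[OF that]]] by (simp add: \<alpha>_def \<gamma>_def mult.left_commute mult.assoc[symmetric])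
  qed
  show "regular_point S f d x"
    "\<And>c. c \<in> critical_points S f \<Longrightarrow> signature S f d x c = {class_of (\<lambda>_. False)}"
    using regular_if_backward_branch[OF 1 2 3 4 5 6 7 8] by blast+
qed

lemma regular_if_repelling:
  assumes "repelling f n p"
  shows "regular_point S f d x"
    and "\<And>c. c \<in> critical_points S f \<Longrightarrow> signature S f d x c = {class_of (\<lambda>_. False)}"
proof -
  obtain e \<Phi> where \<Phi>: "0 < e" "\<Phi> holomorphic_on ball 0 e" "\<Phi> 0 = 0" "deriv \<Phi> 0 = multiplier f n p"
    "\<And>z. z \<in> ball 0 e \<Longrightarrow> loc z \<in> S" "\<And>z. z \<in> ball 0 e \<Longrightarrow> (f ^^ n) (loc z) = loc (\<Phi> z)"
    by (rule return_map_coord) blast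
  have \<lambda>: "norm (deriv \<Phi> 0) > 1" using assms by (simp add: repelling_def \<Phi>(4))
  have 0: "0 \<in> ball 0 e" using \<Phi>(1) by simp
  have nz: "deriv \<Phi> 0 \<noteq> 0" using \<lambda> by auto
  obtain r1 where r1: "r1 > 0" "ball 0 r1 \<subseteq> ball (0::complex) e" "inj_on \<Phi> (ball 0 r1)"
    by (rule has_complex_derivative_locally_injective[OF \<Phi>(2) 0 open_ball nz])
  have hol1: "\<Phi> holomorphic_on ball 0 r1" using holomorphic_on_subset[OF \<Phi>(2) r1(2)] .
  obtain g where g: "g holomorphic_on (\<Phi> ` ball 0 r1)"
      "\<And>z. z \<in> ball 0 r1 \<Longrightarrow> deriv \<Phi> z * deriv g (\<Phi> z) = 1" "\<And>z. z \<in> ball 0 r1 \<Longrightarrow> g (\<Phi> z) = z"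
    using holomorphic_has_inverse[OF hol1 _ r1(3)] by auto
  have op: "open (\<Phi> ` ball 0 r1)" by (rule open_mapping_thm3[OF hol1 _ r1(3)]) simp
  have in0: "0 \<in> \<Phi> ` ball 0 r1" using \<Phi>(3) r1(1) by (metis centre_in_ball imageI)
  have g0: "g 0 = 0" using g(3)[of 0] \<Phi>(3) r1(1) by simp
  have "deriv \<Phi> 0 * deriv g 0 = 1" using g(2)[of 0] \<Phi>(3) r1(1) by simp
  then have "norm (deriv \<Phi> 0) * norm (deriv g 0) = 1" by (metis norm_mult norm_one)
  then have "norm (deriv g 0) < 1"
  proof -
    have "norm (deriv \<Phi> 0) * 1 \<le> norm (deriv \<Phi> 0) * norm (deriv g 0)" if "1 \<le> norm (deriv g 0)"
      using that by (intro mult_left_mono) auto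
    then show ?thesis using \<lambda> \<open>norm (deriv \<Phi> 0) * norm (deriv g 0) = 1\<close> by force
  qed
  then obtain r where r: "0 < r" "ball 0 r \<subseteq> \<Phi> ` ball 0 r1" "\<And>z. z \<in> ball 0 r \<Longrightarrow> norm (g z) \<le> 1 * norm z"
    using holomorphic_linear_bound[OF g(1) op in0 g0] by blast
  \<comment> \<open>This radius keeps \<open>g\<close> from increasing norms and the coordinate disk
    inside \<open>S\<close>; dividing by \<open>q\<close> then rescales to the unit disk.\<close>
  define q where "q = min r e"
  have q: "0 < q" "q \<le> r" "q \<le> e" using r(1) \<Phi>(1) by (auto simp: q_def)
  have qz: "of_real q * z \<in> ball 0 q" if "z \<in> ball 0 1" for z :: complex
    using that q(1) by (simp add: norm_mult)
  have qr: "of_real q * z \<in> ball 0 r" "of_real q * z \<in> ball 0 e" if "z \<in> ball 0 1" for z :: complex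
    using qz[OF that] q(2,3) by auto
  define \<alpha> where "\<alpha> z = loc (of_real q * z)" for z
  define \<gamma> where "\<gamma> z = g (of_real q * z) / of_real q" for z
  have c: "conformal_from_disk \<alpha> (disk q)" unfolding \<alpha>_def by (rule conformal_disk[OF q(1)])
  have 3: "\<alpha> ` ball 0 1 \<subseteq> S" unfolding \<alpha>_def using \<Phi>(5) qr(2) by blast
  have 4: "\<alpha> 0 = x 0" "0 \<le> n" by (auto simp: \<alpha>_def)
  have "g \<circ> (\<lambda>z. of_real q * z) holomorphic_on ball 0 1"
    by (rule holomorphic_on_compose_gen[OF _ g(1)]) (use qr(1) r(2) in \<open>auto intro!: holomorphic_intros simp del: mem_ball\<close>)
  then have 5: "\<gamma> holomorphic_on ball 0 1" unfolding \<gamma>_def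
    using q(1) by (intro holomorphic_intros) (auto simp: o_def)
  have gle: "norm (g (of_real q * z)) \<le> q * norm z" if "z \<in> ball 0 1" for z
    using r(3)[OF qr(1)[OF that]] q(1) by (simp add: norm_mult)
  have 6: "\<gamma> z \<in> ball 0 1" if "z \<in> ball 0 1" for z
  proof -
    have "norm (\<gamma> z) = norm (g (of_real q * z)) / q" using q(1) by (simp add: \<gamma>_def norm_divide)
    also have "\<dots> \<le> norm z" using gle[OF that] q(1) by (simp add: pos_divide_le_eq mult.commute)
    finally show ?thesis using that by simp
  qed
  have 7: "\<gamma> 0 = 0" by (simp add: \<gamma>_def g0)
  have 8: "(f ^^ n) (\<alpha> (\<gamma> z)) = \<alpha> z" if z: "z \<in> ball 0 1" for z
  proof -
    have \<gamma>q: "of_real q * \<gamma> z = g (of_real q * z)" using q(1) by (simp add: \<gamma>_def)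
    obtain u where u: "u \<in> ball 0 r1" "of_real q * z = \<Phi> u" using qr(1)[OF z] r(2) by blast
    then have "g (of_real q * z) = u" using g(3) by simp
    then show ?thesis unfolding \<alpha>_def \<gamma>q using \<Phi>(6)[of u] u r1(2) by auto
  qed
  show "regular_point S f d x"
    "\<And>c. c \<in> critical_points S f \<Longrightarrow> signature S f d x c = {class_of (\<lambda>_. False)}"
    using regular_if_backward_branch[OF conformal_from_diskD(1,2)[OF c] 3 4 5 6 7 8] by blast+
qed


subsection \<open>Signatures of irregular and of attracting cycles\<close>

text \<open>
  Some critical point \<open>c\<close> lies in infinitely many entries of every plaque of the base, by the
  pigeonhole principle; a pseudo-intersection of these index sets is then a nontrivial element.
\<close>

lemma signature_nontrivial:
  assumes base: "disk_base r0 B" and irr: "\<not> regular_point S f d x" and fin: "finite (critical_points S f)"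
  obtains c where "c \<in> critical_points S f" "signature S f d x c \<noteq> {class_of (\<lambda>_. False)}"
proof -
  have r0: "0 < r0" using base by (simp add: disk_base_def)
  have inf: "infinite {i. \<exists>c\<in>critical_points S f. c \<in> B r i}" if r: "0 < r" "r \<le> r0" for r
    unfolding infinite_nat_iff_unbounded_le
  proof (intro allI)
    fix m
    have nb: "nbhd S f d x (B r)" by (rule disk_baseD(1)[OF base r])
    then obtain i where "m \<le> i" "\<not> bij_betw f (B r (Suc i)) (B r i)"
      using irr x_limit unfolding regular_point_def by blast
    then obtain c where "c \<in> critical_points S f" "c \<in> B r (Suc i)"
      using plaque_bij_or_critical[OF nbhdD(1)[OF nb], of i] by blast
    then show "\<exists>k\<ge>m. k \<in> {i. \<exists>c\<in>critical_points S f. c \<in> B r i}"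
      using \<open>m \<le> i\<close> by (intro exI[of _ "Suc i"]) auto
  qed
  have "\<exists>c\<in>critical_points S f. \<forall>r. 0 < r \<longrightarrow> r \<le> r0 \<longrightarrow> infinite {i. c \<in> B r i}"
  proof (rule ccontr)
    assume "\<not> ?thesis"
    then have "\<forall>c\<in>critical_points S f. \<exists>r. 0 < r \<and> r \<le> r0 \<and> finite {i. c \<in> B r i}" by blast
    then obtain R where R: "\<And>c. c \<in> critical_points S f \<Longrightarrow> 0 < R c \<and> R c \<le> r0 \<and> finite {i. c \<in> B (R c) i}"
      by metis
    \<comment> \<open>If each critical point had a radius at which it lies in only finitely many
      entries, the smallest one would serve all of them at once; \<open>r0\<close> covers the case
      of no critical points.\<close>
    define r where "r = Min (insert r0 (R ` critical_points S f))"
    have r: "0 < r" "r \<le> r0" "\<And>c. c \<in> critical_points S f \<Longrightarrow> r \<le> R c"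
      using fin R r0 by (auto simp: r_def)
    have "{i. \<exists>c\<in>critical_points S f. c \<in> B r i} \<subseteq> (\<Union>c\<in>critical_points S f. {i. c \<in> B (R c) i})"
      using disk_base_mono[OF base r(1) r(3)] R by blast
    moreover have "finite (\<Union>c\<in>critical_points S f. {i. c \<in> B (R c) i})" using fin R by blast
    ultimately show False using inf[OF r(1,2)] finite_subset by blast
  qed
  then obtain c where c: "c \<in> critical_points S f"
    "\<And>r. 0 < r \<Longrightarrow> r \<le> r0 \<Longrightarrow> infinite {i. c \<in> B r i}" by blast
  define s where "s k = r0 / real (Suc k)" for k
  have s: "0 < s k" "s k \<le> r0" for k
    using r0 by (auto simp: s_def divide_le_eq mult_le_cancel_left1)
  have "\<exists>g. \<forall>k. c \<in> B (s k) (g k) \<and> g k < g (Suc k)"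
  proof (rule dependent_nat_choice)
    show "\<exists>i. c \<in> B (s 0) i" using c(2)[OF s] not_finite_existsD by blast
    fix i k
    obtain j where "i < j" "j \<in> {j. c \<in> B (s (Suc k)) j}"
      using c(2)[OF s] unfolding infinite_nat_iff_unbounded by blast
    then show "\<exists>j. c \<in> B (s (Suc k)) j \<and> i < j" by blast
  qed
  then obtain g where g: "\<And>k. c \<in> B (s k) (g k)" "\<And>k. g k < g (Suc k)" by blast
  have sm: "strict_mono g" using g(2) by (simp add: strict_mono_Suc_iff)
  define \<beta> where "\<beta> i \<longleftrightarrow> i \<in> range g" for i
  have "class_of \<beta> \<in> signature S f d x c"
    unfolding signature_iff[OF base]
  proof (intro allI impI)
    fix r :: real assume r: "0 < r" "r \<le> r0"
    obtain K where K: "r0 / r < of_nat K" using reals_Archimedean2 by blast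
    have "\<beta> i \<longrightarrow> c \<in> B r i" if "g K \<le> i" for i
    proof
      assume "\<beta> i"
      then obtain k where k: "i = g k" by (auto simp: \<beta>_def)
      then have "K \<le> k" using that sm by (simp add: strict_mono_less_eq)
      then have "r0 / r < real (Suc k)" using K by linarith
      then have "s k \<le> r" using r(1) by (simp add: s_def divide_simps mult.commute)
      then show "c \<in> B r i" using disk_base_mono[OF base s(1) _ r(2)] g(1)[of k] k by blast
    qed
    then show "\<forall>\<^sub>F i in sequentially. \<beta> i \<longrightarrow> c \<in> B r i" unfolding eventually_sequentially by blast
  qed
  moreover have "\<not> (\<forall>\<^sub>F i in sequentially. \<not> \<beta> i)"
  proof
    assume "\<forall>\<^sub>F i in sequentially. \<not> \<beta> i"
    then obtain N where "\<And>i. N \<le> i \<Longrightarrow> \<not> \<beta> i" unfolding eventually_sequentially by blast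
    moreover have "N \<le> g N" using sm by (rule strict_mono_imp_increasing)
    ultimately show False by (auto simp: \<beta>_def)
  qed
  ultimately have "signature S f d x c \<noteq> {class_of (\<lambda>_. False)}"
    unfolding signature_trivial_iff by blast
  then show ?thesis using c(1) that by blast
qed

text \<open>By periodicity, \<open>\<lambda>i. B r (i + n)\<close> is again a plaque around
  \<open>x\<close>, so it contains a member of the base.\<close>

lemma signature_shift_forward:
  assumes base: "disk_base r0 B" and \<beta>: "class_of \<beta> \<in> signature S f d x c"
  shows "class_of (\<lambda>j. n \<le> j \<and> \<beta> (j - n)) \<in> signature S f d x c"
  unfolding signature_iff[OF base]
proof (intro allI impI)
  fix r :: real assume r: "0 < r" "r \<le> r0"
  have "nbhd S f d x (\<lambda>i. B r (i + n))" using nbhd_shift[OF disk_baseD(1)[OF base r], of 1] by simp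
  then obtain r' where r': "0 < r'" "r' \<le> r0" "\<And>i. B r' i \<subseteq> B r (i + n)"
    using disk_base_absorbs[OF base] by blast
  obtain N where N: "\<And>i. N \<le> i \<Longrightarrow> \<beta> i \<Longrightarrow> c \<in> B r' i"
    using \<beta> r'(1,2) unfolding signature_iff[OF base] eventually_sequentially by meson
  have "n \<le> j \<and> \<beta> (j - n) \<longrightarrow> c \<in> B r j" if j: "N + n \<le> j" for j
  proof
    assume "n \<le> j \<and> \<beta> (j - n)"
    then have "c \<in> B r' (j - n)" using N[of "j - n"] j by simp
    then show "c \<in> B r j" using r'(3)[of "j - n"] j by auto
  qed
  then show "\<forall>\<^sub>F j in sequentially. n \<le> j \<and> \<beta> (j - n) \<longrightarrow> c \<in> B r j"
    unfolding eventually_sequentially by blast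
qed

lemma iterate_image_plaque: "plaque S f d U \<Longrightarrow> (f ^^ k) ` U (i + k) = U i"
proof (induction k arbitrary: i)
  case (Suc k)
  have "(f ^^ Suc k) ` U (i + Suc k) = f ` (f ^^ k) ` U (Suc i + k)" by (simp add: image_image)
  also have "(f ^^ k) ` U (Suc i + k) = U (Suc i)" by (rule Suc.IH[OF Suc.prems])
  also have "f ` U (Suc i) = U i" by (rule plaqueD(3)[OF Suc.prems])
  finally show ?case .
qed simp

text \<open>
  The return map has no zero on a small circle around \<open>x 0\<close>, so that the component of the preimage
  of a much smaller disk stays inside.
\<close>

lemma disk_base_absorbs_backward:
  assumes base: "disk_base r0 B" and mult: "multiplier f n p \<noteq> 0" and r: "0 < r" "r \<le> r0"
  obtains r' where "0 < r'" "r' \<le> r0" "\<And>i. B r' (i + n) \<subseteq> B r i"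
proof -
  obtain e \<Phi> where \<Phi>: "0 < e" "\<Phi> holomorphic_on ball 0 e" "\<Phi> 0 = 0" "deriv \<Phi> 0 = multiplier f n p"
    "\<And>z. z \<in> ball 0 e \<Longrightarrow> (f ^^ n) (loc z) = loc (\<Phi> z)"
    by (rule return_map_coord) blast
  have 0: "0 \<in> ball 0 e" using \<Phi>(1) by simp
  obtain r1 where r1: "r1 > 0" "ball 0 r1 \<subseteq> ball (0::complex) e" "inj_on \<Phi> (ball 0 r1)"
    by (rule has_complex_derivative_locally_injective[OF \<Phi>(2) 0 open_ball mult[folded \<Phi>(4)]])
  define q where "q = min r r1 / 2"
  have q: "0 < q" "q < r" "q < r1" using r(1) r1(1) by (auto simp: q_def min_def)
  have sph: "z \<in> ball 0 r1" if "z \<in> sphere 0 q" for z :: complex using that q(3) by simp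
  have "continuous_on (sphere 0 q) (\<lambda>z. norm (\<Phi> z))"
    using \<Phi>(2) sph r1(2) by (intro continuous_on_norm continuous_on_subset[OF holomorphic_on_imp_continuous_on[OF \<Phi>(2)]]) blast
  moreover have "sphere (0::complex) q \<noteq> {}" using q(1) by simp
  ultimately obtain a where a: "a \<in> sphere 0 q" "\<And>z. z \<in> sphere 0 q \<Longrightarrow> norm (\<Phi> a) \<le> norm (\<Phi> z)"
    using continuous_attains_inf[OF compact_sphere] by meson
  have "\<Phi> a \<noteq> 0"
  proof
    assume "\<Phi> a = 0"
    then have "a = 0" using inj_onD[OF r1(3), of a 0] \<Phi>(3) sph[OF a(1)] r1(1) by simp
    then show False using a(1) q(1) by simp
  qed
  \<comment> \<open>Below the minimum of \<open>\<Phi>\<close> on the circle of radius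
    \<open>q\<close>: a point of \<open>B r' n\<close> on that circle would have too large an image
    to lie in \<open>disk r'\<close>.\<close>
  define r' where "r' = min r0 (norm (\<Phi> a))"
  have r': "0 < r'" "r' \<le> r0" using r \<open>\<Phi> a \<noteq> 0\<close> by (auto simp: r'_def)
  note nb = disk_baseD[OF base r']
  have op: "openin riemann_sphere (disk q)" by (rule conformal_from_diskD(4)[OF conformal_disk[OF q(1)]])
  have "sphere_holomorphic_on loc UNIV" using sphere_holomorphic_loc[of "\<lambda>z. z" UNIV] by simp
  then have "compactin riemann_sphere (loc ` cball 0 q)"
    using image_compactin[OF _ sphere_holomorphic_continuous[of loc UNIV]] by simp
  then have "closedin riemann_sphere (loc ` cball 0 q)" using compactin_imp_closedin[OF Hausdorff_sphere] by blast
  then have op': "openin riemann_sphere (- loc ` cball 0 q)" by (simp add: closedin_def Compl_eq_Diff_UNIV)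
  have sub: "B r' n \<subseteq> disk q"
  proof (rule ccontr)
    assume n: "\<not> B r' n \<subseteq> disk q"
    have cov: "B r' n \<subseteq> disk q \<union> - loc ` cball 0 q"
    proof
      fix s assume s: "s \<in> B r' n"
      show "s \<in> disk q \<union> - loc ` cball 0 q"
      proof (rule ccontr)
        assume "s \<notin> disk q \<union> - loc ` cball 0 q"
        then obtain z where z: "s = loc z" "z \<in> cball 0 q" "s \<notin> loc ` ball 0 q" by (auto simp: disk_def)
        then have "z \<notin> ball 0 q" by blast
        then have zq: "z \<in> sphere 0 q" using z(2) by auto
        have "(f ^^ n) s \<in> B r' 0" using iterate_image_plaque[OF nbhdD(1)[OF nb(1)], of n 0] s by auto
        then have "loc (\<Phi> z) \<in> disk r'" using \<Phi>(5)[of z] sph[OF zq] r1(2) z(1) nb(2) by auto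
        then have "norm (\<Phi> z) < r'" by (auto simp: disk_def)
        then show False using a(2)[OF zq] by (simp add: r'_def)
      qed
    qed
    show False
    proof (rule connectedinD[OF plaqueD(4)[OF nbhdD(1)[OF nb(1)], of n] op op' cov])
      show "disk q \<inter> - loc ` cball 0 q \<inter> B r' n = {}" by (auto simp: disk_def)
      have "x n = x 0" by (simp add: x_eq_iff)
      then have "x 0 \<in> B r' n" using nbhdD(2)[OF nb(1), of n] by simp
      then show "disk q \<inter> B r' n \<noteq> {}" using x0_in_disk[OF q(1)] by blast
      show "- loc ` cball 0 q \<inter> B r' n \<noteq> {}" using n cov by blast
    qed
  qed
  show ?thesis
  proof
    show "0 < r'" "r' \<le> r0" by (rule r')+
    have "nbhd S f d x (\<lambda>i. B r' (i + n))" using nbhd_shift[OF nb(1), of 1] by simp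
    moreover have "B r' (0 + n) \<subseteq> B r 0" using sub disk_mono[of q r] q(2) disk_baseD(2)[OF base r] by auto
    ultimately show "B r' (i + n) \<subseteq> B r i" for i using nbhd_mono[OF _ disk_baseD(1)[OF base r]] by blast
  qed
qed

lemma signature_shift_backward:
  assumes base: "disk_base r0 B" and mult: "multiplier f n p \<noteq> 0" and \<beta>: "class_of \<beta> \<in> signature S f d x c"
  shows "class_of (\<lambda>j. \<beta> (j + n)) \<in> signature S f d x c"
  unfolding signature_iff[OF base]
proof (intro allI impI)
  fix r :: real assume r: "0 < r" "r \<le> r0"
  obtain r' where r': "0 < r'" "r' \<le> r0" "\<And>i. B r' (i + n) \<subseteq> B r i"
    using disk_base_absorbs_backward[OF base mult r] by blast
  obtain N where N: "\<And>i. N \<le> i \<Longrightarrow> \<beta> i \<Longrightarrow> c \<in> B r' i"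
    using \<beta> r'(1,2) unfolding signature_iff[OF base] eventually_sequentially by meson
  have "\<beta> (j + n) \<longrightarrow> c \<in> B r j" if j: "N \<le> j" for j
    using N[of "j + n"] j r'(3)[of j] by auto
  then show "\<forall>\<^sub>F j in sequentially. \<beta> (j + n) \<longrightarrow> c \<in> B r j"
    unfolding eventually_sequentially by blast
qed

section \<open>Critical points attracted to the cycle\<close>

lemma iter_x0_eq_iff: "(f ^^ m) (x 0) = x 0 \<longleftrightarrow> n dvd m"
proof -
  have m: "m \<le> n * m" using n_pos by simp
  \<comment> \<open>\<open>n * m - m\<close> is a natural number congruent to \<open>- m\<close>
    modulo \<open>n\<close>, so that \<open>iter_x\<close> applies.\<close>
  have "x 0 = x ((n * m - m) + m)" using m by (simp add: x_eq_iff)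
  then have "(f ^^ m) (x 0) = x (n * m - m)" using iter_x[of m "n * m - m"] by simp
  then have "(f ^^ m) (x 0) = x 0 \<longleftrightarrow> n dvd n * m - m" by (simp add: x_eq_iff dvd_eq_mod_eq_0)
  also have "\<dots> \<longleftrightarrow> n dvd m" using m by (metis dvd_diffD1 dvd_diff_nat dvd_triv_left)
  finally show ?thesis .
qed

text \<open>Convergence to \<open>x 0\<close> is required along one residue class of times modulo
  \<open>n\<close>; this class becomes the support of the signature of \<open>c\<close>.\<close>

definition attracted :: "complex option \<Rightarrow> nat \<Rightarrow> bool" where
  "attracted c i \<longleftrightarrow> (\<forall>N. openin riemann_sphere N \<longrightarrow> x 0 \<in> N \<longrightarrow>
     (\<forall>\<^sub>F j in sequentially. (f ^^ (i + n * j)) c \<in> N))"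

text \<open>At times with another residue the orbit converges to a different point of the cycle,
  which can be separated from \<open>x 0\<close> as the sphere is Hausdorff.\<close>

lemma attracted_residue:
  assumes "c \<in> S" "attracted c i"
  obtains N where "openin riemann_sphere N" "x 0 \<in> N"
    "\<forall>\<^sub>F l in sequentially. (f ^^ l) c \<in> N \<longrightarrow> l mod n = i mod n"
proof -
  have "\<exists>P Q. openin riemann_sphere P \<and> openin riemann_sphere Q \<and> (f ^^ m) (x 0) \<in> P \<and> x 0 \<in> Q \<and> P \<inter> Q = {}"
    if "m \<in> {1..<n}" for m
  proof -
    have "(f ^^ m) (x 0) \<noteq> x 0" using that iter_x0_eq_iff nat_dvd_not_less by auto
    then show ?thesis using Hausdorff_sphere unfolding Hausdorff_space_def disjnt_def by simp
  qed
  then obtain P Q where PQ: "\<And>m. m \<in> {1..<n} \<Longrightarrow> openin riemann_sphere (P m) \<and> openin riemann_sphere (Q m)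
      \<and> (f ^^ m) (x 0) \<in> P m \<and> x 0 \<in> Q m \<and> P m \<inter> Q m = {}" by metis
  define N where "N = (\<Inter>m\<in>{1..<n}. Q m) \<inter> UNIV"
  have N: "openin riemann_sphere N"
  proof (cases "{1..<n} = {}")
    case True
    then show ?thesis using openin_topspace[of riemann_sphere] by (simp add: N_def)
  next
    case False
    then show ?thesis using PQ unfolding N_def Int_UNIV_right by (intro openin_Inter) auto
  qed
  have "\<forall>\<^sub>F j in sequentially. (f ^^ m) ((f ^^ (i + n * j)) c) \<in> P m" if m: "m \<in> {1..<n}" for m
  proof -
    have "openin riemann_sphere {s \<in> S. (f ^^ m) s \<in> P m}"
      using holomorphic_self_vimage[OF self_iter S_open] PQ[OF m] by blast
    moreover have "x 0 \<in> {s \<in> S. (f ^^ m) s \<in> P m}" using x_in_S PQ[OF m] by simp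
    ultimately have "\<forall>\<^sub>F j in sequentially. (f ^^ (i + n * j)) c \<in> {s \<in> S. (f ^^ m) s \<in> P m}"
      using assms(2) by (auto simp: attracted_def)
    then show ?thesis by (rule eventually_mono) simp
  qed
  then have "\<forall>\<^sub>F j in sequentially. \<forall>m\<in>{1..<n}. (f ^^ m) ((f ^^ (i + n * j)) c) \<in> P m"
    by (intro eventually_ball_finite) auto
  then obtain J where J: "\<And>j m. J \<le> j \<Longrightarrow> m \<in> {1..<n} \<Longrightarrow> (f ^^ m) ((f ^^ (i + n * j)) c) \<in> P m"
    unfolding eventually_sequentially by blast
  have "l mod n = i mod n" if l: "i + n * J \<le> l" "(f ^^ l) c \<in> N" for l
  proof (rule ccontr)
    assume ne: "l mod n \<noteq> i mod n"
    define j m where "j = (l - i) div n" and "m = (l - i) mod n"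
    have l_eq: "l = m + (i + n * j)" using l(1) by (simp add: j_def m_def)
    have "m \<noteq> 0" using ne unfolding l_eq by (metis add_0 mod_mult_self2)
    moreover have "m < n" using n_pos by (simp add: m_def)
    ultimately have m: "m \<in> {1..<n}" by simp
    have "J \<le> j" using l(1) n_pos unfolding j_def
      by (metis add_le_imp_le_diff add.commute div_le_mono nonzero_mult_div_cancel_left not_one_le_zero)
    then have "(f ^^ l) c \<in> P m" using J[OF _ m, of j] unfolding l_eq by (simp add: funpow_add)
    moreover have "(f ^^ l) c \<in> Q m" using l(2) m by (auto simp: N_def)
    ultimately show False using PQ[OF m] by blast
  qed
  then have "\<forall>\<^sub>F l in sequentially. (f ^^ l) c \<in> N \<longrightarrow> l mod n = i mod n"
    unfolding eventually_sequentially by blast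
  moreover have "x 0 \<in> N" using PQ by (auto simp: N_def)
  ultimately show ?thesis using N that by blast
qed

text \<open>If \<open>c\<close> lies in the entry at index \<open>l\<close>, then
  \<open>f ^^ l\<close> maps it near \<open>x 0\<close>, which forces the residue of
  \<open>l\<close>; this is the upper bound, and \<open>ev\<close> provides the lower one.\<close>

lemma signature_attracted:
  assumes base: "disk_base r0 B" and c: "c \<in> S" "attracted c i"
    and ev: "\<And>r. 0 < r \<Longrightarrow> r \<le> r0 \<Longrightarrow> \<forall>\<^sub>F l in sequentially. l mod n = i mod n \<longrightarrow> c \<in> B r l"
  shows "signature S f d x c = alpha (class_of (\<lambda>j. j mod n = i mod n))"
proof -
  have "class_of \<beta> \<in> signature S f d x c \<longleftrightarrow> class_of \<beta> \<in> alpha (class_of (\<lambda>j. j mod n = i mod n))" for \<beta>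
  proof
    assume \<beta>: "class_of \<beta> \<in> signature S f d x c"
    obtain N where N: "openin riemann_sphere N" "x 0 \<in> N"
      "\<forall>\<^sub>F l in sequentially. (f ^^ l) c \<in> N \<longrightarrow> l mod n = i mod n"
      by (rule attracted_residue[OF c])
    obtain q where q: "0 < q" "disk q \<subseteq> N" using disk_small[OF N(1,2)] by blast
    have r0: "0 < r0" using base by (simp add: disk_base_def)
    define r where "r = min q r0"
    have r: "0 < r" "r \<le> r0" "disk r \<subseteq> N" using q r0 disk_mono[of r q] by (auto simp: r_def)
    have "\<forall>\<^sub>F l in sequentially. \<beta> l \<longrightarrow> c \<in> B r l" using \<beta> r(1,2) unfolding signature_iff[OF base] by blast
    with N(3) have "\<forall>\<^sub>F l in sequentially. \<beta> l \<longrightarrow> l mod n = i mod n"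
    proof eventually_elim
      case (elim l)
      note nb = disk_baseD[OF base r(1,2)]
      have "(f ^^ l) c \<in> B r 0" if "c \<in> B r l"
        using iterate_image_plaque[OF nbhdD(1)[OF nb(1)], of l 0] that by auto
      then show ?case using elim r(3) nb(2) by blast
    qed
    then show "class_of \<beta> \<in> alpha (class_of (\<lambda>j. j mod n = i mod n))"
      by (simp add: alpha_def class_of_le_iff)
  next
    assume "class_of \<beta> \<in> alpha (class_of (\<lambda>j. j mod n = i mod n))"
    then have \<beta>: "\<forall>\<^sub>F j in sequentially. \<beta> j \<longrightarrow> j mod n = i mod n" by (simp add: alpha_def class_of_le_iff)
    show "class_of \<beta> \<in> signature S f d x c"
      unfolding signature_iff[OF base]
    proof (intro allI impI)
      fix r :: real assume "0 < r" "r \<le> r0"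
      from ev[OF this] \<beta> show "\<forall>\<^sub>F l in sequentially. \<beta> l \<longrightarrow> c \<in> B r l" by eventually_elim blast
    qed
  qed
  then show ?thesis by (metis class_of_cases subsetI subset_antisym)
qed

lemma disk_base_less: "disk_base r0 B \<Longrightarrow> 0 < r1 \<Longrightarrow> r1 \<le> r0 \<Longrightarrow> disk_base r1 B"
  by (auto simp: disk_base_def)

text \<open>Either \<open>c\<close> lies in no entry of \<open>B r0\<close>, or it lies in one at
  some index \<open>i\<close>; contraction then keeps it in the entries with index congruent to
  \<open>i\<close>, eventually for every smaller radius as well.\<close>

lemma signature_attracting_cycle:
  assumes nb: "nbhd S f d x U" and c: "c \<in> critical_points S f" and mult: "norm (multiplier f n p) < 1"
  shows "signature S f d x c = {class_of (\<lambda>_. False)} \<or>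
    (\<exists>i. signature S f d x c = alpha (class_of (\<lambda>j. j mod n = i mod n)))"
proof -
  obtain e \<Phi> where \<Phi>: "0 < e" "\<Phi> holomorphic_on ball 0 e" "\<Phi> 0 = 0" "deriv \<Phi> 0 = multiplier f n p"
    "\<And>z. z \<in> ball 0 e \<Longrightarrow> (f ^^ n) (loc z) = loc (\<Phi> z)"
    by (rule return_map_coord) blast
  obtain \<kappa> where \<kappa>: "norm (deriv \<Phi> 0) < \<kappa>" "\<kappa> < 1" using mult dense unfolding \<Phi>(4) by blast
  have \<kappa>0: "0 < \<kappa>" using \<kappa>(1) norm_ge_zero[of "deriv \<Phi> 0"] by linarith
  have 0: "0 \<in> ball 0 e" using \<Phi>(1) by simp
  obtain q where q: "0 < q" "ball 0 q \<subseteq> ball (0::complex) e" "\<And>z. z \<in> ball 0 q \<Longrightarrow> norm (\<Phi> z) \<le> \<kappa> * norm z"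
    using holomorphic_linear_bound[OF \<Phi>(2) open_ball 0 \<Phi>(3) \<kappa>(1)] by blast
  obtain r00 B where base0: "disk_base r00 B" using disk_base_exists[OF nb] by blast
  define r0 where "r0 = min r00 q"
  have r0: "0 < r0" "r0 \<le> q" using base0 q(1) by (auto simp: r0_def disk_base_def)
  have base: "disk_base r0 B" using disk_base_less[OF base0 r0(1)] by (simp add: r0_def)
  note nb0 = disk_baseD[OF base r0(1) order_refl]
  have \<kappa>1: "\<kappa> ^ k \<le> 1" "0 < \<kappa> ^ k" for k using \<kappa>0 \<kappa>(2) by (simp_all add: power_le_one)
  have contr: "(f ^^ (n * k)) ` disk r0 \<subseteq> disk (\<kappa> ^ k * r0)" for k
  proof -
    have "\<exists>w. (f ^^ (n * k)) (loc z) = loc w \<and> norm w \<le> \<kappa> ^ k * norm z" if z: "norm z < r0" for z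
    proof (induction k)
      case (Suc k)
      then obtain w where w: "(f ^^ (n * k)) (loc z) = loc w" "norm w \<le> \<kappa> ^ k * norm z" by blast
      have "norm w \<le> norm z" using w(2) mult_right_mono[OF \<kappa>1(1)[of k], of "norm z"] by simp
      then have wq: "w \<in> ball 0 q" using z r0(2) by simp
      then have "norm (\<Phi> w) \<le> \<kappa> * norm w" by (rule q(3))
      also have "\<dots> \<le> \<kappa> * (\<kappa> ^ k * norm z)" using w(2) \<kappa>0 by (intro mult_left_mono) auto
      finally have "norm (\<Phi> w) \<le> \<kappa> ^ Suc k * norm z" by simp
      moreover have "(f ^^ (n * Suc k)) (loc z) = loc (\<Phi> w)"
        using \<Phi>(5)[of w] wq q(2) w(1) by (auto simp: funpow_add)
      ultimately show ?case by blast
    qed (auto intro: exI[of _ z])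
    moreover have "\<kappa> ^ k * norm z < \<kappa> ^ k * r0" if "norm z < r0" for z :: complex
      using that \<kappa>1(2) by (rule mult_strict_left_mono)
    ultimately show ?thesis unfolding disk_def by (force simp: image_subset_iff)
  qed
  have small: "\<exists>k0. \<forall>k\<ge>k0. disk (\<kappa> ^ k * r0) \<subseteq> disk r" if r: "0 < r" for r
  proof -
    have "(\<lambda>k. \<kappa> ^ k * r0) \<longlonglongrightarrow> 0 * r0"
      using \<kappa>0 \<kappa>(2) by (intro tendsto_mult LIMSEQ_realpow_zero tendsto_const) auto
    then have "\<forall>\<^sub>F k in sequentially. \<kappa> ^ k * r0 < r" using r by (intro order_tendstoD(2)[where y = "0 * r0"]) auto
    then obtain k0 where "\<And>k. k0 \<le> k \<Longrightarrow> \<kappa> ^ k * r0 < r" unfolding eventually_sequentially by blast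
    then show ?thesis using disk_mono less_imp_le by meson
  qed
  have absorb: "B r0 i \<subseteq> B r (i + n * k)" if r: "0 < r" "r \<le> r0" and k: "disk (\<kappa> ^ k * r0) \<subseteq> disk r" for r k i
  proof -
    note nbr = disk_baseD[OF base r]
    \<comment> \<open>After \<open>k\<close> periods \<open>disk r0\<close> lies in
      \<open>disk r\<close>; absorption turns this forward statement into one about an entry of
      \<open>B r\<close>.\<close>
    have "disk r0 \<subseteq> B r (n * k)"
    proof (rule plaque_absorb_iter[OF nbhdD(1)[OF nbr(1)] _ _ nbhdD(3)[OF nbr(1)]])
      show "connectedin riemann_sphere (disk r0)" "disk r0 \<subseteq> S"
        using plaqueD(1,4)[OF nbhdD(1)[OF nb0(1)], of 0] nb0(2) by simp_all
      have "x (n * k) = x 0" by (simp add: x_eq_iff)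
      then show "x (n * k) \<in> disk r0" using x0_in_disk[OF r0(1)] by simp
      show "(f ^^ (n * k)) ` disk r0 \<subseteq> B r 0" using contr[of k] k nbr(2) by blast
    qed
    then show ?thesis using nbhd_mono[OF nb0(1) nbhd_shift[OF nbr(1), of k]] nb0(2) by simp
  qed
  show ?thesis
  proof (cases "\<exists>i. c \<in> B r0 i")
    case False
    have "\<forall>\<^sub>F i in sequentially. \<not> \<beta> i" if "class_of \<beta> \<in> signature S f d x c" for \<beta>
    proof -
      have "\<forall>\<^sub>F i in sequentially. \<beta> i \<longrightarrow> c \<in> B r0 i"
        using that r0(1) unfolding signature_iff[OF base] by blast
      then show ?thesis by (rule eventually_mono) (use False in blast)
    qed
    moreover have "class_of (\<lambda>_. False) \<in> signature S f d x c" by (simp add: signature_iff[OF base])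
    ultimately show ?thesis unfolding signature_trivial_iff by blast
  next
    case True
    then obtain i where i: "c \<in> B r0 i" by blast
    have cS: "c \<in> S" using c by (simp add: critical_points_def)
    have fic: "(f ^^ i) c \<in> disk r0"
      using iterate_image_plaque[OF nbhdD(1)[OF nb0(1)], of i 0] i nb0(2) by auto
    have "attracted c i" unfolding attracted_def
    proof (intro allI impI)
      fix N assume "openin riemann_sphere N" "x 0 \<in> N"
      then obtain r where r: "0 < r" "disk r \<subseteq> N" using disk_small by blast
      obtain k0 where "\<And>k. k0 \<le> k \<Longrightarrow> disk (\<kappa> ^ k * r0) \<subseteq> disk r" using small[OF r(1)] by blast
      then have "(f ^^ (i + n * k)) c \<in> N" if "k0 \<le> k" for k
        using that contr[of k] fic r(2) by (auto simp: add.commute[of i] funpow_add image_subset_iff)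
      then show "\<forall>\<^sub>F j in sequentially. (f ^^ (i + n * j)) c \<in> N" unfolding eventually_sequentially by blast
    qed
    moreover have "\<forall>\<^sub>F l in sequentially. l mod n = i mod n \<longrightarrow> c \<in> B r l" if r: "0 < r" "r \<le> r0" for r
    proof -
      obtain k0 where k0: "\<And>k. k0 \<le> k \<Longrightarrow> disk (\<kappa> ^ k * r0) \<subseteq> disk r" using small[OF r(1)] by blast
      have "c \<in> B r l" if l: "i + n * k0 \<le> l" "l mod n = i mod n" for l
      proof -
        have "n dvd l - i" using l by (metis add_leD1 mod_eq_dvd_iff_nat)
        then obtain k where "l - i = n * k" by (rule dvdE)
        then have k: "l = i + n * k" using l(1) by linarith
        then have "k0 \<le> k" using l(1) n_pos by simp
        then show ?thesis using absorb[OF r k0, of k i] i k by blast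
      qed
      then show ?thesis unfolding eventually_sequentially by blast
    qed
    ultimately show ?thesis using signature_attracted[OF base cS] by blast
  qed
qed

text \<open>With multiplier 0 the return map has no local inverse to shift a plaque back; invariance
  is read off the explicit form of the signature instead.\<close>

lemma signature_shift_attracting:
  assumes "signature S f d x c = {class_of (\<lambda>_. False)} \<or>
    (\<exists>i. signature S f d x c = alpha (class_of (\<lambda>j. j mod n = i mod n)))"
    and \<beta>: "class_of \<beta> \<in> signature S f d x c"
  shows "class_of (\<lambda>j. \<beta> (j + n)) \<in> signature S f d x c"
  using assms(1)
proof (elim disjE exE)
  assume s: "signature S f d x c = {class_of (\<lambda>_. False)}"
  then have "\<forall>\<^sub>F j in sequentially. \<not> \<beta> j" using \<beta> by (simp add: class_of_eq_iff)
  then have "\<forall>\<^sub>F j in sequentially. \<not> \<beta> (j + n)" by (rule eventually_all_ge_at_top[THEN eventually_mono]) simp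
  then show ?thesis unfolding s by (simp add: class_of_eq_iff)
next
  fix i assume s: "signature S f d x c = alpha (class_of (\<lambda>j. j mod n = i mod n))"
  obtain N where N: "\<And>j. N \<le> j \<Longrightarrow> \<beta> j \<Longrightarrow> j mod n = i mod n"
    using \<beta> unfolding s alpha_def mem_Collect_eq class_of_le_iff eventually_sequentially by blast
  have "\<beta> (j + n) \<longrightarrow> j mod n = i mod n" if "N \<le> j" for j using N[of "j + n"] that by simp
  then show ?thesis
    unfolding s alpha_def mem_Collect_eq class_of_le_iff eventually_sequentially by blast
qed

end

subsection \<open>Holomorphic disks omitting three points\<close>

text \<open>The coordinate that sends \<open>a\<close> to infinity. As \<open>inverse 0 = 0\<close>,
  its value at \<open>Some a\<close> collides with that at infinity, so \<open>a\<close> has to be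
  excluded below.\<close>

definition recip :: "complex \<Rightarrow> complex option \<Rightarrow> complex" where
  "recip a s = (case s of None \<Rightarrow> 0 | Some z \<Rightarrow> inverse (z - a))"

lemma recip_inj:
  "recip a s = recip a t \<Longrightarrow> s \<noteq> Some a \<Longrightarrow> t \<noteq> Some a \<Longrightarrow> s = t"
  by (auto simp: recip_def split: option.splits)

lemma recip_holomorphic:
  assumes "sphere_holomorphic_on \<phi> A" "open A" "\<And>z. z \<in> A \<Longrightarrow> \<phi> z \<noteq> Some a"
  shows "(\<lambda>z. recip a (\<phi> z)) holomorphic_on A"
proof (rule holomorphic_onI)
  fix z assume z: "z \<in> A"
  have "\<exists>B. open B \<and> z \<in> B \<and> (\<lambda>z. recip a (\<phi> z)) holomorphic_on B"
  proof (cases "\<phi> z = None")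
    case False
    then have "chart (Some 0) (\<phi> z) \<noteq> None" by (simp add: chart_def)
    then obtain B where B: "open B" "z \<in> B" "B \<subseteq> A" "\<And>w. w \<in> B \<Longrightarrow> chart (Some 0) (\<phi> w) \<noteq> None"
        "(\<lambda>w. co (Some 0) (\<phi> w)) holomorphic_on B"
      using sphere_holomorphic_coord_local[OF assms(1,2) z] by metis
    have \<phi>: "\<phi> w = Some (co (Some 0) (\<phi> w))" if "w \<in> B" for w
      using B(4)[OF that] by (simp add: chart_def co_def)
    then have ne: "co (Some 0) (\<phi> w) - a \<noteq> 0" if "w \<in> B" for w
      using that assms(3)[of w] B(3) by auto
    have "(\<lambda>w. inverse (co (Some 0) (\<phi> w) - a)) holomorphic_on B"
      using B(5) ne by (intro holomorphic_intros)
    then have "(\<lambda>z. recip a (\<phi> z)) holomorphic_on B"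
    proof (rule holomorphic_transform)
      fix w assume "w \<in> B"
      have "recip a (Some (co (Some 0) (\<phi> w))) = inverse (co (Some 0) (\<phi> w) - a)" by (simp add: recip_def)
      then show "inverse (co (Some 0) (\<phi> w) - a) = recip a (\<phi> w)" using \<phi>[OF \<open>w \<in> B\<close>] by simp
    qed
    then show ?thesis using B by blast
  next
    case True
    then have "chart None (\<phi> z) \<noteq> None" by (simp add: chart_def)
    then obtain B where B: "open B" "z \<in> B" "B \<subseteq> A" "\<And>w. w \<in> B \<Longrightarrow> chart None (\<phi> w) \<noteq> None"
        "(\<lambda>w. co None (\<phi> w)) holomorphic_on B"
      using sphere_holomorphic_coord_local[OF assms(1,2) z] by metis
    define u where "u w = co None (\<phi> w)" for w
    have \<phi>: "\<phi> w = (if u w = 0 then None else Some (1 / u w))" if "w \<in> B" for w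
      using pt_co[OF B(4)[OF that]] by (auto simp: u_def pt_def chart_def split: if_splits)
    \<comment> \<open>In the coordinate \<open>u = 1 / z\<close> the map \<open>1 / (z - a)\<close>
      reads \<open>u / (1 - a u)\<close>, which is regular at \<open>u = 0\<close>; its denominator
      vanishes only at the excluded value \<open>a\<close>.\<close>
    have ne: "1 - a * u w \<noteq> 0" if "w \<in> B" for w
    proof
      assume "1 - a * u w = 0"
      then have au: "a * u w = 1" by simp
      then have "u w \<noteq> 0" by auto
      moreover from this have "1 / u w = a" using au by (simp add: nonzero_divide_eq_eq)
      ultimately have "u w \<noteq> 0" "1 / u w = a" .
      then show False using \<phi>[OF that] assms(3)[of w] that B(3) by auto
    qed
    have "(\<lambda>w. u w / (1 - a * u w)) holomorphic_on B"
      using B(5) ne unfolding u_def by (intro holomorphic_intros)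
    then have "(\<lambda>z. recip a (\<phi> z)) holomorphic_on B"
    proof (rule holomorphic_transform)
      fix w assume w: "w \<in> B"
      show "u w / (1 - a * u w) = recip a (\<phi> w)"
      proof (cases "u w = 0")
        case False
        have "recip a (Some (1 / u w)) = inverse ((1 - a * u w) / u w)"
          using False by (simp add: recip_def diff_divide_distrib)
        also have "\<dots> = u w / (1 - a * u w)" by simp
        finally show ?thesis using \<phi>[OF w] False by simp
      qed (use \<phi>[OF w] in \<open>simp add: recip_def\<close>)
    qed
    then show ?thesis using B by blast
  qed
  then obtain B where B: "open B" "z \<in> B" "(\<lambda>z. recip a (\<phi> z)) holomorphic_on B" by blast
  then have "(\<lambda>z. recip a (\<phi> z)) field_differentiable at z"
    using holomorphic_on_imp_differentiable_at by blast
  then show "(\<lambda>z. recip a (\<phi> z)) field_differentiable at z within A"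
    by (rule field_differentiable_at_within)
qed

text \<open>Schottky's bound depends only on the value at the center, so it is uniform over all
  holomorphic disks centered at \<open>s\<close> that omit the three points.\<close>

lemma three_point_bound:
  assumes "a \<noteq> b" "a \<noteq> c" "b \<noteq> c"
  obtains K where "0 \<le> K" "\<And>\<phi> z. sphere_holomorphic_on \<phi> (ball 0 1) \<Longrightarrow> \<phi> 0 = s \<Longrightarrow>
    \<phi> ` ball 0 1 \<inter> {Some a, Some b, Some c} = {} \<Longrightarrow> norm z \<le> 1 / 2 \<Longrightarrow> norm (recip a (\<phi> z)) \<le> K"
proof -
  define D where "D = recip a (Some c) - recip a (Some b)"
  \<comment> \<open>The Moebius map that sends \<open>a\<close>, \<open>b\<close>, \<open>c\<close>
    to infinity, 0, 1.\<close>
  define M where "M s = (recip a s - recip a (Some b)) / D" for s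
  have D: "D \<noteq> 0" using assms recip_inj[of a "Some c" "Some b"] by (auto simp: D_def)
  have M01: "M s \<noteq> 0" "M s \<noteq> 1" if "s \<notin> {Some a, Some b, Some c}" for s
    using that D recip_inj[of a s "Some b"] recip_inj[of a s "Some c"] assms
    by (auto simp: M_def divide_simps D_def)
  define C where "C = exp (pi * exp (pi * (2 + 2 * norm (M s) + 12 * (2 / 3) / (1 - 2 / 3))))"
  define K where "K = C * norm D + norm (recip a (Some b))"
  show ?thesis
  proof (rule that[of K])
    show "0 \<le> K" by (simp add: K_def C_def)
    fix \<phi> and z :: complex
    assume \<phi>: "sphere_holomorphic_on \<phi> (ball 0 1)" "\<phi> 0 = s"
      "\<phi> ` ball 0 1 \<inter> {Some a, Some b, Some c} = {}" and z: "norm z \<le> 1 / 2"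
    have omit: "\<phi> w \<notin> {Some a, Some b, Some c}" if "w \<in> ball 0 1" for w using \<phi>(3) that by blast
    \<comment> \<open>The factor \<open>3 / 4\<close> makes \<open>g\<close> holomorphic on the
      closed disk and turns \<open>norm z \<le> 1 / 2\<close> into the radius \<open>2 / 3\<close>
      for which \<open>C\<close> is Schottky's constant.\<close>
    define g where "g w = M (\<phi> ((3 / 4) * w))" for w
    have in1: "(3 / 4) * w \<in> ball 0 1" if "w \<in> cball 0 1" for w :: complex
      using that by (auto simp: norm_mult)
    have "(\<lambda>z. recip a (\<phi> z)) holomorphic_on ball 0 1"
      by (rule recip_holomorphic[OF \<phi>(1)]) (use omit in auto)
    then have "(\<lambda>z. recip a (\<phi> z)) \<circ> (\<lambda>w. (3 / 4) * w) holomorphic_on cball 0 1"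
      by (rule holomorphic_on_compose_gen[rotated]) (use in1 in \<open>auto intro!: holomorphic_intros\<close>)
    then have g: "g holomorphic_on cball 0 1"
      unfolding g_def M_def using D by (intro holomorphic_intros) (auto simp: o_def)
    have "norm (g ((4 / 3) * z)) \<le> C"
      unfolding C_def
    proof (rule Schottky[OF g])
      show "norm (g 0) \<le> norm (M s)" by (simp add: g_def \<phi>(2))
      show "\<not> (g w = 0 \<or> g w = 1)" if "w \<in> cball 0 1" for w
        using M01[OF omit[OF in1[OF that]]] by (simp add: g_def)
      show "norm ((4 / 3) * z) \<le> 2 / 3" using z by (simp add: norm_mult)
    qed auto
    then have M: "norm (M (\<phi> z)) \<le> C" by (simp add: g_def)
    have "recip a (\<phi> z) = M (\<phi> z) * D + recip a (Some b)" using D by (simp add: M_def)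
    then have "norm (recip a (\<phi> z)) \<le> norm (M (\<phi> z)) * norm D + norm (recip a (Some b))"
      by (metis norm_mult norm_triangle_ineq)
    also have "\<dots> \<le> K" unfolding K_def using M by (intro add_right_mono mult_right_mono) auto
    finally show "norm (recip a (\<phi> z)) \<le> K" .
  qed
qed

lemma deriv_bound_half_disk:
  assumes "g holomorphic_on ball 0 1" "\<And>z. norm z \<le> 1 / 2 \<Longrightarrow> norm (g z) \<le> K"
  shows "norm (deriv g 0) \<le> 2 * K"
proof -
  have sub: "cball 0 (1/2) \<subseteq> ball (0::complex) 1" "ball 0 (1/2) \<subseteq> ball (0::complex) 1" by auto
  have "norm ((deriv ^^ 1) g 0) \<le> fact 1 * K / (1 / 2) ^ 1"
  proof (rule Cauchy_inequality)
    show "g holomorphic_on ball 0 (1/2)" by (rule holomorphic_on_subset[OF assms(1) sub(2)])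
    show "continuous_on (cball 0 (1/2)) g"
      by (rule holomorphic_on_imp_continuous_on[OF holomorphic_on_subset[OF assms(1) sub(1)]])
  qed (use assms(2) in auto)
  then show ?thesis by simp
qed

section \<open>Inverse branches at a regular point\<close>

context covering_cycle
begin

text \<open>
  The points are taken from a backward orbit under \<open>f ^^ n\<close> of a point outside the cycle that
  \<open>f\<close> maps into the cycle.
\<close>

lemma omitted_points:
  assumes mult: "multiplier f n p \<noteq> 0"
  obtains a b c :: complex and k0 where "a \<noteq> b" "a \<noteq> c" "b \<noteq> c"
    "\<And>t. t \<in> {a, b, c} \<Longrightarrow> Some t \<in> S" "\<And>t. t \<in> {a, b, c} \<Longrightarrow> Some t \<noteq> x 0"
    "\<And>t k. t \<in> {a, b, c} \<Longrightarrow> k0 \<le> k \<Longrightarrow> (f ^^ (n * k)) (Some t) = x 0"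
proof -
  have "sphere_deriv (f ^^ n) (x 0) \<noteq> 0" using mult p_eq_x[of 0] n_pos by (simp add: multiplier_def)
  then obtain N where N: "openin riemann_sphere N" "x 0 \<in> N" "N \<subseteq> S" "inj_on (f ^^ n) N"
    using inj_if_sphere_deriv_nonzero[OF self_iter S_open x_in_S] by blast
  have fn: "(f ^^ n) z = (f ^^ (n - 1)) (f z)" for z
    using n_pos by (cases n) (auto simp: funpow_swap1)
  \<comment> \<open>An iterate that is injective near \<open>x 0\<close> has an injective first
    factor, so the covering has a second preimage \<open>q\<close> of
    \<open>f (x 0)\<close>.\<close>
  have "inj_on f N" using N(4) unfolding inj_on_def fn by metis
  then obtain q where q: "q \<in> S" "q \<noteq> x 0" "f q = f (x 0)" using other_preimage[OF N(2,1,3)] by metis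
  have Fx: "(f ^^ (n * k)) (x 0) = x 0" for k by (rule iter_x_periodic)
  have Fq: "(f ^^ n) q = x 0" using fn[of q] fn[of "x 0"] q(3) Fx[of 1] by simp
  have "\<exists>r. \<forall>j. (r j \<in> S \<and> (j = 0 \<longrightarrow> r j = q)) \<and> (f ^^ n) (r (Suc j)) = r j"
  proof (rule dependent_nat_choice)
    fix z and j :: nat assume "z \<in> S \<and> (j = 0 \<longrightarrow> z = q)"
    then show "\<exists>y. (y \<in> S \<and> (Suc j = 0 \<longrightarrow> y = q)) \<and> (f ^^ n) y = z"
      using iter_preimage_exists by blast
  qed (use q in auto)
  then obtain r where r: "\<And>j. r j \<in> S" "r 0 = q" "\<And>j. (f ^^ n) (r (Suc j)) = r j" by blast
  have rq: "(f ^^ (n * j)) (r j) = q" for j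
  proof (induction j)
    case (Suc j)
    have "(f ^^ (n * Suc j)) (r (Suc j)) = (f ^^ (n * j)) ((f ^^ n) (r (Suc j)))"
      by (metis add.commute comp_apply funpow_add mult_Suc_right)
    then show ?case using r(3) Suc by simp
  qed (simp add: r(2))
  have rx: "(f ^^ (n * k)) (r j) = x 0" if "j < k" for j k
  proof -
    have "n * k = n * (k - Suc j) + (n + n * j)" using that
      by (metis Suc_leI le_add_diff_inverse2 distrib_left mult_Suc_right)
    then have "(f ^^ (n * k)) (r j) = (f ^^ (n * (k - Suc j))) ((f ^^ n) ((f ^^ (n * j)) (r j)))"
      by (simp add: funpow_add)
    then show ?thesis using rq Fq Fx by simp
  qed
  have ne: "r j \<noteq> x 0" for j using rq[of j] Fx[of j] q(2) by metis
  have inj: "r i \<noteq> r j" if "i < j" for i j using rx[OF that] rq[of j] q(2) by metis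
  \<comment> \<open>The backward orbit never repeats, so it meets infinity at most once; three
    consecutive points after that are finite.\<close>
  have "\<exists>m. \<forall>j\<ge>m. r j \<noteq> None"
  proof (cases "\<exists>i. r i = None")
    case True
    then obtain i where "r i = None" by blast
    then have "\<forall>j\<ge>Suc i. r j \<noteq> None" using inj[of i] by (metis Suc_le_eq)
    then show ?thesis by blast
  qed auto
  then obtain m where m: "\<And>j. m \<le> j \<Longrightarrow> r j \<noteq> None" by blast
  obtain a b c where abc: "r m = Some a" "r (Suc m) = Some b" "r (Suc (Suc m)) = Some c"
    using m[of m] m[of "Suc m"] m[of "Suc (Suc m)"] by auto
  show ?thesis
  proof (rule that[of a b c "Suc (Suc (Suc m))"])
    show "a \<noteq> b" "a \<noteq> c" "b \<noteq> c"
      using inj[of m "Suc m"] inj[of m "Suc (Suc m)"] inj[of "Suc m" "Suc (Suc m)"] abc by auto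
    show "Some t \<in> S" if "t \<in> {a, b, c}" for t using that r(1) abc by (metis insertE singletonD)
    show "Some t \<noteq> x 0" if "t \<in> {a, b, c}" for t using that ne abc by (metis insertE singletonD)
    show "(f ^^ (n * k)) (Some t) = x 0" if "t \<in> {a, b, c}" "Suc (Suc (Suc m)) \<le> k" for t k
      using that rx[of m k] rx[of "Suc m" k] rx[of "Suc (Suc m)" k] abc by auto
  qed
qed

lemma plaque_iterate_inj:
  assumes V: "plaque S f d V" and bij: "\<And>i. i < m \<Longrightarrow> bij_betw f (V (Suc i)) (V i)"
  shows "inj_on (f ^^ m) (V m)"
  using bij
proof (induction m)
  case (Suc m)
  have "inj_on ((f ^^ m) \<circ> f) (V (Suc m))"
  proof (rule comp_inj_on)
    show "inj_on f (V (Suc m))" using Suc.prems[of m] by (simp add: bij_betw_def)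
    show "inj_on (f ^^ m) (f ` V (Suc m))" using Suc plaqueD(3)[OF V] by simp
  qed
  then show ?case by (simp only: funpow_Suc_right)
qed simp

text \<open>Shifting by enough whole periods passes the finitely many steps that may fail to be
  bijective and still gives a plaque around \<open>x\<close>.\<close>

lemma regular_univalent_nbhd:
  assumes "regular_point S f d x"
  obtains r V where "0 < r" "nbhd S f d x V" "V 0 = disk r" "\<And>i. bij_betw f (V (Suc i)) (V i)"
proof -
  obtain U n0 where U: "nbhd S f d x U" "\<And>i. n0 \<le> i \<Longrightarrow> bij_betw f (U (Suc i)) (U i)"
    using assms by (auto simp: regular_point_def)
  define W where "W i = U (i + n * n0)" for i
  have W: "nbhd S f d x W" unfolding W_def by (rule nbhd_shift[OF U(1)])
  have inj: "inj_on f (W (Suc i))" for i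
  proof -
    have "n0 \<le> i + n * n0" using n_pos by (metis le_add2 le_trans mult_le_mono1 nat_mult_1)
    then show ?thesis using U(2) by (simp add: W_def bij_betw_def)
  qed
  obtain r where r: "0 < r" "disk r \<subseteq> W 0"
    using disk_small[OF plaqueD(2)[OF nbhdD(1)[OF W]] nbhdD(2)[OF W]] by blast
  obtain V where V: "plaque S f d V" "V 0 = disk r" "x \<in> points_of S f V" "\<And>i. V i \<subseteq> W i"
    using plaque_shrink[OF nbhdD(1,3)[OF W] r(2) x0_in_disk[OF r(1)] conformal_disk[OF r(1)]] by metis
  show ?thesis
  proof
    show "0 < r" "V 0 = disk r" by (fact r V)+
    show "nbhd S f d x V" using V by (simp add: nbhd_def)
    show "bij_betw f (V (Suc i)) (V i)" for i
      using plaqueD(3)[OF V(1)] inj_on_subset[OF inj V(4)] by (simp add: bij_betw_def)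
  qed
qed

lemma regular_multiplier_nonzero:
  assumes "regular_point S f d x" shows "multiplier f n p \<noteq> 0"
proof -
  obtain r V where V: "0 < r" "nbhd S f d x V" "V 0 = disk r" "\<And>i. bij_betw f (V (Suc i)) (V i)"
    by (rule regular_univalent_nbhd[OF assms]) blast
  note P = nbhdD(1)[OF V(2)]
  have "x n = x 0" by (simp add: x_eq_iff)
  then have "x 0 \<in> V n" using nbhdD(2)[OF V(2), of n] by simp
  then have "sphere_deriv (f ^^ n) (x 0) \<noteq> 0"
    using sphere_deriv_nonzero_if_inj[OF self_iter S_open _ plaqueD(2,1)[OF P] plaque_iterate_inj[OF P V(4)]] by blast
  then show ?thesis using p_eq_x[of 0] n_pos by (simp add: multiplier_def)
qed

text \<open>
  The inverse branches of the iterates of \<open>f ^^ n\<close> on a univalent plaque form a normal family, as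
  they omit three points, and hence \<open>1 \<le> cmod \<lambda>\<close>. In the neutral case a limit \<open>h\<close> of
  the averages of \<open>\<lambda>\<^sup>k g\<^sub>k\<close> satisfies \<open>h \<circ> \<gamma> = \<lambda>\<^sup>-\<^sup>1 h\<close> for the local inverse \<open>\<gamma>\<close> of \<open>f ^^ n\<close>.
\<close>

lemma regular_inverse_branches:
  assumes reg: "regular_point S f d x"
  obtains r \<delta> \<gamma> G K where "0 < r" "0 < \<delta>" "\<delta> \<le> 1 / 2"
    "\<gamma> holomorphic_on ball 0 \<delta>" "\<gamma> 0 = 0" "deriv \<gamma> 0 = inverse (multiplier f n p)"
    "\<And>z. z \<in> ball 0 \<delta> \<Longrightarrow> \<gamma> z \<in> ball 0 (1 / 2)"
    "\<And>z. z \<in> ball 0 \<delta> \<Longrightarrow> (f ^^ n) (loc (of_real r * \<gamma> z)) = loc (of_real r * z)"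
    "\<And>k::nat. G k holomorphic_on ball 0 1" "\<And>k z. norm z \<le> 1 / 2 \<Longrightarrow> norm (G k z) \<le> K"
    "\<And>k. G k 0 = 0" "deriv (G 0) 0 \<noteq> 0" "\<And>k z. z \<in> ball 0 \<delta> \<Longrightarrow> G (Suc k) z = G k (\<gamma> z)"
proof -
  note mult = regular_multiplier_nonzero[OF reg]
  obtain r V where r: "0 < r" and V: "nbhd S f d x V" "V 0 = disk r" "\<And>i. bij_betw f (V (Suc i)) (V i)"
    by (rule regular_univalent_nbhd[OF reg]) blast
  note P = nbhdD(1)[OF V(1)]
  obtain a b c k0 where abc: "a \<noteq> b" "a \<noteq> c" "b \<noteq> c"
    "\<And>t. t \<in> {a, b, c} \<Longrightarrow> Some t \<in> S" "\<And>t. t \<in> {a, b, c} \<Longrightarrow> Some t \<noteq> x 0"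
    "\<And>t k. t \<in> {a, b, c} \<Longrightarrow> k0 \<le> k \<Longrightarrow> (f ^^ (n * k)) (Some t) = x 0"
    by (rule omitted_points[OF mult]) blast
  have xV: "x 0 \<in> V (n * k)" for k
  proof -
    have "x (n * k) = x 0" by (simp add: x_eq_iff)
    then show ?thesis using nbhdD(2)[OF V(1), of "n * k"] by simp
  qed
  have injV: "inj_on (f ^^ (n * k)) (V (n * k))" for k
    using plaque_iterate_inj[OF P, of "n * k"] V(3) by blast
  have "\<exists>\<beta>. conformal_from_disk \<beta> (V (n * k)) \<and> (\<forall>z\<in>ball 0 1. (f ^^ (n * k)) (\<beta> z) = loc (of_real r * z))" for k
  proof -
    have "conformal_from_disk (\<lambda>z. loc (of_real r * z)) (V 0)" using conformal_disk[OF r] V(2) by simp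
    then show ?thesis
    proof (rule plaque_chain[OF P V(3), where m = "n * k"])
      fix \<beta> assume "conformal_from_disk \<beta> (V (n * k))"
        "\<And>z. z \<in> ball 0 1 \<Longrightarrow> (f ^^ (n * k)) (\<beta> z) = loc (of_real r * z)"
      then show ?thesis by (intro exI[of _ \<beta>] conjI ballI)
    qed
  qed
  then obtain \<psi> where \<psi>: "\<And>k. conformal_from_disk (\<psi> k) (V (n * k))"
    "\<And>k z. z \<in> ball 0 1 \<Longrightarrow> (f ^^ (n * k)) (\<psi> k z) = loc (of_real r * z)" by metis
  note \<psi>D = conformal_from_diskD[OF \<psi>(1)]
  have \<psi>V: "\<psi> k z \<in> V (n * k)" if "z \<in> ball 0 1" for k z using \<psi>D(3) that by blast
  have \<psi>0: "\<psi> k 0 = x 0" for k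
  proof (rule inj_onD[OF injV _ \<psi>V xV])
    show "(f ^^ (n * k)) (\<psi> k 0) = (f ^^ (n * k)) (x 0)" using \<psi>(2)[of 0 k] iter_x_periodic[of k 0] by simp
  qed simp
  \<comment> \<open>\<open>Some t\<close> and \<open>x 0\<close> have the same image under an
    iterate that is injective on the entry, so \<open>Some t\<close> cannot lie in the entry
    together with \<open>x 0\<close>.\<close>
  have omit: "\<psi> k z \<noteq> Some t" if "k0 \<le> k" "t \<in> {a, b, c}" "z \<in> ball 0 1" for k t z
  proof
    assume *: "\<psi> k z = Some t"
    have "Some t = x 0"
    proof (rule inj_onD[OF injV[of k] _ _ xV])
      show "(f ^^ (n * k)) (Some t) = (f ^^ (n * k)) (x 0)" using abc(6)[OF that(2,1)] iter_x_periodic[of k 0] by simp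
      show "Some t \<in> V (n * k)" using \<psi>V[OF that(3), of k] * by simp
    qed
    then show False using abc(5)[OF that(2)] by blast
  qed
  obtain K where K: "0 \<le> K" "\<And>\<phi> z. sphere_holomorphic_on \<phi> (ball 0 1) \<Longrightarrow> \<phi> 0 = x 0 \<Longrightarrow>
    \<phi> ` ball 0 1 \<inter> {Some a, Some b, Some c} = {} \<Longrightarrow> norm z \<le> 1 / 2 \<Longrightarrow> norm (recip a (\<phi> z)) \<le> K"
    by (rule three_point_bound[OF abc(1-3)]) blast
  \<comment> \<open>The index starts at \<open>k0\<close> so that every branch omits the three
    points; subtracting the value at \<open>x 0\<close> makes 0 a fixed value at the center.\<close>
  define G where "G k z = recip a (\<psi> (k0 + k) z) - recip a (x 0)" for k z
  have rechol: "(\<lambda>z. recip a (\<psi> (k0 + k) z)) holomorphic_on ball 0 1" for k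
    by (rule recip_holomorphic[OF \<psi>D(1)]) (use omit in auto)
  then have Ghol: "G k holomorphic_on ball 0 1" for k unfolding G_def by (intro holomorphic_intros)
  have Gbd: "norm (G k z) \<le> K + norm (recip a (x 0))" if "norm z \<le> 1 / 2" for k z
  proof -
    have "\<psi> (k0 + k) w \<notin> {Some a, Some b, Some c}" if "w \<in> ball 0 1" for w
      using omit[of "k0 + k" a w] omit[of "k0 + k" b w] omit[of "k0 + k" c w] that by simp
    then have "\<psi> (k0 + k) ` ball 0 1 \<inter> {Some a, Some b, Some c} = {}" by blast
    then have "norm (recip a (\<psi> (k0 + k) z)) \<le> K" by (rule K(2)[OF \<psi>D(1) \<psi>0 _ that])
    then show ?thesis unfolding G_def by (metis add_right_mono norm_triangle_ineq4 order_trans)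
  qed
  have Ginj: "inj_on (G 0) (ball 0 1)"
  proof (rule inj_onI)
    fix z w assume zw: "z \<in> ball 0 1" "w \<in> ball 0 1" "G 0 z = G 0 w"
    then have "\<psi> (k0 + 0) z = \<psi> (k0 + 0) w" using recip_inj[of a] omit[of "k0 + 0" a] by (simp add: G_def)
    then show "z = w" using \<psi>D(2) zw by (auto simp: inj_on_def)
  qed
  obtain e \<Phi> where \<Phi>: "0 < e" "\<Phi> holomorphic_on ball 0 e" "\<Phi> 0 = 0" "deriv \<Phi> 0 = multiplier f n p"
    "\<And>z. z \<in> ball 0 e \<Longrightarrow> (f ^^ n) (loc z) = loc (\<Phi> z)"
    by (rule return_map_coord) blast
  have 0: "0 \<in> ball 0 e" using \<Phi>(1) by simp
  obtain r1 where r1: "r1 > 0" "ball 0 r1 \<subseteq> ball (0::complex) e" "inj_on \<Phi> (ball 0 r1)"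
    by (rule has_complex_derivative_locally_injective[OF \<Phi>(2) 0 open_ball mult[folded \<Phi>(4)]])
  have hol1: "\<Phi> holomorphic_on ball 0 r1" using holomorphic_on_subset[OF \<Phi>(2) r1(2)] .
  obtain g where g: "g holomorphic_on (\<Phi> ` ball 0 r1)"
      "\<And>z. z \<in> ball 0 r1 \<Longrightarrow> deriv \<Phi> z * deriv g (\<Phi> z) = 1" "\<And>z. z \<in> ball 0 r1 \<Longrightarrow> g (\<Phi> z) = z"
    using holomorphic_has_inverse[OF hol1 _ r1(3)] by auto
  have op: "open (\<Phi> ` ball 0 r1)" by (rule open_mapping_thm3[OF hol1 _ r1(3)]) simp
  have in0: "0 \<in> \<Phi> ` ball 0 r1" using \<Phi>(3) r1(1) by (metis centre_in_ball imageI)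
  have g0: "g 0 = 0" using g(3)[of 0] \<Phi>(3) r1(1) by simp
  have dg: "deriv g 0 = inverse (multiplier f n p)"
    using g(2)[of 0] \<Phi>(3,4) r1(1) by (simp add: inverse_unique)
  define \<gamma> where "\<gamma> z = g (of_real r * z) / of_real r" for z
  define A where "A = {z. of_real r * z \<in> \<Phi> ` ball 0 r1}"
  have A: "open A" "0 \<in> A"
  proof -
    have "open ((\<lambda>z. of_real r * z) -` (\<Phi> ` ball 0 r1))" by (intro open_vimage op continuous_intros)
    then show "open A" by (simp add: A_def vimage_def)
    show "0 \<in> A" using in0 by (simp add: A_def)
  qed
  have "g \<circ> (\<lambda>z. of_real r * z) holomorphic_on A"
    by (rule holomorphic_on_compose_gen[OF _ g(1)]) (auto intro!: holomorphic_intros simp: A_def)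
  then have \<gamma>A: "\<gamma> holomorphic_on A" unfolding \<gamma>_def
    using r by (intro holomorphic_intros) (auto simp: o_def)
  have \<gamma>0: "\<gamma> 0 = 0" by (simp add: \<gamma>_def g0)
  have d\<gamma>: "deriv \<gamma> 0 = inverse (multiplier f n p)"
  proof -
    have "(g has_field_derivative deriv g 0) (at 0)" by (rule holomorphic_derivI[OF g(1) op in0])
    then have 1: "(g has_field_derivative deriv g 0) (at (of_real r * 0))" by simp
    have 2: "((\<lambda>z. of_real r * z) has_field_derivative of_real r) (at (0::complex))"
      by (auto intro!: derivative_eq_intros)
    have "((\<lambda>z. g (of_real r * z)) has_field_derivative deriv g 0 * of_real r) (at 0)"
      by (rule DERIV_chain2[where f = g and g = "\<lambda>z. of_real r * z"]) (fact 1 2)+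
    then have "(\<gamma> has_field_derivative deriv g 0 * of_real r / of_real r) (at 0)"
      unfolding \<gamma>_def by (rule DERIV_cdivide)
    then show ?thesis using dg r by (simp add: DERIV_imp_deriv)
  qed
  have \<gamma>F: "(f ^^ n) (loc (of_real r * \<gamma> z)) = loc (of_real r * z)" if z: "z \<in> A" for z
  proof -
    obtain u where u: "u \<in> ball 0 r1" "of_real r * z = \<Phi> u" using z by (auto simp: A_def)
    then have "of_real r * \<gamma> z = u" using g(3) r by (simp add: \<gamma>_def)
    then show ?thesis using \<Phi>(5)[of u] u r1(2) by auto
  qed
  have "open (A \<inter> \<gamma> -` ball 0 (1 / 2))"
    using A(1) \<gamma>A by (intro continuous_open_preimage holomorphic_on_imp_continuous_on) auto
  moreover have "0 \<in> A \<inter> \<gamma> -` ball 0 (1 / 2)" using A(2) \<gamma>0 by simp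
  ultimately obtain \<delta>0 where \<delta>0: "0 < \<delta>0" "ball 0 \<delta>0 \<subseteq> A \<inter> \<gamma> -` ball 0 (1 / 2)"
    using open_contains_ball by metis
  define \<delta> where "\<delta> = min \<delta>0 (1 / 2)"
  have \<delta>: "0 < \<delta>" "\<delta> \<le> 1 / 2" "ball 0 \<delta> \<subseteq> A" "\<And>z. z \<in> ball 0 \<delta> \<Longrightarrow> \<gamma> z \<in> ball 0 (1 / 2)"
  proof -
    show "0 < \<delta>" "\<delta> \<le> 1 / 2" using \<delta>0(1) by (auto simp: \<delta>_def)
    have "ball 0 \<delta> \<subseteq> ball (0::complex) \<delta>0" by (auto simp: \<delta>_def)
    then show "ball 0 \<delta> \<subseteq> A" "\<And>z. z \<in> ball 0 \<delta> \<Longrightarrow> \<gamma> z \<in> ball 0 (1 / 2)" using \<delta>0(2) by blast+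
  qed
  have \<gamma>1: "\<gamma> z \<in> ball 0 1" if "z \<in> ball 0 \<delta>" for z using \<delta>(4)[OF that] by auto
  have \<delta>1: "ball 0 \<delta> \<subseteq> ball (0::complex) 1" using \<delta>(2) by auto
  have \<gamma>hol: "\<gamma> holomorphic_on ball 0 \<delta>" by (rule holomorphic_on_subset[OF \<gamma>A \<delta>(3)])
  have rec: "G (Suc k) z = G k (\<gamma> z)" if z: "z \<in> ball 0 \<delta>" for k z
  proof -
    define m where "m = k0 + k"
    \<comment> \<open>On \<open>W\<close> both sides of the recursion lie in the entry on which the
      iterate is injective, so they agree; analytic continuation carries this over to the whole
      disk.\<close>
    define W where "W = {z \<in> ball 0 \<delta>. \<psi> m (\<gamma> z) \<in> V (n * Suc m)}"
    have "sphere_holomorphic_on (\<lambda>z. \<psi> m (\<gamma> z)) (ball 0 \<delta>)"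
      by (rule sphere_holomorphic_compose[OF \<psi>D(1) _ \<gamma>hol]) (use \<gamma>1 in auto)
    then have W: "open W" unfolding W_def by (intro sphere_holomorphic_vimage plaqueD(2)[OF P]) auto
    have W0: "0 \<in> W" using \<delta>(1) \<gamma>0 \<psi>0[of m] xV[of "Suc m"] by (simp add: W_def del: mult_Suc_right)
    have "\<psi> (Suc m) w = \<psi> m (\<gamma> w)" if w: "w \<in> W" for w
    proof (rule inj_onD[OF injV[of "Suc m"]])
      have w\<delta>: "w \<in> ball 0 \<delta>" using w by (simp add: W_def)
      have "(f ^^ (n * Suc m)) (\<psi> m (\<gamma> w)) = (f ^^ n) ((f ^^ (n * m)) (\<psi> m (\<gamma> w)))"
        by (simp add: funpow_add)
      also have "\<dots> = loc (of_real r * w)" using \<psi>(2)[OF \<gamma>1[OF w\<delta>]] \<gamma>F[of w] w\<delta> \<delta>(3) by auto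
      also have "\<dots> = (f ^^ (n * Suc m)) (\<psi> (Suc m) w)" using \<psi>(2)[of w "Suc m"] w\<delta> \<delta>1 by auto
      finally show "(f ^^ (n * Suc m)) (\<psi> (Suc m) w) = (f ^^ (n * Suc m)) (\<psi> m (\<gamma> w))" by simp
      show "\<psi> (Suc m) w \<in> V (n * Suc m)" using \<psi>V w\<delta> \<delta>1 by blast
      show "\<psi> m (\<gamma> w) \<in> V (n * Suc m)" using w by (simp add: W_def)
    qed
    then have eqW: "G (Suc k) w = G k (\<gamma> w)" if "w \<in> W" for w
      using that by (simp add: G_def m_def)
    have Gg: "G k \<circ> \<gamma> holomorphic_on ball 0 \<delta>"
      by (rule holomorphic_on_compose_gen[OF \<gamma>hol Ghol]) (use \<gamma>1 in blast)
    have "G (Suc k) z = (G k \<circ> \<gamma>) z"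
    proof (rule analytic_continuation_open[where s = W and s' = "ball 0 \<delta>" and f = "G (Suc k)" and g = "G k \<circ> \<gamma>"])
      show "W \<noteq> {}" using W0 by blast
      show "W \<subseteq> ball 0 \<delta>" by (auto simp: W_def)
      show "G (Suc k) holomorphic_on ball 0 \<delta>" by (rule holomorphic_on_subset[OF Ghol \<delta>1])
      show "G (Suc k) w = (G k \<circ> \<gamma>) w" if "w \<in> W" for w using eqW[OF that] by simp
    qed (use z Gg W in auto)
    then show ?thesis by simp
  qed
  show ?thesis
  proof (rule that[of r \<delta> \<gamma> G "K + norm (recip a (x 0))"])
    show "(f ^^ n) (loc (of_real r * \<gamma> z)) = loc (of_real r * z)" if "z \<in> ball 0 \<delta>" for z
      using \<gamma>F \<delta>(3) that by blast
    show "G k 0 = 0" for k by (simp add: G_def \<psi>0)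
    show "deriv (G 0) 0 \<noteq> 0" by (rule holomorphic_injective_imp_regular[OF Ghol open_ball Ginj]) simp
  qed (fact r \<delta> \<gamma>hol \<gamma>0 d\<gamma> Ghol Gbd rec)+
qed

end

lemma deriv_compose_at:
  assumes "g holomorphic_on A" "open A" "h holomorphic_on B" "open B" "z \<in> B" "h z \<in> A"
    and "open C" "z \<in> C" "\<And>w. w \<in> C \<Longrightarrow> k w = g (h w)"
  shows "deriv k z = deriv g (h z) * deriv h z"
proof -
  have "(g has_field_derivative deriv g (h z)) (at (h z))" by (rule holomorphic_derivI[OF assms(1,2,6)])
  moreover have "(h has_field_derivative deriv h z) (at z)" by (rule holomorphic_derivI[OF assms(3-5)])
  ultimately have "((\<lambda>w. g (h w)) has_field_derivative deriv g (h z) * deriv h z) (at z)"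
    by (rule DERIV_chain2)
  then have "(k has_field_derivative deriv g (h z) * deriv h z) (at z)"
    by (rule has_field_derivative_transform_within_open[OF _ assms(7,8)]) (simp add: assms(9))
  then show ?thesis by (rule DERIV_imp_deriv)
qed

context covering_cycle
begin

lemma inverse_branch_deriv:
  assumes "\<gamma> holomorphic_on ball 0 \<delta>" "0 < \<delta>" "\<gamma> 0 = (0::complex)"
    and "\<And>k::nat. G k holomorphic_on ball 0 1" "\<And>k z. z \<in> ball 0 \<delta> \<Longrightarrow> G (Suc k) z = (G k (\<gamma> z) :: complex)"
  shows "deriv (G k) 0 = deriv \<gamma> 0 ^ k * deriv (G 0) 0"
proof (induction k)
  case (Suc k)
  have "deriv (G (Suc k)) 0 = deriv (G k) (\<gamma> 0) * deriv \<gamma> 0"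
    by (rule deriv_compose_at[OF assms(4) open_ball assms(1) open_ball _ _ open_ball[of 0 \<delta>]])
       (use assms(2,3,5) in auto)
  then show ?case using Suc assms(3) by simp
qed simp

text \<open>At the center the derivatives of the branches are a nonzero constant times the powers of
  the inverse multiplier, while Cauchy's estimate keeps them bounded.\<close>

lemma regular_norm_multiplier:
  assumes reg: "regular_point S f d x" shows "1 \<le> norm (multiplier f n p)"
proof (rule ccontr)
  assume "\<not> ?thesis"
  then have small: "norm (multiplier f n p) < 1" by simp
  obtain r \<delta> \<gamma> G K where G: "0 < \<delta>" "\<gamma> holomorphic_on ball 0 \<delta>" "\<gamma> 0 = 0"
    "deriv \<gamma> 0 = inverse (multiplier f n p)"
    "\<And>k::nat. G k holomorphic_on ball 0 1" "\<And>k z. norm z \<le> 1 / 2 \<Longrightarrow> norm (G k z) \<le> K"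
    "deriv (G 0) 0 \<noteq> 0" "\<And>k z. z \<in> ball 0 \<delta> \<Longrightarrow> G (Suc k) z = G k (\<gamma> z)"
    by (rule regular_inverse_branches[OF reg]) metis
  define R where "R = norm (inverse (multiplier f n p))"
  have "1 < R" using small regular_multiplier_nonzero[OF reg]
    by (simp add: R_def norm_inverse one_less_inverse_iff)
  have pos: "0 < norm (deriv (G 0) 0)" using G(7) by simp
  obtain k where "2 * K / norm (deriv (G 0) 0) < R ^ k" using real_arch_pow[OF \<open>1 < R\<close>] by blast
  then have "2 * K < R ^ k * norm (deriv (G 0) 0)" using pos by (simp add: pos_divide_less_eq)
  moreover have "deriv (G k) 0 = deriv \<gamma> 0 ^ k * deriv (G 0) 0"
    by (rule inverse_branch_deriv[where \<gamma> = \<gamma> and \<delta> = \<delta> and G = G]) (fact G)+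
  then have "R ^ k * norm (deriv (G 0) 0) = norm (deriv (G k) 0)"
    unfolding G(4) R_def by (simp add: norm_mult norm_power)
  moreover have "norm (deriv (G k) 0) \<le> 2 * K" by (rule deriv_bound_half_disk[OF G(5) G(6)])
  ultimately show False by simp
qed

lemma regular_neutral_linearizable:
  assumes reg: "regular_point S f d x" and neutral: "norm (multiplier f n p) = 1"
  shows "conjugate_to_rotation (f ^^ n) (multiplier f n p) (p 0)"
proof -
  define \<mu> where "\<mu> = multiplier f n p"
  have \<mu>1: "norm \<mu> = 1" and \<mu>0: "\<mu> \<noteq> 0" using neutral by (auto simp: \<mu>_def)
  obtain r \<delta> \<gamma> G K where r: "0 < r" and \<delta>: "0 < \<delta>" "\<delta> \<le> 1 / 2"
    and \<gamma>: "\<gamma> holomorphic_on ball 0 \<delta>" "\<gamma> 0 = 0" "deriv \<gamma> 0 = inverse \<mu>"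
    "\<And>z. z \<in> ball 0 \<delta> \<Longrightarrow> \<gamma> z \<in> ball 0 (1 / 2)"
    "\<And>z. z \<in> ball 0 \<delta> \<Longrightarrow> (f ^^ n) (loc (of_real r * \<gamma> z)) = loc (of_real r * z)"
    and G: "\<And>k::nat. G k holomorphic_on ball 0 1" "\<And>k z. norm z \<le> 1 / 2 \<Longrightarrow> norm (G k z) \<le> K"
    "\<And>k. G k 0 = 0" "deriv (G 0) 0 \<noteq> 0" "\<And>k z. z \<in> ball 0 \<delta> \<Longrightarrow> G (Suc k) z = G k (\<gamma> z)"
    unfolding \<mu>_def by (rule regular_inverse_branches[OF reg]) metis
  define C where "C = deriv (G 0) 0"
  have K0: "0 \<le> K" using order_trans[OF norm_ge_zero G(2)[of 0 0]] by simp
  \<comment> \<open>The weights cancel the factors \<open>\<mu>\<close> in the derivatives at 0, so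
    all averages have the same nonzero derivative \<open>C\<close> there and a limit cannot be
    constant.\<close>
  define h where "h m z = (\<Sum>k<Suc m. \<mu> ^ k * G k z) / of_nat (Suc m)" for m z
  have sub: "ball 0 (1/2) \<subseteq> ball (0::complex) 1" by auto
  have hhol: "h m holomorphic_on ball 0 (1/2)" for m
    unfolding h_def using holomorphic_on_subset[OF G(1) sub] by (intro holomorphic_intros) auto
  have hbd: "norm (h m z) \<le> K" if "norm z \<le> 1 / 2" for m z
  proof -
    have "norm (\<Sum>k<Suc m. \<mu> ^ k * G k z) \<le> (\<Sum>k<Suc m. K)"
      using G(2)[OF that] \<mu>1 by (intro sum_norm_le) (simp add: norm_mult norm_power)
    then have "norm (\<Sum>k<Suc m. \<mu> ^ k * G k z) \<le> real (Suc m) * K" by simp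
    then show ?thesis by (simp add: h_def norm_divide pos_divide_le_eq mult.commute del: of_nat_Suc)
  qed
  have dk: "deriv (G k) 0 = deriv \<gamma> 0 ^ k * deriv (G 0) 0" for k
    by (rule inverse_branch_deriv[where \<gamma> = \<gamma> and \<delta> = \<delta> and G = G]) (fact G \<gamma> \<delta>)+
  have hd: "deriv (h m) 0 = C" for m
  proof -
    have "(G k has_field_derivative deriv \<gamma> 0 ^ k * C) (at 0)" for k
    proof -
      have "(G k has_field_derivative deriv (G k) 0) (at 0)"
        by (rule holomorphic_derivI[OF G(1) open_ball]) simp
      then show ?thesis by (simp only: dk[of k] C_def)
    qed
    then have "(h m has_field_derivative (\<Sum>k<Suc m. \<mu> ^ k * (deriv \<gamma> 0 ^ k * C)) / of_nat (Suc m)) (at 0)"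
      unfolding h_def by (intro DERIV_cdivide DERIV_sum DERIV_cmult)
    moreover have "\<mu> ^ k * (deriv \<gamma> 0 ^ k * C) = C" for k
      using \<mu>0 by (simp add: \<gamma>(3) mult.assoc[symmetric] power_mult_distrib[symmetric])
    ultimately have "(h m has_field_derivative (\<Sum>k<Suc m. C) / of_nat (Suc m)) (at 0)" by simp
    then have "(h m has_field_derivative C) (at 0)" by (simp del: of_nat_Suc sum.lessThan_Suc)
    then show ?thesis by (rule DERIV_imp_deriv)
  qed
  obtain H q where H: "H holomorphic_on ball 0 (1/2)" "strict_mono (q :: nat \<Rightarrow> nat)"
    "\<And>z. z \<in> ball 0 (1/2) \<Longrightarrow> (\<lambda>m. h (q m) z) \<longlonglongrightarrow> H z"
    "\<And>K. compact K \<Longrightarrow> K \<subseteq> ball 0 (1/2) \<Longrightarrow> uniform_limit K (h \<circ> q) H sequentially"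
  proof (rule Montel[OF open_ball[of 0 "1/2"], of "range h" h])
    show "g holomorphic_on ball 0 (1/2)" if "g \<in> range h" for g using that hhol by auto
    show "\<exists>B. \<forall>g\<in>range h. \<forall>z\<in>L. norm (g z) \<le> B" if "compact L" "L \<subseteq> ball 0 (1/2)" for L
    proof (intro exI ballI)
      fix g z assume "g \<in> range h" "z \<in> L"
      then show "norm (g z) \<le> K" using hbd that(2) by fastforce
    qed
  qed auto
  have ul: "uniform_limit (ball 0 (1/4)) (\<lambda>m. h (q m)) H sequentially"
  proof -
    have "uniform_limit (cball 0 (1/4)) (h \<circ> q) H sequentially" by (rule H(4)) auto
    then have "uniform_limit (cball 0 (1/4)) (\<lambda>m. h (q m)) H sequentially" by (simp add: o_def)
    then show ?thesis by (rule uniform_limit_on_subset) auto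
  qed
  have "(\<lambda>m. (deriv ^^ 1) (h (q m)) 0) \<longlonglongrightarrow> (deriv ^^ 1) H 0"
    by (rule higher_deriv_complex_uniform_limit[OF ul])
       (auto intro!: always_eventually holomorphic_on_subset[OF hhol])
  then have HC: "deriv H 0 = C" using hd LIMSEQ_unique[OF _ tendsto_const] by simp
  have "h m 0 = 0" for m by (simp add: h_def G(3))
  then have H0: "H 0 = 0" using H(3)[of 0] LIMSEQ_unique[OF _ tendsto_const] by simp
  have func: "\<mu> * H (\<gamma> z) = H z" if z: "z \<in> ball 0 \<delta>" for z
  proof -
    have zz: "z \<in> ball 0 (1/2)" "norm z \<le> 1/2" using z \<delta>(2) by auto
    define a where "a k = \<mu> ^ k * G k z" for k
    \<comment> \<open>Composing with \<open>\<gamma>\<close> and multiplying by \<open>\<mu>\<close>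
      shifts the sum by one term. Only the two end terms remain, and dividing by the number of terms
      makes them vanish in the limit.\<close>
    have tele: "\<mu> * h m (\<gamma> z) = h m z + (a (Suc m) - a 0) / of_nat (Suc m)" for m
    proof -
      have "\<mu> * (\<Sum>k<Suc m. \<mu> ^ k * G k (\<gamma> z)) = (\<Sum>k<Suc m. a (Suc k))"
        unfolding sum_distrib_left a_def using G(5)[OF z] by (intro sum.cong) auto
      also have "\<dots> = (\<Sum>k<Suc m. a k) + (a (Suc m) - a 0)"
        by (simp add: sum.lessThan_Suc_shift[of a] sum.lessThan_Suc[of "\<lambda>k. a (Suc k)"] del: sum.lessThan_Suc)
      finally show ?thesis by (simp add: h_def a_def add_divide_distrib[symmetric] del: sum.lessThan_Suc)
    qed
    have "(\<lambda>m. (a (Suc (q m)) - a 0) / of_nat (Suc (q m))) \<longlonglongrightarrow> 0"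
    proof (rule Lim_null_comparison)
      have bd: "norm (a k) \<le> K" for k using G(2)[OF zz(2)] \<mu>1 by (simp add: a_def norm_mult norm_power)
      have "norm ((a (Suc (q m)) - a 0) / of_nat (Suc (q m))) \<le> 2 * K / real (Suc m)" for m
      proof -
        have "norm (a (Suc (q m)) - a 0) \<le> 2 * K"
          using norm_triangle_ineq4[of "a (Suc (q m))" "a 0"] bd[of "Suc (q m)"] bd[of 0] by linarith
        moreover have "m \<le> q m" using H(2) by (rule strict_mono_imp_increasing)
        ultimately show ?thesis unfolding norm_divide norm_of_nat
          using K0 by (intro frac_le) auto
      qed
      then show "\<forall>\<^sub>F m in sequentially. norm ((a (Suc (q m)) - a 0) / of_nat (Suc (q m))) \<le> 2 * K / real (Suc m)"
        by (intro always_eventually allI)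
      show "(\<lambda>m. 2 * K / real (Suc m)) \<longlonglongrightarrow> 0"
        using LIMSEQ_inverse_real_of_nat[THEN tendsto_mult_left, of "2 * K"]
        by (simp add: divide_inverse)
    qed
    from tendsto_add[OF H(3)[OF zz(1)] this]
    have "(\<lambda>m. \<mu> * h (q m) (\<gamma> z)) \<longlonglongrightarrow> H z + 0" unfolding tele .
    moreover have "(\<lambda>m. \<mu> * h (q m) (\<gamma> z)) \<longlonglongrightarrow> \<mu> * H (\<gamma> z)"
      by (intro tendsto_mult tendsto_const H(3) \<gamma>(4) z)
    ultimately show ?thesis using LIMSEQ_unique by fastforce
  qed
  have half: "ball 0 \<delta> \<subseteq> ball (0::complex) (1/2)" using \<delta>(2) by auto
  have H\<delta>: "H holomorphic_on ball 0 \<delta>" by (rule holomorphic_on_subset[OF H(1) half])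
  have 0: "0 \<in> ball (0::complex) \<delta>" using \<delta>(1) by simp
  have HC0: "deriv H 0 \<noteq> 0" using HC G(4) by (simp add: C_def)
  obtain \<epsilon> where \<epsilon>: "0 < \<epsilon>" "ball 0 \<epsilon> \<subseteq> ball (0::complex) \<delta>" "inj_on H (ball 0 \<epsilon>)"
    by (rule has_complex_derivative_locally_injective[OF H\<delta> 0 open_ball HC0])
  have H\<epsilon>: "H holomorphic_on ball 0 \<epsilon>" by (rule holomorphic_on_subset[OF H\<delta> \<epsilon>(2)])
  obtain L where L: "L holomorphic_on (H ` ball 0 \<epsilon>)" "\<And>z. z \<in> ball 0 \<epsilon> \<Longrightarrow> L (H z) = z"
    using holomorphic_has_inverse[OF H\<epsilon> open_ball \<epsilon>(3)] by metis
  have op: "open (H ` ball 0 \<epsilon>)" by (rule open_mapping_thm3[OF H\<epsilon> open_ball \<epsilon>(3)])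
  have in0: "0 \<in> H ` ball 0 \<epsilon>" using H0 \<epsilon>(1) by (metis centre_in_ball imageI)
  have L0: "L 0 = 0" using L(2)[of 0] H0 \<epsilon>(1) by simp
  have op1: "open (ball 0 \<epsilon> \<inter> \<gamma> -` ball 0 \<epsilon>)"
    by (intro continuous_open_preimage holomorphic_on_imp_continuous_on
        holomorphic_on_subset[OF \<gamma>(1) \<epsilon>(2)] open_ball)
  have op2: "open (H ` ball 0 \<epsilon> \<inter> L -` (ball 0 \<epsilon> \<inter> \<gamma> -` ball 0 \<epsilon>))"
    by (rule continuous_open_preimage[OF holomorphic_on_imp_continuous_on[OF L(1)] op op1])
  have "0 \<in> H ` ball 0 \<epsilon> \<inter> L -` (ball 0 \<epsilon> \<inter> \<gamma> -` ball 0 \<epsilon>)"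
    using in0 L0 \<epsilon>(1) \<gamma>(2) by simp
  then obtain \<rho> where \<rho>: "0 < \<rho>" "ball 0 \<rho> \<subseteq> H ` ball 0 \<epsilon> \<inter> L -` (ball 0 \<epsilon> \<inter> \<gamma> -` ball 0 \<epsilon>)"
    using op2 open_contains_ball by metis
  have HL: "H (L w) = w" "L w \<in> ball 0 \<epsilon>" "\<gamma> (L w) \<in> ball 0 \<epsilon>" if w: "w \<in> ball 0 \<rho>" for w
  proof -
    obtain u where u: "u \<in> ball 0 \<epsilon>" "w = H u" using w \<rho>(2) by blast
    then show "H (L w) = w" using L(2) by simp
    show "L w \<in> ball 0 \<epsilon>" "\<gamma> (L w) \<in> ball 0 \<epsilon>" using w \<rho>(2) by blast+
  qed
  show ?thesis unfolding conjugate_to_rotation_def \<mu>_def[symmetric]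
  proof (intro exI conjI ballI)
    define k where "k w = loc (of_real r * L w)" for w
    show "0 < \<rho>" by (rule \<rho>(1))
    have "L holomorphic_on ball 0 \<rho>" by (rule holomorphic_on_subset[OF L(1)]) (use \<rho>(2) in blast)
    then show "sphere_holomorphic_on k (ball 0 \<rho>)"
      unfolding k_def by (intro sphere_holomorphic_loc holomorphic_intros) auto
    show "inj_on k (ball 0 \<rho>)"
    proof (rule inj_onI)
      fix z w assume zw: "z \<in> ball 0 \<rho>" "w \<in> ball 0 \<rho>" "k z = k w"
      have "L z = L w" using zw(3) r by (simp add: k_def)
      then show "z = w" using HL(1)[OF zw(1)] HL(1)[OF zw(2)] by metis
    qed
    show "k 0 = p 0" using L0 p_eq_x[of 0] n_pos by (simp add: k_def)
    fix w :: complex assume w: "w \<in> ball 0 \<rho>"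
    then have w': "\<mu> * w \<in> ball 0 \<rho>" using \<mu>1 by (simp add: norm_mult)
    \<comment> \<open>\<open>func\<close> at this point says that \<open>\<gamma> u\<close> and
      \<open>L w\<close> have the same image under \<open>H\<close>. So \<open>\<gamma>\<close>
      takes \<open>L (\<mu> * w)\<close> to \<open>L w\<close>, and the return map takes it
      back.\<close>
    define u where "u = L (\<mu> * w)"
    have u: "u \<in> ball 0 \<delta>" "\<gamma> u \<in> ball 0 \<epsilon>" "H u = \<mu> * w" using HL[OF w'] \<epsilon>(2) by (auto simp: u_def)
    have "\<mu> * H (\<gamma> u) = \<mu> * w" using func[OF u(1)] u(3) by simp
    then have "H (\<gamma> u) = H (L w)" using \<mu>0 HL(1)[OF w] by simp
    then have "\<gamma> u = L w" using inj_onD[OF \<epsilon>(3)] u(2) HL(2)[OF w] by blast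
    then show "(f ^^ n) (k w) = k (\<mu> * w)" using \<gamma>(5)[OF u(1)] by (simp add: k_def u_def)
  qed
qed

lemma irregular_if_cremer: "cremer f n p \<Longrightarrow> \<not> regular_point S f d x"
  using regular_neutral_linearizable n_pos unfolding cremer_def neutral_with_angle_def
  by (metis less_le_trans zero_less_one)

lemma irregular_if_attracting: "norm (multiplier f n p) < 1 \<Longrightarrow> \<not> regular_point S f d x"
  using regular_norm_multiplier by fastforce

end

subsection \<open>Attracting petals\<close>

text \<open>An error of at most \<open>1 / 8\<close> makes the real part grow by at least
  \<open>1 / 2\<close> per step. Cauchy's estimate bounds each factor of the derivative in terms of
  the distance to the boundary line, and the product along the orbit grows no faster than a square
  root.\<close>

lemma petal_orbit:
  assumes hol: "Ft holomorphic_on {\<zeta>. R < Re \<zeta>}"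
    and bd: "\<And>\<zeta>. R < Re \<zeta> \<Longrightarrow> norm (Ft \<zeta> - \<zeta> - 1) \<le> 1 / 8"
  shows "R < Re \<zeta> \<Longrightarrow> Re \<zeta> + real k / 2 \<le> Re ((Ft ^^ k) \<zeta>)"
    and "(Ft ^^ k) holomorphic_on {\<zeta>. R < Re \<zeta>}"
    and "R + 1 \<le> Re \<zeta> \<Longrightarrow> norm (deriv (Ft ^^ k) \<zeta>) \<le> sqrt (real (Suc k))"
proof -
  have op: "open {\<zeta>. R < Re \<zeta>}" by (rule open_halfspace_Re_gt)
  have step: "Re \<zeta> + 1 / 2 \<le> Re (Ft \<zeta>)" if "R < Re \<zeta>" for \<zeta>
  proof -
    have "\<bar>Re (Ft \<zeta> - \<zeta> - 1)\<bar> \<le> 1 / 8" using abs_Re_le_cmod bd[OF that] order_trans by blast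
    then have "\<bar>Re (Ft \<zeta>) - Re \<zeta> - 1\<bar> \<le> 1 / 8" unfolding minus_complex.sel one_complex.sel .
    then show ?thesis by linarith
  qed
  have orb: "Re \<zeta> + real k / 2 \<le> Re ((Ft ^^ k) \<zeta>)" if \<zeta>: "R < Re \<zeta>" for k \<zeta>
  proof (induction k)
    case (Suc k)
    have "R < Re ((Ft ^^ k) \<zeta>)" using Suc \<zeta> of_nat_0_le_iff[of k] by linarith
    from step[OF this] show ?case using Suc by (simp add: add_divide_distrib)
  qed simp
  then show "R < Re \<zeta> \<Longrightarrow> Re \<zeta> + real k / 2 \<le> Re ((Ft ^^ k) \<zeta>)" by blast
  have into: "(Ft ^^ k) \<zeta> \<in> {\<zeta>. R < Re \<zeta>}" if "R < Re \<zeta>" for k \<zeta>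
    using orb[OF that, of k] that of_nat_0_le_iff[of k] by simp
  have hk: "(Ft ^^ k) holomorphic_on {\<zeta>. R < Re \<zeta>}" for k
  proof (induction k)
    case (Suc k)
    have "Ft \<circ> (Ft ^^ k) holomorphic_on {\<zeta>. R < Re \<zeta>}"
      by (rule holomorphic_on_compose_gen[OF Suc hol]) (use into in blast)
    then show ?case by (simp add: o_def)
  qed (simp add: id_def)
  then show "(Ft ^^ k) holomorphic_on {\<zeta>. R < Re \<zeta>}" .
  have dF: "norm (deriv Ft \<eta>) \<le> 1 + 1 / (4 * (Re \<eta> - R))" if \<eta>: "R < Re \<eta>" for \<eta>
  proof -
    define u where "u \<zeta> = Ft \<zeta> - \<zeta> - 1" for \<zeta>
    \<comment> \<open>Half the distance to the boundary line: the disk stays in the half-plane, and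
      \<open>(1 / 8) / \<rho>\<close> is the claimed
      \<open>1 / (4 * (Re \<eta> - R))\<close>.\<close>
    define \<rho> where "\<rho> = (Re \<eta> - R) / 2"
    have \<rho>: "0 < \<rho>" using \<eta> by (simp add: \<rho>_def)
    have cb: "cball \<eta> \<rho> \<subseteq> {\<zeta>. R < Re \<zeta>}"
    proof
      fix z assume "z \<in> cball \<eta> \<rho>"
      then have "\<bar>Re (\<eta> - z)\<bar> \<le> \<rho>" using abs_Re_le_cmod[of "\<eta> - z"] by (simp add: dist_norm)
      then have "Re \<eta> - Re z \<le> (Re \<eta> - R) / 2" unfolding \<rho>_def minus_complex.sel by linarith
      then show "z \<in> {\<zeta>. R < Re \<zeta>}" using \<eta> unfolding mem_Collect_eq by argo
    qed
    have uh: "u holomorphic_on {\<zeta>. R < Re \<zeta>}" unfolding u_def by (intro holomorphic_intros hol)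
    have "norm ((deriv ^^ 1) u \<eta>) \<le> fact 1 * (1 / 8) / \<rho> ^ 1"
    proof (rule Cauchy_inequality)
      show "u holomorphic_on ball \<eta> \<rho>"
        by (rule holomorphic_on_subset[OF uh]) (use cb ball_subset_cball in blast)
      show "continuous_on (cball \<eta> \<rho>) u"
        by (rule holomorphic_on_imp_continuous_on[OF holomorphic_on_subset[OF uh cb]])
      show "norm (u z) \<le> 1 / 8" if "norm (\<eta> - z) = \<rho>" for z
        using bd[of z] cb that by (auto simp: u_def dist_norm)
    qed (rule \<rho>)
    then have du: "norm (deriv u \<eta>) \<le> 1 / (4 * (Re \<eta> - R))" using \<eta> by (simp add: \<rho>_def divide_simps)
    have "(Ft has_field_derivative deriv Ft \<eta>) (at \<eta>)"
      by (rule holomorphic_derivI[OF hol op]) (use \<eta> in simp)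
    then have "(u has_field_derivative deriv Ft \<eta> - 1 - 0) (at \<eta>)"
      unfolding u_def by (intro DERIV_diff DERIV_ident DERIV_const)
    then have "deriv Ft \<eta> = 1 + deriv u \<eta>" by (simp add: DERIV_imp_deriv)
    then show ?thesis using du norm_triangle_ineq[of 1 "deriv u \<eta>"] by simp
  qed
  show "norm (deriv (Ft ^^ k) \<zeta>) \<le> sqrt (real (Suc k))" if \<zeta>: "R + 1 \<le> Re \<zeta>"
  proof (induction k)
    case (Suc k)
    define \<eta> where "\<eta> = (Ft ^^ k) \<zeta>"
    \<comment> \<open>The new factor is at most \<open>1 + 1 / (2 * t)\<close>, and its square times
      \<open>t - 1\<close> is at most \<open>t\<close>.\<close>
    define t where "t = real k + 2"
    have R: "R < Re \<zeta>" using \<zeta> by simp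
    have "R + 1 + real k / 2 \<le> Re \<eta>" using orb[OF R, of k] \<zeta> by (simp add: \<eta>_def)
    then have \<eta>: "t / 2 \<le> Re \<eta> - R" "R < Re \<eta>" using of_nat_0_le_iff[of k] by (auto simp: t_def)
    have t: "0 < t" "1 \<le> t" by (auto simp: t_def)
    have "1 / (4 * (Re \<eta> - R)) \<le> 1 / (2 * t)" using \<eta> t by (intro divide_left_mono) auto
    then have d1: "norm (deriv Ft \<eta>) \<le> 1 + 1 / (2 * t)" using dF[OF \<eta>(2)] by linarith
    have "deriv (Ft ^^ Suc k) \<zeta> = deriv Ft ((Ft ^^ k) \<zeta>) * deriv (Ft ^^ k) \<zeta>"
      by (rule deriv_compose_at[OF hol op hk op _ _ open_UNIV UNIV_I]) (use R into[OF R, of k] in auto)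
    then have "norm (deriv (Ft ^^ Suc k) \<zeta>) = norm (deriv Ft \<eta>) * norm (deriv (Ft ^^ k) \<zeta>)"
      by (simp add: \<eta>_def norm_mult)
    also have "\<dots> \<le> (1 + 1 / (2 * t)) * sqrt (real (Suc k))"
      using t by (intro mult_mono d1 Suc) auto
    also have "\<dots> \<le> sqrt (real (Suc (Suc k)))"
    proof (rule real_le_rsqrt)
      have "((1 + 1 / (2 * t)) * sqrt (real (Suc k)))\<^sup>2 = (1 + 1 / (2 * t))\<^sup>2 * (t - 1)"
        by (simp add: power_mult_distrib t_def)
      also have "\<dots> = t - 3 / (4 * t) - 1 / (4 * t\<^sup>2)"
        using t by (simp add: field_simps power2_eq_square power3_eq_cube)
      also have "\<dots> \<le> t"
      proof -
        have "0 \<le> 3 / (4 * t)" "0 \<le> 1 / (4 * t\<^sup>2)" using t by simp_all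
        then show ?thesis by linarith
      qed
      finally show "((1 + 1 / (2 * t)) * sqrt (real (Suc k)))\<^sup>2 \<le> real (Suc (Suc k))" by (simp add: t_def)
    qed
    finally show ?case .
  qed (simp add: id_def)
qed

text \<open>
  For \<open>\<Psi> z = z + a z\<^sup>k\<^sup>+\<^sup>1 + \<dots>\<close> the coordinate \<open>\<zeta> = \<beta>\<^sup>k / z\<^sup>k\<close> with \<open>\<beta>\<^sup>k = - 1 / (k a)\<close> turns \<open>\<Psi>\<close>
  into \<open>\<zeta> + 1 + o(1)\<close> on a right half-plane.
\<close>

lemma parabolic_petal:
  assumes \<Psi>: "\<Psi> holomorphic_on ball 0 e" "0 < e" "\<Psi> 0 = 0" "deriv \<Psi> 0 = 1"
    and nid: "\<not> (\<forall>z\<in>ball 0 e. \<Psi> z = z)"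
  obtains R E Ft where "0 < R" "E holomorphic_on {\<zeta>. 0 < Re \<zeta>}" "inj_on E {\<zeta>. 0 < Re \<zeta>}"
    "\<And>\<zeta>. 0 < Re \<zeta> \<Longrightarrow> E \<zeta> \<noteq> 0"
    "\<And>\<epsilon>. 0 < \<epsilon> \<Longrightarrow> \<exists>R>0. \<forall>\<zeta>. R < Re \<zeta> \<longrightarrow> norm (E \<zeta>) < \<epsilon>"
    "Ft holomorphic_on {\<zeta>. R < Re \<zeta>}"
    "\<And>\<zeta>. R < Re \<zeta> \<Longrightarrow> E \<zeta> \<in> ball 0 e \<and> \<Psi> (E \<zeta>) = E (Ft \<zeta>) \<and> norm (Ft \<zeta> - \<zeta> - 1) \<le> 1 / 8"
proof -
  define g where "g z = \<Psi> z - z" for z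
  have ghol: "g holomorphic_on ball 0 e" unfolding g_def by (intro holomorphic_intros \<Psi>(1))
  have g0: "g 0 = 0" using \<Psi>(3) by (simp add: g_def)
  have 0: "0 \<in> ball 0 e" using \<Psi>(2) by simp
  have "\<not> g constant_on ball 0 e"
  proof
    assume "g constant_on ball 0 e"
    then have "g z = g 0" if "z \<in> ball 0 e" for z using that 0 unfolding constant_on_def by metis
    then show False using nid g0 by (simp add: g_def)
  qed
  then obtain h r m where h: "0 < m" "0 < r" "ball 0 r \<subseteq> ball (0::complex) e" "h holomorphic_on ball 0 r"
      "\<And>w. w \<in> ball 0 r \<Longrightarrow> g w = (w - 0) ^ m * h w" "\<And>w. w \<in> ball 0 r \<Longrightarrow> h w \<noteq> 0"
    using holomorphic_factor_zero_nonconstant[OF ghol open_ball connected_ball 0 g0] by metis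
  have r0: "0 \<in> ball (0::complex) r" using h(2) by simp
  define a where "a = h 0"
  have a: "a \<noteq> 0" using h(6)[OF r0] by (simp add: a_def)
  have hc: "h \<midarrow>0\<rightarrow> a"
    using holomorphic_on_imp_continuous_on[OF h(4)] r0 unfolding a_def
    by (metis continuous_on_eq_continuous_at isCont_def open_ball)
  \<comment> \<open>Derivative 1 makes \<open>g\<close> vanish to order at least 2, which leaves a
    positive exponent \<open>k\<close> for the coordinate.\<close>
  have "m \<noteq> 1"
  proof
    assume m1: "m = 1"
    have "(\<Psi> has_field_derivative 1) (at 0)"
      using holomorphic_derivI[OF \<Psi>(1) open_ball 0] \<Psi>(4) by simp
    then have "(g has_field_derivative 1 - 1) (at 0)" unfolding g_def by (intro DERIV_diff DERIV_ident)
    moreover have "((\<lambda>w. w * h w) has_field_derivative 0 * deriv h 0 + 1 * h 0) (at 0)"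
      using DERIV_mult[OF DERIV_ident holomorphic_derivI[OF h(4) open_ball r0]] by (simp add: algebra_simps)
    then have "(g has_field_derivative 0 * deriv h 0 + 1 * h 0) (at 0)"
      by (rule has_field_derivative_transform_within_open[OF _ open_ball r0]) (use h(5) m1 in simp)
    ultimately have "1 - 1 = 0 * deriv h 0 + 1 * h 0" by (rule DERIV_unique)
    then show False using a by (simp add: a_def)
  qed
  then obtain k where k: "m = Suc k" "1 \<le> k" using h(1) by (cases m) auto
  define w where "w z = z ^ k * h z" for z
  have \<Psi>w: "\<Psi> z = z * (1 + w z)" if "z \<in> ball 0 r" for z
    using h(5)[OF that] k(1) by (simp add: g_def w_def algebra_simps)
  \<comment> \<open>This normalizes the translation: \<open>\<zeta> * w (E \<zeta>)\<close> tends to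
    \<open>\<beta> ^ k * a = - 1 / k\<close>, so that \<open>\<zeta>\<close> times the
    \<open>- k\<close>-th power of \<open>1 + w\<close> is about \<open>\<zeta> + 1\<close>.\<close>
  obtain \<beta> where \<beta>: "\<beta> ^ k = - 1 / (of_nat k * a)" using complex_root_exists[OF k(2)] by blast
  have \<beta>0: "\<beta> \<noteq> 0" using \<beta> a k(2) by (auto simp: power_0_left)
  have wlim: "w \<midarrow>0\<rightarrow> 0"
  proof -
    have "w \<midarrow>0\<rightarrow> 0 ^ k * a" unfolding w_def by (intro tendsto_intros hc)
    then show ?thesis using k(2) by (simp add: power_0_left)
  qed
  define Q where "Q v = exp (- of_nat k * Ln (1 + v))" for v :: complex
  have Q: "(\<lambda>v. (Q v - 1) / v) \<midarrow>0\<rightarrow> - of_nat k"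
  proof -
    have "(Q has_field_derivative - of_nat k) (at 0)"
      unfolding Q_def by (auto intro!: derivative_eq_intros simp: complex_nonpos_Reals_iff)
    then show ?thesis by (simp add: DERIV_def Q_def)
  qed
  \<comment> \<open>The error term \<open>Ft \<zeta> - \<zeta> - 1\<close>, written in the original
    coordinate \<open>z = E \<zeta>\<close>.\<close>
  define D where "D z = \<beta> ^ k * h z * ((Q (w z) - 1) / w z) - 1" for z
  have wnz: "w z \<noteq> 0" if "z \<in> ball 0 r" "z \<noteq> 0" for z using h(6)[OF that(1)] that(2) by (simp add: w_def)
  have "\<forall>\<^sub>F z in at 0. w z \<noteq> 0"
    unfolding eventually_at using h(2) wnz by (intro exI[of _ r]) (auto simp: dist_norm)
  then have "filterlim w (at 0) (at 0)" using wlim by (simp add: filterlim_at)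
  from filterlim_compose[OF Q this] have "(\<lambda>z. (Q (w z) - 1) / w z) \<midarrow>0\<rightarrow> - of_nat k" .
  then have "D \<midarrow>0\<rightarrow> \<beta> ^ k * a * (- of_nat k) - 1" unfolding D_def by (intro tendsto_intros hc)
  moreover have "\<beta> ^ k * a * (- of_nat k) - 1 = 0" using \<beta> a k(2) by simp
  ultimately have "D \<midarrow>0\<rightarrow> 0" by simp
  then have ev1: "\<forall>\<^sub>F z in at 0. norm (D z) < 1 / 8"
    using tendsto_norm_zero order_tendstoD(2) by (metis zero_less_divide_1_iff zero_less_numeral)
  have ev2: "\<forall>\<^sub>F z in at 0. norm (w z) < 1"
    using tendsto_norm_zero[OF wlim] order_tendstoD(2) zero_less_one by blast
  have "(\<lambda>z. of_nat k * Ln (1 + w z)) \<midarrow>0\<rightarrow> of_nat k * Ln (1 + 0)"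
    by (intro tendsto_intros wlim) (auto simp: complex_nonpos_Reals_iff)
  then have "(\<lambda>z. of_nat k * Ln (1 + w z)) \<midarrow>0\<rightarrow> 0" by simp
  \<comment> \<open>With the imaginary part of \<open>Ln \<zeta>\<close> below \<open>pi / 2\<close>
    in the half-plane, this keeps the sum of logarithms in the principal strip, so
    \<open>Ln (Ft \<zeta>)\<close> splits.\<close>
  then have ev3: "\<forall>\<^sub>F z in at 0. norm (of_nat k * Ln (1 + w z)) < pi / 2"
    using tendsto_norm_zero order_tendstoD(2) pi_half_gt_zero by blast
  have ev4: "\<forall>\<^sub>F z in at 0. z \<in> ball (0::complex) r"
    unfolding eventually_at using h(2) by (intro exI[of _ r]) (auto simp: dist_norm)
  from ev1 ev2 ev3 ev4 have "\<forall>\<^sub>F z in at 0. norm (D z) < 1 / 8 \<and> norm (w z) < 1 \<and>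
      norm (of_nat k * Ln (1 + w z)) < pi / 2 \<and> z \<in> ball 0 r"
    by eventually_elim simp
  then obtain s where s: "0 < s" "\<And>z. z \<noteq> 0 \<Longrightarrow> norm z < s \<Longrightarrow> norm (D z) < 1 / 8 \<and> norm (w z) < 1 \<and>
      norm (of_nat k * Ln (1 + w z)) < pi / 2 \<and> z \<in> ball 0 r"
    unfolding eventually_at by (auto simp: dist_norm)
  define E where "E \<zeta> = \<beta> * exp (- Ln \<zeta> / of_nat k)" for \<zeta>
  have notneg: "\<zeta> \<notin> \<real>\<^sub>\<le>\<^sub>0" if "0 < Re \<zeta>" for \<zeta> using that by (auto simp: complex_nonpos_Reals_iff)
  have Ehol: "E holomorphic_on {\<zeta>. 0 < Re \<zeta>}"
    unfolding E_def using notneg k(2) by (intro holomorphic_intros) auto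
  have Ek: "E \<zeta> ^ k = \<beta> ^ k / \<zeta>" if "0 < Re \<zeta>" for \<zeta>
  proof -
    have "exp (- Ln \<zeta> / of_nat k) ^ k = exp (- Ln \<zeta>)" using k(2) by (simp add: exp_of_nat_mult[symmetric])
    moreover have "\<zeta> \<noteq> 0" using that by auto
    then have "exp (- Ln \<zeta>) = inverse \<zeta>" by (simp add: exp_minus)
    ultimately show ?thesis by (simp add: E_def power_mult_distrib divide_inverse)
  qed
  have Einj: "inj_on E {\<zeta>. 0 < Re \<zeta>}"
  proof (rule inj_onI)
    fix z z' assume z: "z \<in> {\<zeta>. 0 < Re \<zeta>}" "z' \<in> {\<zeta>. 0 < Re \<zeta>}" "E z = E z'"
    then have "\<beta> ^ k / z = \<beta> ^ k / z'" using Ek by (metis mem_Collect_eq)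
    then show "z = z'" using \<beta>0 by (simp add: divide_inverse)
  qed
  have Enz: "E \<zeta> \<noteq> 0" for \<zeta> using \<beta>0 by (simp add: E_def)
  have Esmall: "\<exists>R>0. \<forall>\<zeta>. R < Re \<zeta> \<longrightarrow> norm (E \<zeta>) < \<epsilon>" if \<epsilon>: "0 < \<epsilon>" for \<epsilon>
  proof -
    define R where "R = norm \<beta> ^ k / \<epsilon> ^ k"
    have "norm (E \<zeta>) < \<epsilon>" if R: "R < Re \<zeta>" "0 < Re \<zeta>" for \<zeta>
    proof (rule power_less_imp_less_base)
      have n: "R < norm \<zeta>" using R complex_Re_le_cmod[of \<zeta>] by linarith
      have "norm (E \<zeta>) ^ k = norm \<beta> ^ k / norm \<zeta>"
        using Ek[OF R(2)] by (metis norm_divide norm_power)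
      also have "\<dots> < \<epsilon> ^ k"
      proof -
        have "0 < norm \<zeta>" using R(2) by auto
        moreover have "norm \<beta> ^ k < \<epsilon> ^ k * norm \<zeta>"
          using n \<epsilon> by (simp add: R_def pos_divide_less_eq mult.commute)
        ultimately show ?thesis by (simp add: pos_divide_less_eq)
      qed
      finally show "norm (E \<zeta>) ^ k < \<epsilon> ^ k" .
    qed (use \<epsilon> in simp)
    moreover have "0 < R" using \<beta>0 \<epsilon> by (simp add: R_def)
    ultimately show ?thesis by (meson less_trans)
  qed
  obtain R where R: "0 < R" "\<And>\<zeta>. R < Re \<zeta> \<Longrightarrow> norm (E \<zeta>) < s" using Esmall[OF s(1)] by blast
  define Ft where "Ft \<zeta> = \<zeta> * exp (- of_nat k * Ln (1 + w (E \<zeta>)))" for \<zeta>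
  have sE: "norm (D (E \<zeta>)) < 1 / 8" "norm (w (E \<zeta>)) < 1" "norm (of_nat k * Ln (1 + w (E \<zeta>))) < pi / 2"
      "E \<zeta> \<in> ball 0 r" if "R < Re \<zeta>" for \<zeta>
    using s(2)[OF Enz R(2)[OF that]] by auto
  have lt1: "1 + v \<notin> \<real>\<^sub>\<le>\<^sub>0" "1 + v \<noteq> 0" if "norm v < 1" for v :: complex
  proof -
    have "\<bar>Re v\<bar> < 1" using abs_Re_le_cmod[of v] that by linarith
    then show "1 + v \<notin> \<real>\<^sub>\<le>\<^sub>0" "1 + v \<noteq> 0" by (auto simp: complex_nonpos_Reals_iff complex_eq_iff)
  qed
  have sub: "{\<zeta>. R < Re \<zeta>} \<subseteq> {\<zeta>. 0 < Re \<zeta>}" using R(1) by auto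
  show ?thesis
  proof (rule that[of R E Ft])
    show "0 < R" "E holomorphic_on {\<zeta>. 0 < Re \<zeta>}" "inj_on E {\<zeta>. 0 < Re \<zeta>}" by (fact R Ehol Einj)+
    show "E \<zeta> \<noteq> 0" for \<zeta> by (rule Enz)
    show "\<exists>R>0. \<forall>\<zeta>. R < Re \<zeta> \<longrightarrow> norm (E \<zeta>) < \<epsilon>" if "0 < \<epsilon>" for \<epsilon> by (rule Esmall[OF that])
    have whol: "w holomorphic_on ball 0 r" unfolding w_def by (intro holomorphic_intros h(4))
    have "w \<circ> E holomorphic_on {\<zeta>. R < Re \<zeta>}"
      by (rule holomorphic_on_compose_gen[OF holomorphic_on_subset[OF Ehol sub] whol]) (use sE(4) in blast)
    then have "(\<lambda>\<zeta>. w (E \<zeta>)) holomorphic_on {\<zeta>. R < Re \<zeta>}" by (simp add: o_def)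
    then show "Ft holomorphic_on {\<zeta>. R < Re \<zeta>}"
      unfolding Ft_def using lt1(1)[OF sE(2)] by (intro holomorphic_intros) auto
    fix \<zeta> assume \<zeta>: "R < Re \<zeta>"
    then have \<zeta>0: "0 < Re \<zeta>" "\<zeta> \<noteq> 0" using R(1) by auto
    define v where "v = w (E \<zeta>)"
    have v: "v \<noteq> 0" "norm v < 1" using wnz[OF sE(4)[OF \<zeta>] Enz] sE(2)[OF \<zeta>] by (auto simp: v_def)
    have "Ft \<zeta> = exp (Ln \<zeta> - of_nat k * Ln (1 + v))"
      using \<zeta>0(2) by (simp add: Ft_def v_def exp_diff exp_minus divide_inverse)
    moreover have "Ln (exp (Ln \<zeta> - of_nat k * Ln (1 + v))) = Ln \<zeta> - of_nat k * Ln (1 + v)"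
    proof (rule Ln_exp)
      have "\<bar>Im (Ln \<zeta>)\<bar> < pi / 2" using Re_Ln_pos_lt[OF \<zeta>0(2)] \<zeta>0(1) by blast
      moreover have "\<bar>Im (of_nat k * Ln (1 + v))\<bar> < pi / 2"
        using abs_Im_le_cmod[of "of_nat k * Ln (1 + v)"] sE(3)[OF \<zeta>] unfolding v_def by linarith
      ultimately show "- pi < Im (Ln \<zeta> - of_nat k * Ln (1 + v))" "Im (Ln \<zeta> - of_nat k * Ln (1 + v)) \<le> pi"
        by (simp_all add: abs_less_iff)
    qed
    ultimately have "Ln (Ft \<zeta>) = Ln \<zeta> - of_nat k * Ln (1 + v)" by simp
    then have "- Ln (Ft \<zeta>) / of_nat k = - Ln \<zeta> / of_nat k + Ln (1 + v)"
      using k(2) by (simp add: field_simps)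
    then have "E (Ft \<zeta>) = E \<zeta> * exp (Ln (1 + v))" unfolding E_def by (simp only: exp_add mult.assoc)
    then have "E (Ft \<zeta>) = E \<zeta> * (1 + v)" using lt1(2)[OF v(2)] by simp
    then have "\<Psi> (E \<zeta>) = E (Ft \<zeta>)" using \<Psi>w[OF sE(4)[OF \<zeta>]] by (simp add: v_def)
    moreover have "Ft \<zeta> - \<zeta> - 1 = D (E \<zeta>)"
    proof -
      have "v = E \<zeta> ^ k * h (E \<zeta>)" by (simp add: v_def w_def)
      then have "\<zeta> * v = \<beta> ^ k * h (E \<zeta>)" using Ek[OF \<zeta>0(1)] \<zeta>0(2) by simp
      then have "\<beta> ^ k * h (E \<zeta>) * ((Q v - 1) / v) = \<zeta> * (Q v - 1)" using v(1) by (metis (no_types, lifting) mult.assoc nonzero_mult_div_cancel_left times_divide_eq_right)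
      then show ?thesis by (simp add: D_def v_def[symmetric] Ft_def Q_def algebra_simps)
    qed
    ultimately show "E \<zeta> \<in> ball 0 e \<and> \<Psi> (E \<zeta>) = E (Ft \<zeta>) \<and> norm (Ft \<zeta> - \<zeta> - 1) \<le> 1 / 8"
      using sE(1,4)[OF \<zeta>] h(3) by auto
  qed
qed

section \<open>Iterates of the return map at a parabolic cycle\<close>

context covering_cycle
begin

text \<open>At a parabolic cycle some power of the multiplier is 1, and the corresponding iterate is
  tangent to the identity, as the petal requires.\<close>

lemma return_iter_coord:
  obtains e \<Psi> where "0 < e" "\<Psi> holomorphic_on ball 0 e" "\<Psi> 0 = 0" "deriv \<Psi> 0 = multiplier f n p ^ q"
    "\<And>z. z \<in> ball 0 e \<Longrightarrow> loc z \<in> S" "\<And>z. z \<in> ball 0 e \<Longrightarrow> (f ^^ (n * q)) (loc z) = loc (\<Psi> z)"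
proof -
  obtain e \<Phi> where \<Phi>: "0 < e" "\<Phi> holomorphic_on ball 0 e" "\<Phi> 0 = 0" "deriv \<Phi> 0 = multiplier f n p"
    "\<And>z. z \<in> ball 0 e \<Longrightarrow> loc z \<in> S" "\<And>z. z \<in> ball 0 e \<Longrightarrow> (f ^^ n) (loc z) = loc (\<Phi> z)"
    by (rule return_map_coord) blast
  have "\<exists>e' \<Psi>. 0 < e' \<and> e' \<le> e \<and> \<Psi> holomorphic_on ball 0 e' \<and> \<Psi> 0 = 0 \<and> deriv \<Psi> 0 = multiplier f n p ^ q \<and>
      (\<forall>z\<in>ball 0 e'. (f ^^ (n * q)) (loc z) = loc (\<Psi> z))"
  proof (induction q)
    case 0
    show ?case using \<Phi>(1) by (intro exI[of _ e] exI[of _ "\<lambda>z. z"]) (auto intro: holomorphic_intros)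
  next
    case (Suc q)
    then obtain e' \<Psi> where \<Psi>: "0 < e'" "e' \<le> e" "\<Psi> holomorphic_on ball 0 e'" "\<Psi> 0 = 0"
      "deriv \<Psi> 0 = multiplier f n p ^ q" "\<And>z. z \<in> ball 0 e' \<Longrightarrow> (f ^^ (n * q)) (loc z) = loc (\<Psi> z)" by blast
    have op: "open (ball 0 e' \<inter> \<Psi> -` ball 0 e)"
      by (intro continuous_open_preimage holomorphic_on_imp_continuous_on \<Psi>(3) open_ball)
    have "0 \<in> ball 0 e' \<inter> \<Psi> -` ball 0 e" using \<Psi>(1,4) \<Phi>(1) by simp
    then obtain r where r: "0 < r" "ball 0 r \<subseteq> ball 0 e' \<inter> \<Psi> -` ball 0 e"
      using op open_contains_ball by metis
    define s where "s = min r e'"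
    have s: "0 < s" "s \<le> e" using r(1) \<Psi>(1,2) by (auto simp: s_def)
    have sz: "z \<in> ball 0 e'" "\<Psi> z \<in> ball 0 e" if "z \<in> ball 0 s" for z
    proof -
      have "z \<in> ball 0 r" using that by (simp add: s_def)
      then show "z \<in> ball 0 e'" "\<Psi> z \<in> ball 0 e" using r(2) by blast+
    qed
    have \<Psi>s: "\<Psi> holomorphic_on ball 0 s" by (rule holomorphic_on_subset[OF \<Psi>(3)]) (use sz in blast)
    have "\<Phi> \<circ> \<Psi> holomorphic_on ball 0 s"
      by (rule holomorphic_on_compose_gen[OF \<Psi>s \<Phi>(2)]) (use sz in blast)
    moreover have "deriv (\<Phi> \<circ> \<Psi>) 0 = deriv \<Phi> (\<Psi> 0) * deriv \<Psi> 0"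
      by (rule deriv_compose_at[OF \<Phi>(2) open_ball \<Psi>s open_ball _ _ open_UNIV UNIV_I]) (use s(1) \<Psi>(4) \<Phi>(1) in auto)
    then have "deriv (\<Phi> \<circ> \<Psi>) 0 = multiplier f n p ^ Suc q" using \<Psi>(4,5) \<Phi>(4) by simp
    moreover have "(f ^^ (n * Suc q)) (loc z) = loc ((\<Phi> \<circ> \<Psi>) z)" if "z \<in> ball 0 s" for z
      using \<Psi>(6)[OF sz(1)[OF that]] \<Phi>(6)[OF sz(2)[OF that]] by (simp add: funpow_add)
    ultimately show ?case using s \<Psi>(4) \<Phi>(3)
      by (intro exI[of _ s] exI[of _ "\<Phi> \<circ> \<Psi>"]) (auto simp: o_def)
  qed
  then obtain e' \<Psi> where \<Psi>: "0 < e'" "e' \<le> e" "\<Psi> holomorphic_on ball 0 e'" "\<Psi> 0 = 0"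
    "deriv \<Psi> 0 = multiplier f n p ^ q" "\<And>z. z \<in> ball 0 e' \<Longrightarrow> (f ^^ (n * q)) (loc z) = loc (\<Psi> z)" by blast
  show ?thesis
  proof (rule that[of e' \<Psi>])
    show "loc z \<in> S" if "z \<in> ball 0 e'" for z using \<Phi>(5)[of z] that \<Psi>(2) by simp
  qed (fact \<Psi>)+
qed

lemma connected_finite_part: "connected {z. Some z \<in> S}"
proof -
  have "{z. Some z \<in> S} = UNIV \<or> {z. Some z \<in> S} = ball 0 1" using S_cases by auto
  then show ?thesis using connected_UNIV connected_ball by metis
qed

text \<open>By the identity principle an iterate that is the identity near a point would be invertible.\<close>

lemma iterate_not_locally_identity:
  assumes mult: "multiplier f n p \<noteq> 0" and q: "1 \<le> q"
    and W: "openin riemann_sphere W" "W \<noteq> {}" "W \<subseteq> S" "\<And>s. s \<in> W \<Longrightarrow> (f ^^ (n * q)) s = s"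
  shows False
proof -
  define A where "A = {z. Some z \<in> S}"
  define F where "F z = (f ^^ (n * q)) (Some z)" for z
  have Some_pt: "Some z = pt (Some 0) z" for z by (simp add: pt_def chart_def)
  have A: "open A" unfolding A_def using S_open openin_sphere_iff by blast
  have "sphere_holomorphic_on (\<lambda>z. pt (Some 0) z) A" by (intro sphere_holomorphic_pt A holomorphic_on_ident)
  then have Shol: "sphere_holomorphic_on Some A" by (simp add: Some_pt[abs_def, symmetric] flip: Some_pt)
  have Fhol: "sphere_holomorphic_on F A"
    using self_iter[of "n * q"] Shol A unfolding F_def holomorphic_self_def by (auto simp: A_def)
  \<comment> \<open>The set near whose points the iterate is the identity; it is shown to be open
    and closed in the connected finite part of \<open>S\<close>.\<close>
  define T where "T = {z \<in> A. \<exists>e>0. \<forall>w\<in>ball z e. F w = Some w}"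
  have T: "open T"
  proof (rule openI)
    fix z assume "z \<in> T"
    then obtain e where e: "0 < e" "\<And>w. w \<in> ball z e \<Longrightarrow> F w = Some w" and zA: "z \<in> A" by (auto simp: T_def)
    obtain e' where e': "0 < e'" "ball z e' \<subseteq> A" using A zA open_contains_ball by metis
    define r where "r = min e e' / 2"
    have r: "0 < r" using e e' by (simp add: r_def)
    have "w \<in> T" if w: "w \<in> ball z r" for w
    proof -
      have "w \<in> ball z e'" using w r by (auto simp: r_def min_def split: if_splits)
      then have "w \<in> A" using e'(2) by blast
      moreover have "F v = Some v" if "v \<in> ball w r" for v
      proof (rule e(2))
        have "dist z v \<le> dist z w + dist w v" by (rule dist_triangle)
        then show "v \<in> ball z e" using w that by (auto simp: r_def min_def split: if_splits)
      qed
      ultimately show ?thesis using r by (auto simp: T_def)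
    qed
    then show "\<exists>e>0. ball z e \<subseteq> T" using r by blast
  qed
  have T0: "T \<noteq> {}"
  proof -
    have op: "open {z. Some z \<in> W}" "open {z. sphere_inv (Some z) \<in> W}" using W(1) openin_sphere_iff by blast+
    have "\<exists>z. Some z \<in> W"
    proof (rule ccontr)
      assume no: "\<nexists>z. Some z \<in> W"
      then have "None \<in> W" using W(2) by (metis all_not_in_conv not_Some_eq)
      then have "0 \<in> {z. sphere_inv (Some z) \<in> W}" by simp
      then obtain e where e: "0 < e" "ball 0 e \<subseteq> {z. sphere_inv (Some z) \<in> W}" using op(2) open_contains_ball by metis
      have "of_real (e / 2) \<in> ball (0::complex) e" using e(1) by simp
      then have "sphere_inv (Some (of_real (e / 2))) \<in> W" using e(2) by blast
      then show False using no e(1) by simp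
    qed
    then obtain z where z: "z \<in> {z. Some z \<in> W}" by blast
    then obtain e where e: "0 < e" "ball z e \<subseteq> {z. Some z \<in> W}" using op(1) open_contains_ball by metis
    then have "z \<in> T" using z W(3,4) by (auto simp: T_def A_def F_def)
    then show ?thesis by blast
  qed
  have nT: "open (A - T)"
  proof (rule openI)
    fix z assume z: "z \<in> A - T"
    show "\<exists>e>0. ball z e \<subseteq> A - T"
    proof (rule ccontr)
      assume no: "\<not> ?thesis"
      have meets: "\<exists>w. w \<in> O' \<and> w \<in> T" if O': "open O'" "z \<in> O'" "O' \<subseteq> A" for O'
      proof (rule ccontr)
        assume "\<nexists>w. w \<in> O' \<and> w \<in> T"
        then have "O' \<subseteq> A - T" using O'(3) by blast
        then show False using no O'(1,2) open_contains_ball by (metis order_trans)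
      qed
      have Fz: "F z = Some z"
      proof (rule ccontr)
        assume "F z \<noteq> Some z"
        then obtain P Q where PQ: "openin riemann_sphere P" "openin riemann_sphere Q" "F z \<in> P" "Some z \<in> Q" "P \<inter> Q = {}"
          using Hausdorff_sphere unfolding Hausdorff_space_def disjnt_def by (metis UNIV_I topspace_sphere)
        have "open ({w \<in> A. F w \<in> P} \<inter> {w \<in> A. Some w \<in> Q})"
          by (intro open_Int sphere_holomorphic_vimage Fhol Shol A PQ)
        then obtain w where "w \<in> {w \<in> A. F w \<in> P} \<inter> {w \<in> A. Some w \<in> Q}" "w \<in> T"
          using meets[of "{w \<in> A. F w \<in> P} \<inter> {w \<in> A. Some w \<in> Q}"] z PQ(3,4) by auto
        moreover from this have "F w = Some w" by (auto simp: T_def)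
        ultimately show False using PQ(5) by auto
      qed
      then have "chart (Some 0) (F z) \<noteq> None" by (simp add: chart_def)
      then obtain B where B: "open B" "z \<in> B" "B \<subseteq> A" "\<And>w. w \<in> B \<Longrightarrow> chart (Some 0) (F w) \<noteq> None"
          "(\<lambda>w. co (Some 0) (F w)) holomorphic_on B"
        using sphere_holomorphic_coord_local[OF Fhol A] z by (metis DiffD1)
      then obtain r where r: "0 < r" "ball z r \<subseteq> B" using open_contains_ball by metis
      obtain w0 where w0: "w0 \<in> ball z r" "w0 \<in> T" using meets[of "ball z r"] r B(3) by auto
      have "co (Some 0) (F w) = w" if "w \<in> ball z r" for w
      proof (rule analytic_continuation_open[where s = "ball z r \<inter> T" and s' = "ball z r"
            and f = "\<lambda>w. co (Some 0) (F w)" and g = "\<lambda>w. w"])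
        show "ball z r \<inter> T \<noteq> {}" using w0 by blast
        show "(\<lambda>w. co (Some 0) (F w)) holomorphic_on ball z r" by (rule holomorphic_on_subset[OF B(5) r(2)])
        show "co (Some 0) (F v) = v" if "v \<in> ball z r \<inter> T" for v
        proof -
          have "F v = Some v" using that by (auto simp: T_def)
          then show ?thesis by (simp add: co_def chart_def)
        qed
      qed (use T that in \<open>auto intro: holomorphic_intros\<close>)
      then have "F w = Some w" if "w \<in> ball z r" for w
        using pt_co[OF B(4)] r(2) that Some_pt by (metis subsetD)
      then have "z \<in> T" using z r(1) by (auto simp: T_def)
      then show False using z by blast
    qed
  qed
  have "T \<inter> A = {} \<or> (A - T) \<inter> A = {}"
    by (rule connectedD[OF connected_finite_part[folded A_def] T nT]) auto
  then have all: "F z = Some z" if "z \<in> A" for z using T0 that by (auto simp: T_def)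
  obtain a b c k0 where abc: "\<And>t. t \<in> {a, b, c} \<Longrightarrow> Some t \<in> S" "\<And>t. t \<in> {a, b, c} \<Longrightarrow> Some t \<noteq> x 0"
    "\<And>t k. t \<in> {a, b, c} \<Longrightarrow> k0 \<le> k \<Longrightarrow> (f ^^ (n * k)) (Some t) = x 0"
    by (rule omitted_points[OF mult]) blast
  \<comment> \<open>An iterate that is the identity fixes \<open>a\<close> forever, whereas high
    iterates send the omitted point \<open>a\<close> to \<open>x 0\<close>, which is different from
    \<open>Some a\<close>.\<close>
  have "(f ^^ (n * (q * j))) (Some a) = Some a" for j
  proof (induction j)
    case (Suc j)
    have "(f ^^ (n * (q * Suc j))) (Some a) = (f ^^ (n * q)) ((f ^^ (n * (q * j))) (Some a))"
      by (simp add: funpow_add algebra_simps)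
    then show ?case using Suc all[of a] abc(1)[of a] by (simp add: F_def A_def)
  qed simp
  from this[of k0] have "(f ^^ (n * (q * k0))) (Some a) = Some a" .
  moreover have "k0 \<le> q * k0" using q by simp
  ultimately show False using abc(3)[of a "q * k0"] abc(2)[of a] by simp
qed

lemma parabolic_root_of_unity:
  assumes "parabolic f n p" obtains q where "1 \<le> q" "multiplier f n p ^ q = 1" "norm (multiplier f n p) = 1"
proof -
  obtain \<theta> where \<theta>: "\<theta> \<in> \<rat>" "norm (multiplier f n p) = 1"
    "multiplier f n p = exp (2 * of_real pi * of_real \<theta> * \<i>)"
    using assms by (auto simp: parabolic_def neutral_with_angle_def)
  obtain a b :: int where ab: "0 < b" "\<theta> = of_int a / of_int b" using \<theta>(1) by (rule Rats_cases') blast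
  define q where "q = nat b"
  have q: "1 \<le> q" "of_nat q = (of_int b :: real)" using ab(1) by (auto simp: q_def)
  have "of_real (of_nat q * \<theta>) = (of_int a :: complex)" using ab q by simp
  then have "of_nat q * of_real \<theta> = (of_int a :: complex)" by simp
  moreover have "of_nat q * (2 * of_real pi * of_real \<theta> * \<i>) = 2 * of_real pi * (of_nat q * of_real \<theta>) * \<i>"
    by (simp add: mult_ac)
  ultimately have eq: "of_nat q * (2 * of_real pi * of_real \<theta> * \<i>) = 2 * of_real pi * of_int a * \<i>"
    by (simp only:)
  have "multiplier f n p ^ q = exp (2 * of_real pi * of_int a * \<i>)"
    unfolding \<theta>(3) exp_of_nat_mult[symmetric] eq by (rule refl)
  also have "\<dots> = 1" by (simp add: exp_eq_1 mult.commute mult.left_commute)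
  finally show ?thesis using that q(1) \<theta>(2) by blast
qed


subsection \<open>Parabolic cycles\<close>

text \<open>
  The point \<open>w\<close> of a petal \<open>P\<close> is followed backwards along the orbit of \<open>P\<close>. If every disk around
  \<open>F\<^sup>k w\<close> in \<open>P\<close> lifted univalently to \<open>w\<close>, the lifts would omit three points while
  their derivatives grow at least like the square root of \<open>k\<close>. So a lift meets a critical point.
\<close>

lemma parabolic_critical_point:
  assumes par: "parabolic f n p" and nb: "nbhd S f d x U"
  obtains c i where "c \<in> critical_points S f" "attracted c i"
    "\<forall>r0 B r. disk_base r0 B \<longrightarrow> 0 < r \<longrightarrow> r \<le> r0 \<longrightarrow>
      (\<forall>\<^sub>F l in sequentially. l mod n = i mod n \<longrightarrow> c \<in> B r l)"
proof -
  obtain q where q: "1 \<le> q" "multiplier f n p ^ q = 1" and mnorm: "norm (multiplier f n p) = 1"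
    by (rule parabolic_root_of_unity[OF par])
  have mult: "multiplier f n p \<noteq> 0" using mnorm by auto
  define N where "N = n * q"
  define F where "F = f ^^ N"
  obtain e0 \<Psi> where \<Psi>0: "0 < e0" "\<Psi> holomorphic_on ball 0 e0" "\<Psi> 0 = 0" "deriv \<Psi> 0 = 1"
    "\<And>z. z \<in> ball 0 e0 \<Longrightarrow> loc z \<in> S" "\<And>z. z \<in> ball 0 e0 \<Longrightarrow> F (loc z) = loc (\<Psi> z)"
    unfolding F_def N_def q(2)[symmetric] by (rule return_iter_coord) blast
  have Fk: "(f ^^ (N * k)) s = (F ^^ k) s" for k s by (simp add: F_def funpow_mult mult.commute)
  have nid: "\<not> (\<forall>z\<in>ball 0 e0. \<Psi> z = z)"
  proof
    assume id: "\<forall>z\<in>ball 0 e0. \<Psi> z = z"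
    show False
    proof (rule iterate_not_locally_identity[OF mult q(1), of "disk e0"])
      show "openin riemann_sphere (disk e0)" by (rule conformal_from_diskD(4)[OF conformal_disk[OF \<Psi>0(1)]])
      show "disk e0 \<noteq> {}" using x0_in_disk[OF \<Psi>0(1)] by blast
      show "disk e0 \<subseteq> S" using \<Psi>0(5) by (auto simp: disk_def)
      show "(f ^^ (n * q)) s = s" if "s \<in> disk e0" for s
        using that \<Psi>0(6) id by (auto simp: disk_def F_def N_def)
    qed
  qed
  show thesis
  proof (rule parabolic_petal[OF \<Psi>0(2,1,3,4) nid])
    fix R0 :: real and E Ft :: "complex \<Rightarrow> complex"
    assume pet: "0 < R0" "E holomorphic_on {\<zeta>. 0 < Re \<zeta>}" "inj_on E {\<zeta>. 0 < Re \<zeta>}"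
      "\<And>\<zeta>. 0 < Re \<zeta> \<Longrightarrow> E \<zeta> \<noteq> 0"
      "\<And>\<epsilon>. 0 < \<epsilon> \<Longrightarrow> \<exists>R>0. \<forall>\<zeta>. R < Re \<zeta> \<longrightarrow> norm (E \<zeta>) < \<epsilon>"
      "Ft holomorphic_on {\<zeta>. R0 < Re \<zeta>}"
      "\<And>\<zeta>. R0 < Re \<zeta> \<Longrightarrow> E \<zeta> \<in> ball 0 e0 \<and> \<Psi> (E \<zeta>) = E (Ft \<zeta>) \<and> norm (Ft \<zeta> - \<zeta> - 1) \<le> 1 / 8"
    obtain r where r: "0 < r" "disk r \<subseteq> U 0"
      using disk_small[OF plaqueD(2)[OF nbhdD(1)[OF nb]] nbhdD(2)[OF nb]] by blast
    obtain R1 where R1: "0 < R1" "\<And>\<zeta>. R1 < Re \<zeta> \<Longrightarrow> norm (E \<zeta>) < r" using pet(5)[OF r(1)] by blast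
    \<comment> \<open>Far enough to the right for the model map to be defined and for the petal to
      lie in \<open>U 0\<close>.\<close>
    define R where "R = max R0 R1"
    have R: "R0 \<le> R" "R1 \<le> R" "0 < R" using pet(1) by (auto simp: R_def)
    define H where "H = {\<zeta>. R < Re \<zeta>}"
    have H: "open H" "convex H" "H \<subseteq> {\<zeta>. 0 < Re \<zeta>}" "H \<subseteq> {\<zeta>. R0 < Re \<zeta>}"
      using R by (auto simp: H_def open_halfspace_Re_gt convex_halfspace_Re_gt)
    have Ehol: "E holomorphic_on H" by (rule holomorphic_on_subset[OF pet(2) H(3)])
    have Einj: "inj_on E H" by (rule inj_on_subset[OF pet(3) H(3)])
    have Fthol: "Ft holomorphic_on H" by (rule holomorphic_on_subset[OF pet(6) H(4)])
    have Ftbd: "norm (Ft \<zeta> - \<zeta> - 1) \<le> 1 / 8" if "R < Re \<zeta>" for \<zeta> using pet(7)[of \<zeta>] that R(1) by simp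
    note orb = petal_orbit[OF Fthol[unfolded H_def] Ftbd]
    have FtH: "(Ft ^^ k) \<zeta> \<in> H" if "\<zeta> \<in> H" for k \<zeta>
      using orb(1)[of \<zeta> k] that of_nat_0_le_iff[of k] by (auto simp: H_def)
    have Ftk: "(Ft ^^ k) holomorphic_on H" for k using orb(2) by (simp add: H_def)
    have Fpet: "(F ^^ k) (loc (E \<zeta>)) = loc (E ((Ft ^^ k) \<zeta>))" if \<zeta>: "\<zeta> \<in> H" for k \<zeta>
    proof (induction k)
      case (Suc k)
      have "R0 < Re ((Ft ^^ k) \<zeta>)" using FtH[OF \<zeta>, of k] H(4) by auto
      from pet(7)[OF this] show ?case using Suc \<Psi>0(6)[of "E ((Ft ^^ k) \<zeta>)"] by simp
    qed simp
    define P where "P = (\<lambda>\<zeta>. loc (E \<zeta>)) ` H"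
    \<comment> \<open>Absorption needs a connected set that meets the orbit of the cycle. The petal
      has \<open>x 0\<close> only in its closure, so the point is added.\<close>
    define P0 where "P0 = insert (x 0) P"
    have PU: "P \<subseteq> U 0" using R1(2) R(2) r(2) by (force simp: P_def H_def disk_def)
    have P0U: "P0 \<subseteq> U 0" using PU nbhdD(2)[OF nb] by (simp add: P0_def)
    have P0S: "P0 \<subseteq> S" using P0U plaqueD(1)[OF nbhdD(1)[OF nb]] by blast
    have Fx0: "(F ^^ k) (x 0) = x 0" for k
      using iter_x_periodic[of "q * k" 0] Fk[of k "x 0"] by (simp add: N_def mult.assoc)
    have FP0: "(F ^^ k) ` P0 \<subseteq> P0" for k
      using Fpet FtH Fx0 by (auto simp: P0_def P_def)
    have Phol: "sphere_holomorphic_on (\<lambda>\<zeta>. loc (E \<zeta>)) H" by (rule sphere_holomorphic_loc[OF Ehol H(1)])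
    have Pconn: "connectedin riemann_sphere P"
      unfolding P_def by (rule sphere_holomorphic_connected[OF Phol H(1) convex_connected[OF H(2)] order_refl])
    have P0conn: "connectedin riemann_sphere P0"
    proof (rule connectedin_intermediate_closure_of[OF Pconn])
      show "P \<subseteq> P0" by (auto simp: P0_def)
      have "x 0 \<in> riemann_sphere closure_of P"
        unfolding in_closure_of
      proof (intro conjI allI impI)
        fix T assume T: "x 0 \<in> T \<and> openin riemann_sphere T"
        then obtain s where s: "0 < s" "disk s \<subseteq> T" using disk_small by blast
        obtain R2 where R2: "0 < R2" "\<And>\<zeta>. R2 < Re \<zeta> \<Longrightarrow> norm (E \<zeta>) < s" using pet(5)[OF s(1)] by blast
        define \<zeta> where "\<zeta> = complex_of_real (max R R2 + 1)"
        have "\<zeta> \<in> H" "norm (E \<zeta>) < s" using R2(2)[of \<zeta>] by (auto simp: \<zeta>_def H_def)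
        then show "\<exists>y. y \<in> P \<and> y \<in> T" using s(2) by (intro exI[of _ "loc (E \<zeta>)"]) (auto simp: P_def disk_def)
      qed simp
      moreover have "P \<subseteq> riemann_sphere closure_of P" by (rule closure_of_subset) simp
      ultimately show "P0 \<subseteq> riemann_sphere closure_of P" by (simp add: P0_def)
    qed
    have uniform: "\<exists>s0. \<forall>s\<ge>s0. (f ^^ (n * s)) ` P0 \<subseteq> D" if D: "openin riemann_sphere D" "x 0 \<in> D" for D
    proof -
      \<comment> \<open>\<open>F\<close> consists of \<open>q\<close> returns, and only
        \<open>F\<close> is known to preserve the petal; the remainder of a number of returns modulo
        \<open>q\<close> is absorbed into the neighborhood.\<close>
      define D' where "D' = (\<Inter>v\<in>{..<q}. {s \<in> S. (f ^^ (n * v)) s \<in> D})"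
      have "openin riemann_sphere D'" unfolding D'_def
        using q(1) by (intro openin_Inter) (auto intro!: holomorphic_self_vimage[OF self_iter S_open D(1)] simp: lessThan_empty_iff)
      moreover have "x 0 \<in> D'" unfolding D'_def using iter_x_periodic[of _ 0] x_in_S D(2) by auto
      ultimately obtain s where s: "0 < s" "disk s \<subseteq> D'" using disk_small by blast
      obtain R2 where R2: "0 < R2" "\<And>\<zeta>. R2 < Re \<zeta> \<Longrightarrow> norm (E \<zeta>) < s" using pet(5)[OF s(1)] by blast
      obtain u0 :: nat where u0: "2 * R2 < real u0" using reals_Archimedean2 by blast
      have inD': "(F ^^ u) ` P0 \<subseteq> D'" if u: "u0 \<le> u" for u
      proof -
        have "loc (E ((Ft ^^ u) \<zeta>)) \<in> D'" if \<zeta>: "\<zeta> \<in> H" for \<zeta>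
        proof -
          have "real u0 \<le> real u" using u by simp
          then have "R2 < Re ((Ft ^^ u) \<zeta>)" using orb(1)[of \<zeta> u] \<zeta> u0 R(3) by (simp add: H_def)
          then have "norm (E ((Ft ^^ u) \<zeta>)) < s" by (rule R2(2))
          then show ?thesis using s(2) by (auto simp: disk_def)
        qed
        then show ?thesis using \<open>x 0 \<in> D'\<close> Fpet Fx0 by (auto simp: P0_def P_def)
      qed
      have "(f ^^ (n * s)) ` P0 \<subseteq> D" if s: "q * u0 \<le> s" for s
      proof -
        define u v where "u = s div q" and "v = s mod q"
        have "u0 \<le> u" using s q(1) unfolding u_def by (metis div_le_mono nonzero_mult_div_cancel_left not_one_le_zero)
        moreover have v: "v < q" using q(1) by (simp add: v_def)
        moreover have "n * s = n * v + N * u"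
          unfolding N_def u_def v_def by (metis add.commute add_mult_distrib2 mult.assoc mult_div_mod_eq)
        then have "(f ^^ (n * s)) y = (f ^^ (n * v)) ((F ^^ u) y)" for y by (simp add: funpow_add Fk)
        ultimately show ?thesis using inD'[of u] v unfolding D'_def by (auto simp: image_subset_iff)
      qed
      then show ?thesis by blast
    qed
    \<comment> \<open>At distance 1 from the boundary line, as the derivative bound of
      \<open>petal_orbit\<close> requires.\<close>
    define \<zeta>0 where "\<zeta>0 = complex_of_real (R + 1)"
    define w where "w = loc (E \<zeta>0)"
    have \<zeta>0: "\<zeta>0 \<in> H" "R + 1 \<le> Re \<zeta>0" by (auto simp: \<zeta>0_def H_def)
    have wP: "w \<in> P" using \<zeta>0 by (auto simp: w_def P_def)
    define \<zeta> where "\<zeta> k = (Ft ^^ k) \<zeta>0" for k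
    \<comment> \<open>The distance to the boundary line, hence the radius of the largest disk around
      \<open>\<zeta> k\<close> in the half-plane. It grows at least linearly.\<close>
    define \<rho> where "\<rho> k = Re (\<zeta> k) - R" for k
    have \<rho>: "1 + real k / 2 \<le> \<rho> k" for k
      using orb(1)[of \<zeta>0 k] \<zeta>0 by (simp add: \<zeta>_def \<rho>_def H_def)
    have \<rho>pos: "0 < \<rho> k" for k using \<rho>[of k] of_nat_0_le_iff[of k] by linarith
    have ballH: "ball (\<zeta> k) (\<rho> k) \<subseteq> H" for k
    proof
      fix z assume "z \<in> ball (\<zeta> k) (\<rho> k)"
      then have "\<bar>Re (\<zeta> k - z)\<bar> < \<rho> k" using abs_Re_le_cmod[of "\<zeta> k - z"] by (simp add: dist_norm)
      then have "Re (\<zeta> k) - Re z < Re (\<zeta> k) - R" unfolding \<rho>_def minus_complex.sel by linarith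
      then show "z \<in> H" by (simp add: H_def)
    qed
    define \<alpha> where "\<alpha> k z = loc (E (\<zeta> k + of_real (\<rho> k) * z))" for k z
    define A where "A k = loc ` E ` ball (\<zeta> k) (\<rho> k)" for k
    have \<alpha>: "conformal_from_disk (\<alpha> k) (A k)" for k
      unfolding \<alpha>_def A_def by (rule conformal_loc_ball[OF \<rho>pos ballH Ehol Einj])
    have AP: "A k \<subseteq> P" for k using ballH by (auto simp: A_def P_def)
    \<comment> \<open>\<open>U\<close> absorbs \<open>P0\<close> at level \<open>N * k\<close>,
      which yields an orbit through \<open>w\<close> inside \<open>U\<close>; the plaque is shrunk
      around this orbit and not around \<open>x\<close>.\<close>
    have "\<exists>V y. plaque S f d V \<and> V 0 = A k \<and> y \<in> points_of S f V \<and> y (N * k) = w" for k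
    proof -
      have "x (N * k) = x 0" by (simp add: x_eq_iff N_def)
      have "P0 \<subseteq> U (N * k)"
      proof (rule plaque_absorb_iter[OF nbhdD(1)[OF nb] P0conn P0S nbhdD(3)[OF nb]])
        show "x (N * k) \<in> P0" using \<open>x (N * k) = x 0\<close> by (simp add: P0_def)
        have "(f ^^ (N * k)) ` P0 = (F ^^ k) ` P0" by (rule image_cong) (simp_all add: Fk)
        then show "(f ^^ (N * k)) ` P0 \<subseteq> U 0" using FP0[of k] P0U by blast
      qed
      then have "w \<in> U (N * k)" using wP unfolding P0_def by blast
      then obtain y where y: "y \<in> points_of S f U" "y (N * k) = w" using points_of_through[OF nbhdD(4)[OF nb]] by blast
      have "y 0 = (f ^^ (N * k)) (y (0 + N * k))" by (rule backward_orbit_iter[symmetric]) (rule points_ofD(3)[OF y(1)])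
      then have "y 0 = (F ^^ k) w" using y(2) Fk by simp
      then have "y 0 = loc (E (\<zeta> k))" using Fpet[OF \<zeta>0(1)] by (simp add: w_def \<zeta>_def)
      then have "y 0 \<in> A k" using \<rho>pos[of k] by (auto simp: A_def)
      moreover have "A k \<subseteq> U 0" using AP PU by blast
      ultimately obtain V where "plaque S f d V" "V 0 = A k" "y \<in> points_of S f V"
        using plaque_shrink[OF nbhdD(1)[OF nb] y(1) _ _ \<alpha>] by metis
      then show ?thesis using y(2) by blast
    qed
    then obtain V y where V: "\<And>k. plaque S f d (V k)" "\<And>k. V k 0 = A k" "\<And>k. y k \<in> points_of S f (V k)"
      "\<And>k. y k (N * k) = w" by metis
    have "\<exists>k i. i < N * k \<and> \<not> bij_betw f (V k (Suc i)) (V k i)"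
    proof (rule ccontr)
      assume "\<not> ?thesis"
      then have bij: "\<And>k i. i < N * k \<Longrightarrow> bij_betw f (V k (Suc i)) (V k i)" by blast
      have "\<exists>\<beta>. conformal_from_disk \<beta> (V k (N * k)) \<and> (\<forall>z\<in>ball 0 1. (f ^^ (N * k)) (\<beta> z) = \<alpha> k z)" for k
      proof (rule plaque_chain[where V = "V k" and m = "N * k" and \<alpha> = "\<alpha> k"])
        show "plaque S f d (V k)" by (rule V(1))
        show "bij_betw f (V k (Suc i)) (V k i)" if "i < N * k" for i by (rule bij[OF that])
        show "conformal_from_disk (\<alpha> k) (V k 0)" using \<alpha> V(2) by simp
        fix \<beta> assume "conformal_from_disk \<beta> (V k (N * k))" "\<And>z. z \<in> ball 0 1 \<Longrightarrow> (f ^^ (N * k)) (\<beta> z) = \<alpha> k z"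
        then show ?thesis by (intro exI[of _ \<beta>] conjI ballI)
      qed
      then obtain \<beta> where \<beta>: "\<And>k. conformal_from_disk (\<beta> k) (V k (N * k))"
        "\<And>k z. z \<in> ball 0 1 \<Longrightarrow> (F ^^ k) (\<beta> k z) = \<alpha> k z" unfolding Fk by metis
      note \<beta>D = conformal_from_diskD[OF \<beta>(1)]
      have \<beta>V: "\<beta> k z \<in> V k (N * k)" if "z \<in> ball 0 1" for k z using \<beta>D(3) that by blast
      have injV: "inj_on (F ^^ k) (V k (N * k))" for k
      proof -
        have "inj_on (f ^^ (N * k)) (V k (N * k))" by (rule plaque_iterate_inj[OF V(1)]) (rule bij)
        then show ?thesis unfolding Fk[abs_def] by (simp add: inj_on_def Fk)
      qed
      have wV: "w \<in> V k (N * k)" for k using points_ofD(1)[OF V(3)[of k], of "N * k"] V(4) by simp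
      have \<beta>0: "\<beta> k 0 = w" for k
      proof (rule inj_onD[OF injV _ \<beta>V wV])
        show "(F ^^ k) (\<beta> k 0) = (F ^^ k) w" using \<beta>(2)[of 0 k] Fpet[OF \<zeta>0(1)] by (simp add: \<alpha>_def w_def \<zeta>_def)
      qed simp
      obtain a b c k0 where abc: "a \<noteq> b" "a \<noteq> c" "b \<noteq> c"
        "\<And>t k. t \<in> {a, b, c} \<Longrightarrow> k0 \<le> k \<Longrightarrow> (f ^^ (n * k)) (Some t) = x 0"
        by (rule omitted_points[OF mult]) blast
      \<comment> \<open>The iterate sends the three points to \<open>x 0\<close>, but it maps the
        lifted disk into the petal, where \<open>E\<close> has no zero.\<close>
      have omit: "\<beta> k z \<notin> {Some a, Some b, Some c}" if "k0 \<le> k" "z \<in> ball 0 1" for k z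
      proof
        assume "\<beta> k z \<in> {Some a, Some b, Some c}"
        then obtain t where t: "t \<in> {a, b, c}" "\<beta> k z = Some t" by blast
        have "k0 \<le> q * k" using that(1) q(1) by (metis le_trans mult_le_mono1 nat_mult_1)
        then have "(f ^^ (n * (q * k))) (Some t) = x 0" by (rule abc(4)[OF t(1)])
        moreover have "n * (q * k) = N * k" by (simp add: N_def)
        ultimately have "(F ^^ k) (Some t) = x 0" by (simp only: Fk)
        then have "loc (E (\<zeta> k + of_real (\<rho> k) * z)) = loc 0" using \<beta>(2)[OF that(2), of k] t(2) by (simp add: \<alpha>_def)
        then have "E (\<zeta> k + of_real (\<rho> k) * z) = 0" by (simp only: loc_eq_iff)
        moreover have "\<zeta> k + of_real (\<rho> k) * z \<in> ball (\<zeta> k) (\<rho> k)"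
          using affine_image_ball[OF \<rho>pos[of k], of "\<zeta> k"] that(2) by blast
        then have "0 < Re (\<zeta> k + of_real (\<rho> k) * z)" using ballH H(3) by blast
        ultimately show False using pet(4) by blast
      qed
      obtain K where K: "0 \<le> K" "\<And>\<phi> z. sphere_holomorphic_on \<phi> (ball 0 1) \<Longrightarrow> \<phi> 0 = w \<Longrightarrow>
        \<phi> ` ball 0 1 \<inter> {Some a, Some b, Some c} = {} \<Longrightarrow> norm z \<le> 1 / 2 \<Longrightarrow> norm (recip a (\<phi> z)) \<le> K"
        by (rule three_point_bound[OF abc(1-3)]) blast
      define \<kappa> where "\<kappa> k z = recip a (\<beta> k z)" for k z
      have \<kappa>hol: "\<kappa> k holomorphic_on ball 0 1" if "k0 \<le> k" for k
        unfolding \<kappa>_def by (rule recip_holomorphic[OF \<beta>D(1)]) (use omit[OF that] in auto)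
      have \<kappa>d: "norm (deriv (\<kappa> k) 0) \<le> 2 * K" if k: "k0 \<le> k" for k
      proof (rule deriv_bound_half_disk[OF \<kappa>hol[OF k]])
        fix z :: complex assume z: "norm z \<le> 1 / 2"
        have "\<beta> k ` ball 0 1 \<inter> {Some a, Some b, Some c} = {}" using omit[OF k] by blast
        then show "norm (\<kappa> k z) \<le> K" unfolding \<kappa>_def by (rule K(2)[OF \<beta>D(1) \<beta>0 _ z])
      qed
      have wa: "w \<noteq> Some a" using omit[OF order_refl, of 0] \<beta>0[of k0] by auto
      \<comment> \<open>The points mapped to \<open>a\<close> are removed so that
        \<open>recip a\<close> is holomorphic and injective along the petal.\<close>
      define M where "M = {\<eta> \<in> H. loc (E \<eta>) \<in> - {Some a}}"
      have "closedin riemann_sphere {Some a}"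
        using Hausdorff_imp_t1_space[OF Hausdorff_sphere] by (simp add: t1_space_closedin_singleton)
      then have "openin riemann_sphere (- {Some a})" by (simp add: closedin_def Compl_eq_Diff_UNIV)
      then have "open M" unfolding M_def by (rule sphere_holomorphic_vimage[OF Phol H(1)])
      moreover have "\<zeta>0 \<in> M" "M \<subseteq> H" unfolding M_def using wa \<zeta>0(1) by (auto simp: w_def)
      ultimately have M: "open M" "\<zeta>0 \<in> M" "M \<subseteq> H" by blast+
      define \<Lambda> where "\<Lambda> \<eta> = recip a (loc (E \<eta>))" for \<eta>
      have \<Lambda>hol: "\<Lambda> holomorphic_on M" unfolding \<Lambda>_def
        by (rule recip_holomorphic[OF sphere_holomorphic_subset[OF Phol M(3)] M(1)]) (simp add: M_def)
      have \<Lambda>inj: "inj_on \<Lambda> M"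
      proof (rule inj_onI)
        fix u v assume uv: "u \<in> M" "v \<in> M" "\<Lambda> u = \<Lambda> v"
        have "loc (E u) = loc (E v)" by (rule recip_inj[of a]) (use uv in \<open>simp_all add: \<Lambda>_def M_def\<close>)
        then have "E u = E v" by simp
        then show "u = v" by (rule inj_onD[OF Einj _ subsetD[OF M(3) uv(1)] subsetD[OF M(3) uv(2)]])
      qed
      define L where "L = deriv \<Lambda> \<zeta>0"
      have L: "0 < norm L" using holomorphic_injective_imp_regular[OF \<Lambda>hol M(1) \<Lambda>inj M(2)] by (simp add: L_def)
      \<comment> \<open>Near \<open>\<zeta>0\<close> the fixed map \<open>\<Lambda>\<close> factors
        through the lift \<open>\<kappa> k\<close> and the rescaled iterate \<open>h\<close>. By the
        chain rule its derivative \<open>L\<close> would have to be small if \<open>\<rho> k\<close>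
        outgrows the derivative of the iterate.\<close>
      have bound: "norm L * \<rho> k \<le> 2 * K * sqrt (real (Suc k))" if k: "k0 \<le> k" for k
      proof -
        define h where "h \<eta> = ((Ft ^^ k) \<eta> - \<zeta> k) / of_real (\<rho> k)" for \<eta>
        have hhol: "h holomorphic_on H" unfolding h_def
          using \<rho>pos[of k] by (intro holomorphic_intros Ftk) auto
        have h0: "h \<zeta>0 = 0" by (simp add: h_def \<zeta>_def)
        define C where "C = (H \<inter> h -` ball 0 1) \<inter> {\<eta> \<in> H. loc (E \<eta>) \<in> V k (N * k)}"
        have C: "open C" "\<zeta>0 \<in> C"
        proof -
          have "open (H \<inter> h -` ball 0 1)"
            by (intro continuous_open_preimage holomorphic_on_imp_continuous_on hhol H(1) open_ball)
          then show "open C" unfolding C_def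
            by (rule open_Int) (rule sphere_holomorphic_vimage[OF Phol H(1) plaqueD(2)[OF V(1)]])
          show "\<zeta>0 \<in> C" using \<zeta>0(1) h0 wV[of k] by (simp add: C_def w_def)
        qed
        have rel: "\<Lambda> \<eta> = \<kappa> k (h \<eta>)" if \<eta>: "\<eta> \<in> C" for \<eta>
        proof -
          have \<eta>': "\<eta> \<in> H" "h \<eta> \<in> ball 0 1" "loc (E \<eta>) \<in> V k (N * k)" using \<eta> by (auto simp: C_def)
          have "\<beta> k (h \<eta>) = loc (E \<eta>)"
          proof (rule inj_onD[OF injV _ \<beta>V[OF \<eta>'(2)] \<eta>'(3)])
            have "\<zeta> k + of_real (\<rho> k) * h \<eta> = (Ft ^^ k) \<eta>" using \<rho>pos[of k] by (simp add: h_def)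
            then show "(F ^^ k) (\<beta> k (h \<eta>)) = (F ^^ k) (loc (E \<eta>))"
              using \<beta>(2)[OF \<eta>'(2), of k] Fpet[OF \<eta>'(1), of k] by (simp add: \<alpha>_def)
          qed
          then show ?thesis by (simp add: \<Lambda>_def \<kappa>_def)
        qed
        have "L = deriv (\<kappa> k) (h \<zeta>0) * deriv h \<zeta>0" unfolding L_def
          by (rule deriv_compose_at[OF \<kappa>hol[OF k] open_ball hhol H(1) \<zeta>0(1) _ C rel]) (simp add: h0)
        moreover have "deriv h \<zeta>0 = deriv (Ft ^^ k) \<zeta>0 / of_real (\<rho> k)"
        proof -
          have "((Ft ^^ k) has_field_derivative deriv (Ft ^^ k) \<zeta>0) (at \<zeta>0)"
            by (rule holomorphic_derivI[OF Ftk H(1) \<zeta>0(1)])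
          then have "(h has_field_derivative (deriv (Ft ^^ k) \<zeta>0 - 0) / of_real (\<rho> k)) (at \<zeta>0)"
            unfolding h_def by (intro DERIV_cdivide DERIV_diff DERIV_const)
          then show ?thesis by (simp add: DERIV_imp_deriv)
        qed
        ultimately have "norm L * \<rho> k = norm (deriv (\<kappa> k) 0) * norm (deriv (Ft ^^ k) \<zeta>0)"
          using h0 \<rho>pos[of k] by (simp add: norm_mult norm_divide)
        also have "\<dots> \<le> 2 * K * sqrt (real (Suc k))"
          using K(1) by (intro mult_mono \<kappa>d[OF k] orb(3) \<zeta>0(2)) auto
        finally show ?thesis .
      qed
      obtain j where j: "4 * K / norm L < real j" using reals_Archimedean2 by blast
      \<comment> \<open>A square added to \<open>k0\<close> makes \<open>sqrt (real (Suc k))\<close>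
        exceed the given bound.\<close>
      define k where "k = k0 + j * j"
      have "real j \<le> sqrt (real (Suc k))"
        by (rule real_le_rsqrt) (simp add: k_def power2_eq_square)
      then have "4 * K / norm L < sqrt (real (Suc k))" using j by linarith
      then have s: "4 * K < norm L * sqrt (real (Suc k))" using L by (simp add: pos_divide_less_eq mult.commute)
      have "real (Suc k) / 2 \<le> \<rho> k" using \<rho>[of k] by simp
      then have "norm L * (real (Suc k) / 2) \<le> norm L * \<rho> k" by (rule mult_left_mono) simp
      also have "\<dots> \<le> 2 * K * sqrt (real (Suc k))" by (rule bound) (simp add: k_def)
      finally have "norm L * real (Suc k) \<le> (4 * K) * sqrt (real (Suc k))" by simp
      moreover have "real (Suc k) = sqrt (real (Suc k)) * sqrt (real (Suc k))" by simp
      ultimately have "(norm L * sqrt (real (Suc k))) * sqrt (real (Suc k)) \<le> (4 * K) * sqrt (real (Suc k))"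
        by (simp only: mult.assoc)
      then have "norm L * sqrt (real (Suc k)) \<le> 4 * K" by (rule mult_right_le_imp_le) simp
      then show False using s by simp
    qed
    then obtain k i where ki: "i < N * k" "\<not> bij_betw f (V k (Suc i)) (V k i)" by blast
    then obtain c where c: "c \<in> critical_points S f" "c \<in> V k (Suc i)"
      using plaque_bij_or_critical[OF V(1)] by blast
    define m where "m = Suc i"
    define m' where "m' = N * k - m"
    have mm: "m' + m = N * k" using ki(1) by (simp add: m_def m'_def)
    \<comment> \<open>The point \<open>y k m\<close> lies in both pieces, so \<open>Y\<close> is a
      connected set that joins the critical point \<open>c\<close> to the cycle point
      \<open>x m\<close>, and \<open>f ^^ m\<close> maps it into \<open>P0\<close>.\<close>
    define Y where "Y = V k m \<union> (f ^^ m') ` P0"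
    have Yconn: "connectedin riemann_sphere Y"
      unfolding Y_def
    proof (rule connectedin_Un)
      show "connectedin riemann_sphere (V k m)" by (rule plaqueD(4)[OF V(1)])
      show "connectedin riemann_sphere ((f ^^ m') ` P0)"
        by (rule holomorphic_self_connected[OF self_iter S_open P0conn P0S])
      have "(f ^^ m') (y k (m + m')) = y k m" by (rule backward_orbit_iter) (rule points_ofD(3)[OF V(3)])
      then have "y k m = (f ^^ m') w" using V(4)[of k] mm by (simp add: add.commute)
      then have "y k m \<in> (f ^^ m') ` P0" using wP by (auto simp: P0_def)
      then show "V k m \<inter> (f ^^ m') ` P0 \<noteq> {}" using points_ofD(1)[OF V(3)[of k], of m] by blast
    qed
    have YS: "Y \<subseteq> S" using plaqueD(1)[OF V(1)] iter_in_S P0S by (auto simp: Y_def)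
    have fY: "(f ^^ m) ` Y \<subseteq> P0"
    proof -
      have "(f ^^ m) ` V k m = A k" using iterate_image_plaque[OF V(1)[of k], of m 0] V(2) by simp
      moreover have "(f ^^ m) ` (f ^^ m') ` P0 = (F ^^ k) ` P0"
      proof -
        have "(f ^^ m) ((f ^^ m') s) = (F ^^ k) s" for s
        proof -
          have "(f ^^ m) ((f ^^ m') s) = (f ^^ (m + m')) s" by (simp add: funpow_add)
          also have "m + m' = N * k" using mm by simp
          finally show ?thesis by (simp only: Fk)
        qed
        then show ?thesis by (simp only: image_image)
      qed
      ultimately have "(f ^^ m) ` Y = A k \<union> (F ^^ k) ` P0" by (simp only: Y_def image_Un)
      moreover have "A k \<subseteq> P0" using AP[of k] unfolding P0_def by blast
      ultimately show ?thesis using FP0[of k] by simp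
    qed
    have xY: "x m \<in> Y"
    proof -
      have "x (m + m') = x 0" using mm by (simp add: x_eq_iff N_def add.commute)
      then have "x m = (f ^^ m') (x 0)" using iter_x[of m' m] by simp
      then show ?thesis by (auto simp: Y_def P0_def)
    qed
    have cY: "c \<in> Y" using c(2) by (simp add: Y_def m_def)
    have YD: "\<exists>s0. \<forall>s\<ge>s0. (f ^^ (m + n * s)) ` Y \<subseteq> D" if D: "openin riemann_sphere D" "x 0 \<in> D" for D
    proof -
      obtain s0 where "\<And>s. s0 \<le> s \<Longrightarrow> (f ^^ (n * s)) ` P0 \<subseteq> D" using uniform[OF D] by blast
      moreover have "(f ^^ (m + n * s)) ` Y = (f ^^ (n * s)) ` (f ^^ m) ` Y" for s
        by (simp add: add.commute[of m] funpow_add image_comp)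
      ultimately have "(f ^^ (m + n * s)) ` Y \<subseteq> D" if "s0 \<le> s" for s
        using that fY image_mono[OF fY, of "f ^^ (n * s)"] by (metis order_trans)
      then show ?thesis by blast
    qed
    show thesis
    proof (rule that[of c m])
      show "c \<in> critical_points S f" by (rule c(1))
      show "attracted c m" unfolding attracted_def
      proof (intro allI impI)
        fix D assume "openin riemann_sphere D" "x 0 \<in> D"
        from YD[OF this] show "\<forall>\<^sub>F j in sequentially. (f ^^ (m + n * j)) c \<in> D"
          using cY unfolding eventually_sequentially by blast
      qed
      show "\<forall>r0 B r. disk_base r0 B \<longrightarrow> 0 < r \<longrightarrow> r \<le> r0 \<longrightarrow>
        (\<forall>\<^sub>F l in sequentially. l mod n = m mod n \<longrightarrow> c \<in> B r l)"
      proof (intro allI impI)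
        fix r0 B r assume base: "disk_base r0 B" and r: "0 < r" "r \<le> r0"
        note nbr = disk_baseD[OF base r]
        have "openin riemann_sphere (B r 0)" "x 0 \<in> B r 0" using plaqueD(2)[OF nbhdD(1)[OF nbr(1)]] nbhdD(2)[OF nbr(1)] by blast+
        from YD[OF this] obtain s0 where s0: "\<And>s. s0 \<le> s \<Longrightarrow> (f ^^ (m + n * s)) ` Y \<subseteq> B r 0" by blast
        have "c \<in> B r l" if l: "m + n * s0 \<le> l" "l mod n = m mod n" for l
        proof -
          have "n dvd l - m" using l by (metis add_leD1 mod_eq_dvd_iff_nat)
          then obtain s where "l - m = n * s" by (rule dvdE)
          then have s: "l = m + n * s" using l(1) by linarith
          then have "s0 \<le> s" using l(1) n_pos by simp
          moreover have "x l = x m" using l(2) by (simp add: x_eq_iff)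
          ultimately have "Y \<subseteq> B r l"
            using plaque_absorb_iter[OF nbhdD(1)[OF nbr(1)] Yconn YS nbhdD(3)[OF nbr(1)], of l] xY s0[of s] s by simp
          then show ?thesis using cY by blast
        qed
        then show "\<forall>\<^sub>F l in sequentially. l mod n = m mod n \<longrightarrow> c \<in> B r l" unfolding eventually_sequentially by blast
      qed
    qed
  qed
qed

text \<open>The critical point found above lies in arbitrarily late entries of every plaque around
  \<open>x\<close>, which a univalent plaque excludes.\<close>

lemma irregular_if_parabolic:
  assumes par: "parabolic f n p" shows "\<not> regular_point S f d x"
proof
  assume reg: "regular_point S f d x"
  obtain r V where V: "0 < r" "nbhd S f d x V" "V 0 = disk r" "\<And>i. bij_betw f (V (Suc i)) (V i)"
    by (rule regular_univalent_nbhd[OF reg]) blast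
  obtain r0 B where base: "disk_base r0 B" using disk_base_exists[OF V(2)] by blast
  obtain r' where r': "0 < r'" "r' \<le> r0" "\<And>i. B r' i \<subseteq> V i" using disk_base_absorbs[OF base V(2)] by blast
  obtain c i where c: "c \<in> critical_points S f" "attracted c i" and
    ev: "\<forall>r0 B r. disk_base r0 B \<longrightarrow> 0 < r \<longrightarrow> r \<le> r0 \<longrightarrow>
      (\<forall>\<^sub>F l in sequentially. l mod n = i mod n \<longrightarrow> c \<in> B r l)"
    by (rule parabolic_critical_point[OF par V(2)])
  obtain L where L: "\<And>l. L \<le> l \<Longrightarrow> l mod n = i mod n \<Longrightarrow> c \<in> B r' l"
    using ev base r'(1,2) unfolding eventually_sequentially by blast
  \<comment> \<open>The extra period makes \<open>l\<close> positive, so that the entry at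
    \<open>l\<close> is the source of a bijective step.\<close>
  define l where "l = i + n * Suc L"
  have "1 * Suc L \<le> l" unfolding l_def by (rule order_trans[OF mult_le_mono1[OF n_pos] le_add2])
  then have "L \<le> l" "0 < l" by simp_all
  have "l mod n = i mod n" unfolding l_def by (rule mod_mult_self2)
  then have "c \<in> V l" using L[OF \<open>L \<le> l\<close>] r'(3) by blast
  then obtain l' where "c \<in> V (Suc l')" using \<open>0 < l\<close> by (cases l) auto
  then show False
    using critical_not_inj[OF c(1) _ plaqueD(2,1)[OF nbhdD(1)[OF V(2)]]] bij_betw_imp_inj_on[OF V(4)] by blast
qed

end

subsection \<open>The classification\<close>

context covering_cycle
begin

text \<open>The backward shift uses the explicit signature if the multiplier has norm below 1, and
  local invertibility of the return map if it has norm 1.\<close>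

lemma shift_invariant_signature:
  assumes nb: "nbhd S f d x U" and c: "c \<in> critical_points S f"
    and mult: "norm (multiplier f n p) < 1 \<or> norm (multiplier f n p) = 1"
  shows "signature S f d x c = shift (int n) ` signature S f d x c \<and>
    signature S f d x c = shift (- int n) ` signature S f d x c"
proof -
  obtain r0 B where base: "disk_base r0 B" using disk_base_exists[OF nb] by blast
  show ?thesis
  proof (rule shift_invariantI)
    fix \<beta> assume \<beta>: "class_of \<beta> \<in> signature S f d x c"
    show "class_of (\<lambda>j. n \<le> j \<and> \<beta> (j - n)) \<in> signature S f d x c"
      by (rule signature_shift_forward[OF base \<beta>])
    show "class_of (\<lambda>j. \<beta> (j + n)) \<in> signature S f d x c"
      using mult
    proof
      assume "norm (multiplier f n p) < 1"
      then show ?thesis using signature_shift_attracting[OF signature_attracting_cycle[OF nb c] \<beta>] by blast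
    next
      assume "norm (multiplier f n p) = 1"
      then have "multiplier f n p \<noteq> 0" by auto
      then show ?thesis by (rule signature_shift_backward[OF base _ \<beta>])
    qed
  qed
qed

text \<open>\<open>C\<close> collects the critical points of nontrivial signature; irregularity
  enters through \<open>ne\<close> and makes it nonempty.\<close>

lemma attracting_signatures:
  assumes mult: "norm (multiplier f n p) < 1" and nb: "nbhd S f d x U" and fin: "finite (critical_points S f)"
    and ne: "\<exists>c\<in>critical_points S f. signature S f d x c \<noteq> {class_of (\<lambda>_. False)}"
  shows "\<exists>C k. finite C \<and> C \<noteq> {} \<and> C \<subseteq> critical_points S f \<and>
    (\<forall>c\<in>C. k c < n \<and> signature S f d x c = shift (int (k c)) ` alpha (class_of (sq n))) \<and>
    (\<forall>c\<in>critical_points S f - C. signature S f d x c = {class_of (\<lambda>_. False)})"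
proof -
  define C where "C = {c \<in> critical_points S f. signature S f d x c \<noteq> {class_of (\<lambda>_. False)}}"
  have "\<exists>k<n. signature S f d x c = shift (int k) ` alpha (class_of (sq n))" if "c \<in> C" for c
  proof -
    have "\<exists>i. signature S f d x c = alpha (class_of (\<lambda>j. j mod n = i mod n))"
      using signature_attracting_cycle[OF nb _ mult, of c] that by (auto simp: C_def)
    then obtain i where "signature S f d x c = alpha (class_of (\<lambda>j. j mod n = i mod n))" by blast
    then have "signature S f d x c = shift (int (Suc i mod n)) ` alpha (class_of (sq n))"
      using residue_eq_shift_sq[OF n_pos] by simp
    moreover have "Suc i mod n < n" using n_pos by simp
    ultimately show ?thesis by blast
  qed
  then obtain k where "\<And>c. c \<in> C \<Longrightarrow> k c < n \<and> signature S f d x c = shift (int (k c)) ` alpha (class_of (sq n))"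
    by metis
  moreover have "finite C" "C \<subseteq> critical_points S f" using fin by (auto simp: C_def)
  moreover have "C \<noteq> {}" using ne by (auto simp: C_def)
  moreover have "\<forall>c\<in>critical_points S f - C. signature S f d x c = {class_of (\<lambda>_. False)}" by (auto simp: C_def)
  ultimately show ?thesis by (intro exI[of _ C] exI[of _ k] conjI ballI) blast+
qed

lemma parabolic_signature:
  assumes par: "parabolic f n p" and nb: "nbhd S f d x U"
  shows "\<exists>c\<in>critical_points S f. \<exists>k<n. signature S f d x c = shift (int k) ` alpha (class_of (sq n))"
proof -
  obtain c i where c: "c \<in> critical_points S f" "attracted c i" and
    ev: "\<forall>r0 B r. disk_base r0 B \<longrightarrow> 0 < r \<longrightarrow> r \<le> r0 \<longrightarrow>
      (\<forall>\<^sub>F l in sequentially. l mod n = i mod n \<longrightarrow> c \<in> B r l)"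
    by (rule parabolic_critical_point[OF par nb])
  obtain r0 B where base: "disk_base r0 B" using disk_base_exists[OF nb] by blast
  have "c \<in> S" using c(1) by (simp add: critical_points_def)
  then have "signature S f d x c = alpha (class_of (\<lambda>j. j mod n = i mod n))"
    using signature_attracted[OF base _ c(2)] ev base by blast
  then have "signature S f d x c = shift (int (Suc i mod n)) ` alpha (class_of (sq n))"
    using residue_eq_shift_sq[OF n_pos] by simp
  moreover have "Suc i mod n < n" using n_pos by simp
  ultimately show ?thesis using c(1) by blast
qed

text \<open>From \<open>has_plaque_base\<close> a single plaque is drawn; every base in the argument
  consists of shrinkings of it.\<close>

lemma signature_classification:
  assumes rational: "rational_on S f"
  shows
    "(repelling f n p \<or> siegel f n p \<longrightarrow>
        regular_point S f d x \<and>
        (\<forall>c\<in>critical_points S f. signature S f d x c = {class_of (\<lambda>_. False)})) \<and>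
     (attracting f n p \<or> super_attracting f n p \<or> parabolic f n p \<or> cremer f n p \<longrightarrow>
        irregular_point S f d x \<and>
        (has_plaque_base S f d x \<longrightarrow>
          (\<exists>c\<in>critical_points S f. signature S f d x c \<noteq> {class_of (\<lambda>_. False)}) \<and>
          (\<forall>c\<in>critical_points S f.
             signature S f d x c = shift (int n) ` signature S f d x c \<and>
             signature S f d x c = shift (- int n) ` signature S f d x c))) \<and>
     (attracting f n p \<or> super_attracting f n p \<longrightarrow>
        has_plaque_base S f d x \<longrightarrow>
        (\<exists>C k. finite C \<and> C \<noteq> {} \<and> C \<subseteq> critical_points S f \<and>
          (\<forall>c\<in>C. k c < n \<and>
             signature S f d x c = shift (int (k c)) ` alpha (class_of (sq n))) \<and>
          (\<forall>c\<in>critical_points S f - C. signature S f d x c = {class_of (\<lambda>_. False)}))) \<and>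
     (parabolic f n p \<longrightarrow>
        has_plaque_base S f d x \<longrightarrow>
        (\<exists>c\<in>critical_points S f. \<exists>k<n.
          signature S f d x c = shift (int k) ` alpha (class_of (sq n))))"
proof (intro conjI impI)
  assume "repelling f n p \<or> siegel f n p"
  then show "regular_point S f d x" "\<forall>c\<in>critical_points S f. signature S f d x c = {class_of (\<lambda>_. False)}"
    using regular_if_repelling regular_if_siegel by blast+
next
  have fin: "finite (critical_points S f)" by (rule finite_critical_points[OF rational])
  have small: "norm (multiplier f n p) < 1" if "attracting f n p \<or> super_attracting f n p"
    using that by (auto simp: attracting_def super_attracting_def)
  have irr: "\<not> regular_point S f d x"
    if "attracting f n p \<or> super_attracting f n p \<or> parabolic f n p \<or> cremer f n p"
    using that irregular_if_attracting[OF small] irregular_if_parabolic irregular_if_cremer by blast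
  have nontriv: "\<exists>c\<in>critical_points S f. signature S f d x c \<noteq> {class_of (\<lambda>_. False)}"
    if "attracting f n p \<or> super_attracting f n p \<or> parabolic f n p \<or> cremer f n p" and nb: "nbhd S f d x U" for U
  proof -
    obtain r0 B where base: "disk_base r0 B" using disk_base_exists[OF nb] by blast
    show ?thesis using signature_nontrivial[OF base irr[OF that(1)] fin] by blast
  qed
  {
    assume *: "attracting f n p \<or> super_attracting f n p \<or> parabolic f n p \<or> cremer f n p"
    show "irregular_point S f d x" using irr[OF *] x_limit by (simp add: irregular_point_def)
    assume "has_plaque_base S f d x"
    then obtain U where nb: "nbhd S f d x U" using has_plaque_base_iff by blast
    show "\<exists>c\<in>critical_points S f. signature S f d x c \<noteq> {class_of (\<lambda>_. False)}" by (rule nontriv[OF * nb])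
    have "norm (multiplier f n p) < 1 \<or> norm (multiplier f n p) = 1"
      using * small by (auto simp: parabolic_def cremer_def neutral_with_angle_def)
    then show "\<forall>c\<in>critical_points S f. signature S f d x c = shift (int n) ` signature S f d x c \<and>
        signature S f d x c = shift (- int n) ` signature S f d x c"
      using shift_invariant_signature[OF nb] by blast
  next
    assume *: "attracting f n p \<or> super_attracting f n p" and "has_plaque_base S f d x"
    then obtain U where nb: "nbhd S f d x U" using has_plaque_base_iff by blast
    show "\<exists>C k. finite C \<and> C \<noteq> {} \<and> C \<subseteq> critical_points S f \<and>
          (\<forall>c\<in>C. k c < n \<and> signature S f d x c = shift (int (k c)) ` alpha (class_of (sq n))) \<and>
          (\<forall>c\<in>critical_points S f - C. signature S f d x c = {class_of (\<lambda>_. False)})"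
      using attracting_signatures[OF small[OF *] nb fin] nontriv[OF _ nb] * by blast
  next
    assume "parabolic f n p" "has_plaque_base S f d x"
    then show "\<exists>c\<in>critical_points S f. \<exists>k<n. signature S f d x c = shift (int k) ` alpha (class_of (sq n))"
      using parabolic_signature has_plaque_base_iff by blast
  }
qed

end

theorem theorem33:
  fixes S :: "complex option set" and f :: "complex option \<Rightarrow> complex option"
    and d n :: nat and p x :: "nat \<Rightarrow> complex option"
  assumes S: "S = UNIV \<or> S = range Some \<or> S = Some ` ball 0 1"
    and rational: "rational_on S f"
    and degree: "1 < d"
    and covering: "branched_covering S f d"
    and cycle: "periodic_cycle S f n p"
    and lift: "x = invariant_lift n p"
  shows
    "(repelling f n p \<or> siegel f n p \<longrightarrow>
        regular_point S f d x \<and>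
        (\<forall>c\<in>critical_points S f. signature S f d x c = {class_of (\<lambda>_. False)})) \<and>
     (attracting f n p \<or> super_attracting f n p \<or> parabolic f n p \<or> cremer f n p \<longrightarrow>
        irregular_point S f d x \<and>
        (has_plaque_base S f d x \<longrightarrow>
          (\<exists>c\<in>critical_points S f. signature S f d x c \<noteq> {class_of (\<lambda>_. False)}) \<and>
          (\<forall>c\<in>critical_points S f.
             signature S f d x c = shift (int n) ` signature S f d x c \<and>
             signature S f d x c = shift (- int n) ` signature S f d x c))) \<and>
     (attracting f n p \<or> super_attracting f n p \<longrightarrow>
        has_plaque_base S f d x \<longrightarrow>
        (\<exists>C k. finite C \<and> C \<noteq> {} \<and> C \<subseteq> critical_points S f \<and>
          (\<forall>c\<in>C. k c < n \<and>
             signature S f d x c = shift (int (k c)) ` alpha (class_of (sq n))) \<and>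
          (\<forall>c\<in>critical_points S f - C. signature S f d x c = {class_of (\<lambda>_. False)}))) \<and>
     (parabolic f n p \<longrightarrow>
        has_plaque_base S f d x \<longrightarrow>
        (\<exists>c\<in>critical_points S f. \<exists>k<n.
          signature S f d x c = shift (int k) ` alpha (class_of (sq n))))"
  unfolding lift
  by (rule covering_cycle.signature_classification[OF _ rational])
    (intro covering_cycle.intro sphere_covering.intro covering_cycle_axioms.intro S degree covering cycle)

end
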